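(* If $G$ is a non-elementary, finitely generated group and $\mathcal{X}$ is a quasi-convex, CAT(0) $G$-space such that $G$ contains an element that acts as a rank 1 isometry on $\mathcal{X}$, then $G\curvearrowright\mathcal{X}$ is a growth tight action.
   Context: A group is elementary if it has a finite index cyclic subgroup. A $G$-space is a proper, geodesic metric space $(\mathcal{X},d)$ with a properly discontinuous, isometric action of $G$. It is quasi-convex if for some $C\geqslant0$ it contains a $G$-orbit $\mathcal{O}$ such that any two points of $\mathcal{O}$ are joined by a geodesic contained in the closed $C$-neighborhood of $\mathcal{O}$. An isometry $\phi$ of a CAT(0) space $\mathcal{X}$ is hyperbolic if $\inf_{x\in\mathcal{X}}d(x,\phi(x))$ is positive and attained. A hyperbolic isometry of a proper CAT(0) space is rank 1 if it has an axis that does not bound a half-flat (an isometrically embedded Euclidean half-plane). Growth: fix $o\in\mathcal{X}$ and let $\delta_G:=\limsup_{r\to\infty}\frac1r\log\#\{g\in G\mid d(o,g.o)\leqslant r\}$. For a normal subgroup $\Gamma$, let $\bar d(g\Gamma,g'\Gamma):=\inf_{\gamma,\gamma'\in\Gamma}d(g\gamma.o,g'\gamma'.o)$ and $\delta_{G/\Gamma}:=\limsup_{r\to\infty}\frac1r\log\#\{g\Gamma\in G/\Gamma\mid \bar d(\Gamma,g\Gamma)\leqslant r\}$. The action is growth tight if $\delta_G>\delta_{G/\Gamma}$ for every infinite normal subgroup $\Gamma$ of $G$. *)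

theory Defs
  imports "HOL-Analysis.Analysis" "HOL-Algebra.Group_Action" "HOL-Algebra.Elementary_Groups"
begin

definition finitely_generated :: "('g, 'm) monoid_scheme \<Rightarrow> bool" where
  "finitely_generated G \<longleftrightarrow> (\<exists>S. finite S \<and> S \<subseteq> carrier G \<and> generate G S = carrier G)"

definition elementary :: "('g, 'm) monoid_scheme \<Rightarrow> bool" where
  "elementary G \<longleftrightarrow>
     (\<exists>H. subgroup H G \<and> cyclic_group (G\<lparr>carrier := H\<rparr>) \<and> finite (rcosets\<^bsub>G\<^esub> H))"

text \<open>The path \<open>c\<close> is parametrised by arc length and is only relevant on \<open>{0..dist x y}\<close>.\<close>

definition geodesic_path :: "(real \<Rightarrow> 'x::metric_space) \<Rightarrow> 'x \<Rightarrow> 'x \<Rightarrow> bool" where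
  "geodesic_path c x y \<longleftrightarrow>
     c 0 = x \<and> c (dist x y) = y \<and>
     (\<forall>s\<in>{0..dist x y}. \<forall>t\<in>{0..dist x y}. dist (c s) (c t) = \<bar>s - t\<bar>)"

definition geodesic_segment :: "'x::metric_space set \<Rightarrow> 'x \<Rightarrow> 'x \<Rightarrow> bool" where
  "geodesic_segment S x y \<longleftrightarrow> (\<exists>c. geodesic_path c x y \<and> S = c ` {0..dist x y})"

definition geodesic_space :: "'x::metric_space itself \<Rightarrow> bool" where
  "geodesic_space T \<longleftrightarrow> (\<forall>x y :: 'x. \<exists>S. geodesic_segment S x y)"

definition proper_space :: "'x::metric_space itself \<Rightarrow> bool" where
  "proper_space T \<longleftrightarrow> (\<forall>(x :: 'x) r. compact (cball x r))"

text \<open>\<open>p'\<close> is the point of the Euclidean segment from \<open>x'\<close> to \<open>y'\<close> corresponding to the point \<open>p\<close>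
  of the geodesic segment \<open>S\<close> from \<open>x\<close> to \<open>y\<close>.\<close>

definition comparison_point ::
  "'x::metric_space set \<Rightarrow> 'x \<Rightarrow> real^2 \<Rightarrow> real^2 \<Rightarrow> 'x \<Rightarrow> real^2 \<Rightarrow> bool" where
  "comparison_point S x x' y' p p' \<longleftrightarrow>
     p \<in> S \<and> p' \<in> closed_segment x' y' \<and> dist x' p' = dist x p"

definition CAT0_space :: "'x::metric_space itself \<Rightarrow> bool" where
  "CAT0_space T \<longleftrightarrow> geodesic_space T \<and>
     (\<forall>(x :: 'x) y z S1 S2 S3 x' y' z'.
        geodesic_segment S1 x y \<and> geodesic_segment S2 y z \<and> geodesic_segment S3 z x \<and>
        dist x' y' = dist x y \<and> dist y' z' = dist y z \<and> dist z' x' = dist z x \<longrightarrow>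
        (let cmp = (\<lambda>p p'. comparison_point S1 x x' y' p p' \<or>
                           comparison_point S2 y y' z' p p' \<or>
                           comparison_point S3 z z' x' p p')
         in \<forall>p p' q q'. cmp p p' \<and> cmp q q' \<longrightarrow> dist p q \<le> dist p' q'))"

definition isometric_embedding_on ::
  "'a::metric_space set \<Rightarrow> ('a \<Rightarrow> 'b::metric_space) \<Rightarrow> bool" where
  "isometric_embedding_on A f \<longleftrightarrow> (\<forall>x\<in>A. \<forall>y\<in>A. dist (f x) (f y) = dist x y)"

definition hyperbolic_isometry :: "('x::metric_space \<Rightarrow> 'x) \<Rightarrow> bool" where
  "hyperbolic_isometry f \<longleftrightarrow> bij f \<and> isometric_embedding_on UNIV f \<and>
     (INF x. dist x (f x)) > 0 \<and> (\<exists>x. dist x (f x) = (INF y. dist y (f y)))"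

definition is_axis :: "('x::metric_space \<Rightarrow> 'x) \<Rightarrow> 'x set \<Rightarrow> bool" where
  "is_axis f L \<longleftrightarrow>
     (\<exists>(c :: real \<Rightarrow> 'x) a. isometric_embedding_on UNIV c \<and> a > 0 \<and>
        (\<forall>t. f (c t) = c (t + a)) \<and> L = range c)"

definition bounds_half_flat :: "'x::metric_space set \<Rightarrow> bool" where
  "bounds_half_flat L \<longleftrightarrow>
     (\<exists>h :: real^2 \<Rightarrow> 'x. isometric_embedding_on {v. v $ 2 \<ge> 0} h \<and> h ` {v. v $ 2 = 0} = L)"

definition rank_one_isometry :: "('x::metric_space \<Rightarrow> 'x) \<Rightarrow> bool" where
  "rank_one_isometry f \<longleftrightarrow>
     hyperbolic_isometry f \<and> (\<exists>L. is_axis f L \<and> \<not> bounds_half_flat L)"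

locale G_space = group_action G "UNIV :: 'x set" \<phi>
  for G :: "('g, 'm) monoid_scheme" (structure) and \<phi> :: "'g \<Rightarrow> 'x::metric_space \<Rightarrow> 'x" +
  assumes proper: "proper_space TYPE('x)"
    and geodesic: "geodesic_space TYPE('x)"
    and isometric: "g \<in> carrier G \<Longrightarrow> dist (\<phi> g x) (\<phi> g y) = dist x y"
    and properly_discontinuous:
      "compact K \<Longrightarrow> finite {g \<in> carrier G. \<phi> g ` K \<inter> K \<noteq> {}}"

definition quasi_convex ::
  "('g, 'm) monoid_scheme \<Rightarrow> ('g \<Rightarrow> 'x::metric_space \<Rightarrow> 'x) \<Rightarrow> bool" where
  "quasi_convex G \<phi> \<longleftrightarrow>
     (\<exists>C\<ge>0. \<exists>x. let \<O> = orbit G \<phi> x in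
        \<forall>y\<in>\<O>. \<forall>z\<in>\<O>. \<exists>S. geodesic_segment S y z \<and> (\<forall>p\<in>S. infdist p \<O> \<le> C))"

text \<open>For a \<open>G\<close>-space all the sets counted below are finite, by proper discontinuity; for
  \<open>r \<ge> 0\<close> they contain the identity (coset), so the logarithms are of positive numbers.\<close>

definition growth_exponent ::
  "('g, 'm) monoid_scheme \<Rightarrow> ('g \<Rightarrow> 'x::metric_space \<Rightarrow> 'x) \<Rightarrow> 'x \<Rightarrow> ereal" where
  "growth_exponent G \<phi> b =
     Limsup at_top (\<lambda>r::real. ereal (1 / r * ln (real (card
       {g \<in> carrier G. dist b (\<phi> g b) \<le> r}))))"

text \<open>For \<open>A = g\<Gamma>\<close> and \<open>B = g'\<Gamma>\<close> this is the infimum of \<open>d(g\<gamma>.b, g'\<gamma>'.b)\<close>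
  over \<open>\<gamma>, \<gamma>' \<in> \<Gamma>\<close>.\<close>

definition coset_dist :: "('g \<Rightarrow> 'x::metric_space \<Rightarrow> 'x) \<Rightarrow> 'x \<Rightarrow> 'g set \<Rightarrow> 'g set \<Rightarrow> real" where
  "coset_dist \<phi> b A B = (INF (g, g') \<in> A \<times> B. dist (\<phi> g b) (\<phi> g' b))"

definition quotient_growth_exponent ::
  "('g, 'm) monoid_scheme \<Rightarrow> ('g \<Rightarrow> 'x::metric_space \<Rightarrow> 'x) \<Rightarrow> 'x \<Rightarrow> 'g set \<Rightarrow> ereal" where
  "quotient_growth_exponent G \<phi> b \<Gamma> =
     Limsup at_top (\<lambda>r::real. ereal (1 / r * ln (real (card
       {A \<in> carrier (G Mod \<Gamma>). coset_dist \<phi> b \<Gamma> A \<le> r}))))"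

definition growth_tight ::
  "('g, 'm) monoid_scheme \<Rightarrow> ('g \<Rightarrow> 'x::metric_space \<Rightarrow> 'x) \<Rightarrow> 'x \<Rightarrow> bool" where
  "growth_tight G \<phi> b \<longleftrightarrow>
     (\<forall>\<Gamma>. \<Gamma> \<lhd> G \<and> infinite \<Gamma> \<longrightarrow>
        growth_exponent G \<phi> b > quotient_growth_exponent G \<phi> b \<Gamma>)"

end

theory Submission
  imports Defs
begin

text \<open>An axis \<open>L\<close> of a rank 1 isometry \<open>g\<close> is contracting: otherwise there are far-away geodesics with long projection
  to \<open>L\<close>; by averaging they contain pieces spanning almost flat strips over \<open>L\<close>, and these accumulate,
  after translation by powers of \<open>g\<close>, at a half-flat bounded by \<open>L\<close>. As \<open>G\<close> is not elementary, an infinite normal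
  subgroup \<open>N\<close> contains \<open>\<gamma>\<close> such that \<open>L\<close> and \<open>\<gamma> L\<close> have bounded projections to each other. The conjugate
  of \<open>\<gamma>\<close> by a high power of \<open>g\<close> can be used to shorten every group element whose geodesic follows its
  path. Hence shortest representatives of cosets of \<open>N\<close> avoid that path, and for a suitable \<open>f\<close> in \<open>N\<close> built from
  such conjugates the products \<open>x\<^sub>1 f x\<^sub>2 f ... x\<^sub>k f\<close> of well-separated shortest representatives are pairwise distinct.
  By quasi-convexity the growth of \<open>G/N\<close> is submultiplicative, so its Poincare series diverges at the
  critical exponent, and the free products push the exponent of \<open>G\<close> strictly above it.\<close>

section \<open>CAT(0) geometry\<close>

text \<open>The strict inequality is the difficulty. Each inserted copy of \<open>f\<close>
  multiplies the weight of a word by \<open>exp (- s * len f)\<close>, a fixed loss, so the sum over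
  the letters has to exceed a prescribed bound at the exponent \<open>s\<close> itself; divergence
  below \<open>s\<close> would only give a weak inequality. Hence \<open>s\<close> is taken as an
  infimum of rates of balls, and submultiplicativity is what ties it to the growth of the quotient.
  If the quotient is finite, there are no long letters at all, and a free semigroup made from
  conjugates of powers of \<open>g\<close> shows instead that the growth of \<open>G\<close> is
  positive.

  Unique decoding of the words is the other difficulty: a shortest letter may backtrack along the
  beginning or the end of \<open>f\<close>, and one letter may look like another one followed by
  \<open>f\<close>. The outer two bumps of \<open>f\<close> control the backtracking, the middle one
  excludes the second coincidence. All three arguments shorten a representative by an element of the
  normal subgroup, which normality allows to be inserted anywhere in a product.\<close>

lemma euclidean_triangle_exists:
  fixes a b c :: real
  assumes "0 \<le> a" "0 \<le> b" "0 \<le> c" "a \<le> b + c" "b \<le> c + a" "c \<le> a + b"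
  obtains x y z :: "real^2" where "dist x y = a" "dist y z = b" "dist z x = c"
proof (cases "a = 0")
  case True
  hence bc: "b = c" using assms by simp
  have "dist (0::real^2) 0 = a" using True by simp
  moreover have "dist (0::real^2) (b *\<^sub>R axis 1 1) = b" using assms by (simp add: norm_axis_1)
  moreover have "dist (b *\<^sub>R axis 1 1) (0::real^2) = c" using assms bc by (simp add: norm_axis_1)
  ultimately show ?thesis using that by blast
next
  case False
  hence a: "a > 0" using assms by simp
  \<comment> \<open>The third vertex has first coordinate \<open>u\<close> by the law of
    cosines.\<close>
  define u where "u = (a\<^sup>2 + c\<^sup>2 - b\<^sup>2) / (2 * a)"
  have ua: "2 * a * u = a\<^sup>2 + c\<^sup>2 - b\<^sup>2" using a by (simp add: u_def)
  \<comment> \<open>This is Heron's factorisation of sixteen times the squared area.\<close>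
  have "4 * a\<^sup>2 * (c\<^sup>2 - u\<^sup>2) = (2*a*c)\<^sup>2 - (2*a*u)\<^sup>2" by (simp add: algebra_simps power2_eq_square)
  also have "\<dots> = ((a + c)\<^sup>2 - b\<^sup>2) * (b\<^sup>2 - (a - c)\<^sup>2)"
    unfolding ua by (simp add: algebra_simps power2_eq_square)
  also have "\<dots> \<ge> 0"
  proof (rule mult_nonneg_nonneg)
    show "0 \<le> (a + c)\<^sup>2 - b\<^sup>2" using assms by (simp add: power_mono)
    have "\<bar>a - c\<bar>\<^sup>2 \<le> b\<^sup>2" using assms by (intro power_mono) auto
    thus "0 \<le> b\<^sup>2 - (a - c)\<^sup>2" by simp
  qed
  finally have cu: "c\<^sup>2 - u\<^sup>2 \<ge> 0" using a by (simp add: zero_le_mult_iff)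
  define w where "w = sqrt (c\<^sup>2 - u\<^sup>2)"
  have w2: "w\<^sup>2 = c\<^sup>2 - u\<^sup>2" using cu by (simp add: w_def)
  let ?x = "0 :: real^2" and ?y = "vector [a, 0] :: real^2" and ?z = "vector [u, w] :: real^2"
  have "dist ?x ?y = a" using a by (simp add: dist_vec_def L2_set_def UNIV_2 vector_def)
  moreover have "dist ?y ?z = b"
  proof -
    have "(a - u)\<^sup>2 + w\<^sup>2 = b\<^sup>2" using ua w2 by (simp add: power2_diff)
    thus ?thesis using assms by (simp add: dist_vec_def L2_set_def UNIV_2 vector_def dist_real_def)
  qed
  moreover have "dist ?z ?x = c"
    using w2 assms by (simp add: dist_vec_def L2_set_def UNIV_2 vector_def dist_real_def)
  ultimately show ?thesis using that by blast
qed

lemma euclidean_stewart: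
  fixes x y z :: "'a::real_inner"
  shows "(dist x (y + l *\<^sub>R (z - y)))\<^sup>2 = (1 - l) * (dist x y)\<^sup>2 + l * (dist x z)\<^sup>2 - l * (1 - l) * (dist y z)\<^sup>2"
  unfolding dist_norm power2_norm_eq_inner
  by (simp add: inner_simps algebra_simps inner_commute)

locale proper_CAT0 =
  fixes T :: "'x::metric_space itself"
  assumes CAT0: "CAT0_space T" and proper: "proper_space T"
begin

lemma geodesic_ex: obtains c where "geodesic_path c (x::'x) y"
  using CAT0 unfolding CAT0_space_def geodesic_space_def geodesic_segment_def by blast

lemma between_ex:
  assumes "0 \<le> t" "t \<le> dist (x::'x) y"
  obtains m where "dist x m = t" "dist m y = dist x y - t"
proof -
  obtain c where c: "geodesic_path c x y" by (rule geodesic_ex)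
  have iso: "\<And>s t. s \<in> {0..dist x y} \<Longrightarrow> t \<in> {0..dist x y} \<Longrightarrow> dist (c s) (c t) = \<bar>s - t\<bar>"
    and e: "c 0 = x" "c (dist x y) = y"
    using c unfolding geodesic_path_def by auto
  have "dist (c 0) (c t) = t" "dist (c t) (c (dist x y)) = dist x y - t"
    using iso[of 0 t] iso[of t "dist x y"] assms by auto
  thus ?thesis using that[of "c t"] e by simp
qed

lemma fraction_ex:
  assumes "0 \<le> l" "l \<le> 1"
  obtains m where "dist (x::'x) m = l * dist x y" "dist m y = (1 - l) * dist x y"
proof -
  have "l * dist x y \<le> dist x y" using mult_right_mono[OF assms(2), of "dist x y"] by simp
  moreover have "0 \<le> l * dist x y" using assms by simp
  ultimately obtain m where "dist x m = l * dist x y" "dist m y = dist x y - l * dist x y"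
    by (metis between_ex)
  thus ?thesis using that by (simp add: left_diff_distrib)
qed

text \<open>This is the inequality of Bruhat and Tits for an arbitrary fraction \<open>l\<close>:
  compare a vertex and a point of the opposite side with the Euclidean triangle, where Stewart's
  theorem is an equality. Apart from the existence of geodesics, the later geometry uses the CAT(0)
  condition only through it.\<close>

lemma CN_aux:
  assumes l: "0 \<le> l" "l \<le> 1"
  obtains m where "dist (y::'x) m = l * dist y z" "dist m z = (1 - l) * dist y z"
    "\<And>x. (dist x m)\<^sup>2 \<le> (1 - l) * (dist x y)\<^sup>2 + l * (dist x z)\<^sup>2 - l * (1 - l) * (dist y z)\<^sup>2"
proof -
  obtain c where c: "geodesic_path c y z" by (rule geodesic_ex)
  have ld: "l * dist y z \<in> {0..dist y z}" using l mult_right_mono[OF l(2), of "dist y z"] by simp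
  define m where "m = c (l * dist y z)"
  have m1: "dist y m = l * dist y z"
  proof -
    have "dist (c 0) m = \<bar>0 - l * dist y z\<bar>" unfolding m_def using c ld
      unfolding geodesic_path_def by (metis atLeastAtMost_iff order_refl zero_le_dist)
    thus ?thesis using c l unfolding geodesic_path_def by simp
  qed
  have m2: "dist m z = (1 - l) * dist y z"
  proof -
    have "dist m (c (dist y z)) = \<bar>l * dist y z - dist y z\<bar>" unfolding m_def using c ld
      unfolding geodesic_path_def by (metis atLeastAtMost_iff order_refl zero_le_dist)
    thus ?thesis using c ld unfolding geodesic_path_def by (simp add: algebra_simps)
  qed
  have "(dist x m)\<^sup>2 \<le> (1 - l) * (dist x y)\<^sup>2 + l * (dist x z)\<^sup>2 - l * (1 - l) * (dist y z)\<^sup>2" for x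
  proof -
    obtain c1 where c1: "geodesic_path c1 x y" by (rule geodesic_ex)
    obtain c3 where c3: "geodesic_path c3 z x" by (rule geodesic_ex)
    obtain x' y' z' :: "real^2" where e: "dist x' y' = dist x y" "dist y' z' = dist y z" "dist z' x' = dist z x"
      by (rule euclidean_triangle_exists[of "dist x y" "dist y z" "dist z x"])
        (auto simp: dist_triangle dist_triangle2 dist_triangle3 dist_commute add.commute)
    define m' where "m' = y' + l *\<^sub>R (z' - y')"
    let ?S1 = "c1 ` {0..dist x y}" and ?S2 = "c ` {0..dist y z}" and ?S3 = "c3 ` {0..dist z x}"
    have S: "geodesic_segment ?S1 x y" "geodesic_segment ?S2 y z" "geodesic_segment ?S3 z x"
      using c c1 c3 unfolding geodesic_segment_def by blast+
    have k1: "comparison_point ?S2 y y' z' m m'"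
      unfolding comparison_point_def
    proof (intro conjI)
      show "m \<in> ?S2" using ld by (auto simp: m_def)
      show "m' \<in> closed_segment y' z'" using l unfolding m'_def closed_segment_def
        by (auto simp: algebra_simps intro!: exI[of _ l])
      have "dist y' m' = l * dist y' z'" using l by (simp add: m'_def dist_norm norm_minus_commute)
      thus "dist y' m' = dist y m" using m1 e by simp
    qed
    have k2: "comparison_point ?S1 x x' y' x x'"
      using c1 unfolding comparison_point_def geodesic_path_def
      by (auto intro!: image_eqI[of _ _ 0])
    have "dist x m \<le> dist x' m'"
      using CAT0 S e k1 k2 unfolding CAT0_space_def Let_def by blast
    hence "(dist x m)\<^sup>2 \<le> (dist x' m')\<^sup>2" by (intro power_mono) auto
    also have "\<dots> = (1 - l) * (dist x' y')\<^sup>2 + l * (dist x' z')\<^sup>2 - l * (1 - l) * (dist y' z')\<^sup>2"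
      unfolding m'_def by (rule euclidean_stewart)
    finally show ?thesis using e by (simp add: dist_commute)
  qed
  thus ?thesis using that m1 m2 by blast
qed

text \<open>The right side of the CN inequality vanishes at any point with these two
  distances.\<close>

lemma fraction_unique:
  assumes l: "0 \<le> l" "l \<le> 1"
    and "dist (y::'x) m = l * dist y z" "dist m z = (1 - l) * dist y z"
    and "dist y m' = l * dist y z" "dist m' z = (1 - l) * dist y z"
  shows "m = m'"
proof -
  obtain n where n: "\<And>x. (dist x n)\<^sup>2 \<le> (1 - l) * (dist x y)\<^sup>2 + l * (dist x z)\<^sup>2 - l * (1 - l) * (dist y z)\<^sup>2"
    using CN_aux[OF l] by metis
  have "k = n" if "dist y k = l * dist y z" "dist k z = (1 - l) * dist y z" for k
  proof -
    have "(dist k n)\<^sup>2 \<le> (1 - l) * (l * dist y z)\<^sup>2 + l * ((1 - l) * dist y z)\<^sup>2 - l * (1 - l) * (dist y z)\<^sup>2"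
      using n[of k] that by (simp add: dist_commute)
    also have "\<dots> = 0" by (simp add: power2_eq_square algebra_simps)
    finally show ?thesis by simp
  qed
  thus ?thesis using assms by metis
qed

lemma CN_inequality:
  assumes l: "0 \<le> l" "l \<le> 1"
    and "dist (y::'x) m = l * dist y z" "dist m z = (1 - l) * dist y z"
  shows "(dist x m)\<^sup>2 \<le> (1 - l) * (dist x y)\<^sup>2 + l * (dist x z)\<^sup>2 - l * (1 - l) * (dist y z)\<^sup>2"
  using CN_aux[OF l, of y z] fraction_unique[OF l] assms by metis

lemma quadrilateral:
  "(dist (a::'x) c)\<^sup>2 + (dist b d)\<^sup>2 \<le> (dist a b)\<^sup>2 + (dist b c)\<^sup>2 + (dist c d)\<^sup>2 + (dist d a)\<^sup>2"
proof -
  have half: "0 \<le> (1/2::real)" "(1/2::real) \<le> 1" by auto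
  obtain m where m: "dist a m = 1/2 * dist a c" "dist m c = (1 - 1/2) * dist a c"
    using fraction_ex[OF half] by metis
  obtain n where n: "dist b n = 1/2 * dist b d" "dist n d = (1 - 1/2) * dist b d"
    using fraction_ex[OF half] by metis
  define ab bc cd da ac bd mb md where defs: "ab = (dist a b)\<^sup>2" "bc = (dist b c)\<^sup>2" "cd = (dist c d)\<^sup>2"
    "da = (dist d a)\<^sup>2" "ac = (dist a c)\<^sup>2" "bd = (dist b d)\<^sup>2" "mb = (dist m b)\<^sup>2" "md = (dist m d)\<^sup>2"
  have "mb \<le> ab / 2 + bc / 2 - ac / 4" "md \<le> da / 2 + cd / 2 - ac / 4"
    "(dist m n)\<^sup>2 \<le> mb / 2 + md / 2 - bd / 4"
    using CN_inequality[OF half m, of b] CN_inequality[OF half m, of d] CN_inequality[OF half n, of m]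
    unfolding defs by (simp_all add: dist_commute)
  moreover have "0 \<le> (dist m n)\<^sup>2" by simp
  ultimately show ?thesis unfolding defs[symmetric] by linarith
qed

text \<open>Two applications of the CN inequality, one on each side at \<open>x\<close>, add up to a
  perfect square.\<close>

lemma dist_fractions_vertex:
  assumes l: "0 \<le> l" "l \<le> 1"
    and p: "dist (x::'x) p = l * dist x y" "dist p y = (1 - l) * dist x y"
    and q: "dist x q = l * dist x z" "dist q z = (1 - l) * dist x z"
  shows "dist p q \<le> l * dist y z"
proof -
  have 1: "(dist z p)\<^sup>2 \<le> (1 - l) * (dist z x)\<^sup>2 + l * (dist z y)\<^sup>2 - l * (1 - l) * (dist x y)\<^sup>2"
    by (rule CN_inequality[OF l p])
  have "(dist p q)\<^sup>2 \<le> (1 - l) * (dist p x)\<^sup>2 + l * (dist p z)\<^sup>2 - l * (1 - l) * (dist x z)\<^sup>2"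
    by (rule CN_inequality[OF l q])
  also have "\<dots> \<le> (1 - l) * (l * dist x y)\<^sup>2 + l * ((1 - l) * (dist z x)\<^sup>2 + l * (dist z y)\<^sup>2 - l * (1 - l) * (dist x y)\<^sup>2)
      - l * (1 - l) * (dist x z)\<^sup>2"
    using p 1 l by (intro diff_mono add_mono mult_left_mono) (auto simp: dist_commute)
  also have "\<dots> = (l * dist y z)\<^sup>2" by (simp add: power2_eq_square algebra_simps dist_commute)
  finally show ?thesis using l by (simp add: abs_le_square_iff[symmetric] abs_mult)
qed

text \<open>Convexity of the metric: the diagonal from \<open>x\<close> to \<open>y'\<close> cuts
  the quadrilateral into two triangles, each treated by
  \<open>dist_fractions_vertex\<close>.\<close>

lemma dist_fractions:
  assumes l: "0 \<le> l" "l \<le> 1"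
    and p: "dist (x::'x) p = l * dist x y" "dist p y = (1 - l) * dist x y"
    and q: "dist x' q = l * dist x' y'" "dist q y' = (1 - l) * dist x' y'"
  shows "dist p q \<le> (1 - l) * dist x x' + l * dist y y'"
proof -
  obtain r where r: "dist x r = l * dist x y'" "dist r y' = (1 - l) * dist x y'"
    using fraction_ex[OF l] by metis
  have "dist p r \<le> l * dist y y'" by (rule dist_fractions_vertex[OF l p r])
  moreover have "dist r q \<le> (1 - l) * dist x x'"
  proof (rule dist_fractions_vertex)
    show "dist y' r = (1 - l) * dist y' x" "dist r x = (1 - (1 - l)) * dist y' x"
      "dist y' q = (1 - l) * dist y' x'" "dist q x' = (1 - (1 - l)) * dist y' x'"
      using r q by (simp_all add: dist_commute)
  qed (use l in auto)
  ultimately show ?thesis using dist_triangle[of p q r] by linarith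
qed

text \<open>A metric substitute for an angle of at least a right angle at \<open>q\<close>: moving
  from \<open>q\<close> towards \<open>r\<close> does not bring one closer to \<open>p\<close>. The
  CN inequality at a nearby point, divided by \<open>l\<close>, gives the claim as \<open>l\<close>
  tends to 0.\<close>

lemma pythagoras_le:
  assumes "\<And>l. 0 < l \<Longrightarrow> l \<le> 1 \<Longrightarrow>
    \<exists>m. dist (q::'x) m = l * dist q r \<and> dist m r = (1 - l) * dist q r \<and> dist p q \<le> dist p m"
  shows "(dist p q)\<^sup>2 + (dist q r)\<^sup>2 \<le> (dist p r)\<^sup>2"
proof -
  have *: "(dist p q)\<^sup>2 + (1 - l) * (dist q r)\<^sup>2 \<le> (dist p r)\<^sup>2" if l: "0 < l" "l \<le> 1" for l
  proof -
    obtain m where m: "dist q m = l * dist q r" "dist m r = (1 - l) * dist q r" "dist p q \<le> dist p m"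
      using assms[OF l] by blast
    have "(dist p q)\<^sup>2 \<le> (dist p m)\<^sup>2" using m by (intro power_mono) auto
    also have "\<dots> \<le> (1 - l) * (dist p q)\<^sup>2 + l * (dist p r)\<^sup>2 - l * (1 - l) * (dist q r)\<^sup>2"
      using l m by (intro CN_inequality) auto
    finally have "l * ((dist p q)\<^sup>2 + (1 - l) * (dist q r)\<^sup>2) \<le> l * (dist p r)\<^sup>2"
      by (simp add: algebra_simps)
    thus ?thesis using l by simp
  qed
  have "((\<lambda>l. (dist p q)\<^sup>2 + (1 - l) * (dist q r)\<^sup>2) \<longlongrightarrow> (dist p q)\<^sup>2 + (1 - 0) * (dist q r)\<^sup>2) (at_right 0)"
    by (intro tendsto_intros)
  moreover have "eventually (\<lambda>l. (dist p q)\<^sup>2 + (1 - l) * (dist q r)\<^sup>2 \<le> (dist p r)\<^sup>2) (at_right 0)"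
    using eventually_at_right[of 0 "1::real"] * by (auto intro!: exI[of _ 1])
  ultimately have "(dist p q)\<^sup>2 + (1 - 0) * (dist q r)\<^sup>2 \<le> (dist p r)\<^sup>2"
    using tendsto_upperbound trivial_limit_at_right_real by blast
  thus ?thesis by simp
qed

end

section \<open>Projection to geodesic lines\<close>

definition is_line :: "'x::metric_space set \<Rightarrow> bool" where
  "is_line L \<longleftrightarrow> (\<exists>c :: real \<Rightarrow> 'x. isometric_embedding_on UNIV c \<and> L = range c)"

definition proj :: "'x::metric_space set \<Rightarrow> 'x \<Rightarrow> 'x" where
  "proj L x = (SOME q. q \<in> L \<and> (\<forall>p\<in>L. dist x q \<le> dist x p))"

text \<open>The strong form of contraction: the geodesic not only comes close to \<open>L\<close>,
  it does so at the entry point \<open>proj L x\<close>. Exchanging \<open>x\<close> and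
  \<open>y\<close> gives the exit point, and contraction of balls follows in
  \<open>contracting_ball\<close>.\<close>

definition contracting :: "real \<Rightarrow> 'x::metric_space set \<Rightarrow> bool" where
  "contracting B L \<longleftrightarrow> 0 \<le> B \<and> (\<forall>x y. B < dist (proj L x) (proj L y) \<longrightarrow>
     (\<exists>m. dist x m + dist m y = dist x y \<and> dist m (proj L x) \<le> B))"

lemma is_lineE:
  assumes "is_line L"
  obtains c :: "real \<Rightarrow> _" where "isometric_embedding_on UNIV c" "L = range c"
  using assms unfolding is_line_def by blast

lemma isometric_lineD:
  "isometric_embedding_on UNIV c \<Longrightarrow> dist (c s) (c t) = \<bar>s - t :: real\<bar>"
  by (simp add: isometric_embedding_on_def dist_real_def)

lemma isometric_line_continuous:
  fixes c :: "real \<Rightarrow> 'x::metric_space"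
  assumes "isometric_embedding_on UNIV c"
  shows "continuous_on A c"
  unfolding continuous_on_iff using isometric_lineD[OF assms]
  by (metis dist_real_def)

context proper_CAT0
begin

text \<open>Uniqueness of geodesics allows points of a geodesic to be described by an equality of
  distances. This betweenness replaces segments in all later arguments.\<close>

lemma between_unique:
  assumes "dist (x::'x) m + dist m y = dist x y" "dist x m' + dist m' y = dist x y" "dist x m = dist x m'"
  shows "m = m'"
proof (cases "dist x y = 0")
  case True
  have "0 \<le> dist x m" "0 \<le> dist m y" "0 \<le> dist x m'" "0 \<le> dist m' y" by simp_all
  hence "dist x m = 0" "dist x m' = 0" using assms True by linarith+
  thus ?thesis by simp
next
  case False
  define l where "l = dist x m / dist x y"
  have le: "dist x m \<le> dist x y" using assms(1) zero_le_dist[of m y] by linarith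
  have 1: "dist x m = l * dist x y" using False by (simp add: l_def)
  have l: "0 \<le> l" "l \<le> 1" using le False by (auto simp: l_def divide_le_eq_1)
  show ?thesis
    by (rule fraction_unique[OF l, of x m y m']) (use assms 1 in \<open>auto simp: algebra_simps\<close>)
qed

lemma between_dist:
  assumes "dist (x::'x) m + dist m y = dist x y" "dist x m' + dist m' y = dist x y" "dist x m \<le> dist x m'"
  shows "dist m m' = dist x m' - dist x m"
proof -
  have "dist x m' - dist x m \<le> dist m y" using assms zero_le_dist[of m' y] by linarith
  then obtain n where n: "dist m n = dist x m' - dist x m" "dist n y = dist m y - (dist x m' - dist x m)"
    using assms(3) between_ex[of "dist x m' - dist x m" m y] by auto
  have "dist x n \<le> dist x m'" using dist_triangle[of x n m] n by linarith
  moreover have "dist x n \<ge> dist x m'" using dist_triangle[of x y n] n assms by linarith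
  ultimately have "n = m'" using n assms by (intro between_unique[of x n y m']) linarith+
  thus ?thesis using n by simp
qed

lemma nearest_point_ex:
  assumes "is_line L"
  shows "\<exists>q. q \<in> L \<and> (\<forall>p\<in>L. dist (x::'x) q \<le> dist x p)"
proof -
  obtain c :: "real \<Rightarrow> 'x" where c: "isometric_embedding_on UNIV c" "L = range c" by (rule is_lineE[OF assms(1)])
  define R where "R = 2 * dist x (c 0)"
  have "continuous_on {-R..R} (\<lambda>t. dist x (c t))"
    by (intro continuous_intros isometric_line_continuous[OF c(1)])
  then obtain t0 where t0: "t0 \<in> {-R..R}" "\<forall>t\<in>{-R..R}. dist x (c t0) \<le> dist x (c t)"
    using continuous_attains_inf[of "{-R..R}" "\<lambda>t. dist x (c t)"] by (auto simp: R_def)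
  have "dist x (c t0) \<le> dist x (c t)" for t
  proof (cases "t \<in> {-R..R}")
    case False
    hence "R < \<bar>t\<bar>" by auto
    moreover have "dist (c 0) (c t) = \<bar>t\<bar>" using isometric_lineD[OF c(1), of 0 t] by simp
    moreover have "dist x (c t0) \<le> dist x (c 0)" using t0 by (auto simp: R_def)
    ultimately show ?thesis using dist_triangle3[of "c 0" "c t" x] by (simp add: R_def)
  qed (use t0 in auto)
  thus ?thesis using c by auto
qed

lemma assumes "is_line L"
  shows proj_in: "proj L (x::'x) \<in> L" and proj_le: "p \<in> L \<Longrightarrow> dist x (proj L x) \<le> dist x p"
  using someI_ex[OF nearest_point_ex[OF assms, of x]] unfolding proj_def[symmetric] by auto

lemma line_fraction_ex:
  assumes "is_line L" "q \<in> L" "r \<in> L" "0 \<le> l" "l \<le> 1"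
  shows "\<exists>m\<in>L. dist (q::'x) m = l * dist q r \<and> dist m r = (1 - l) * dist q r"
proof -
  obtain c :: "real \<Rightarrow> 'x" where c: "isometric_embedding_on UNIV c" "L = range c" by (rule is_lineE[OF assms(1)])
  obtain s t where st: "q = c s" "r = c t" using assms c by auto
  have "\<bar>s - (s + l * (t - s))\<bar> = l * \<bar>s - t\<bar>" using assms by (simp add: abs_mult abs_minus_commute)
  moreover have "\<bar>(s + l * (t - s)) - t\<bar> = (1 - l) * \<bar>s - t\<bar>"
  proof -
    have "(s + l * (t - s)) - t = (1 - l) * (s - t)" by (simp add: algebra_simps)
    thus ?thesis using assms by (simp add: abs_mult)
  qed
  ultimately show ?thesis using c st isometric_lineD[OF c(1)] by (intro bexI[of _ "c (s + l * (t - s))"]) auto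
qed

lemma proj_pythagoras:
  assumes "is_line L" "p \<in> L"
  shows "(dist (x::'x) (proj L x))\<^sup>2 + (dist (proj L x) p)\<^sup>2 \<le> (dist x p)\<^sup>2"
proof (rule pythagoras_le)
  fix l :: real assume "0 < l" "l \<le> 1"
  then obtain m where "m \<in> L" "dist (proj L x) m = l * dist (proj L x) p" "dist m p = (1 - l) * dist (proj L x) p"
    using line_fraction_ex[OF assms(1) proj_in[OF assms(1)] assms(2), of l] by auto
  thus "\<exists>m. dist (proj L x) m = l * dist (proj L x) p \<and> dist m p = (1 - l) * dist (proj L x) p \<and>
      dist x (proj L x) \<le> dist x m"
    using proj_le[OF assms(1)] by blast
qed

lemma proj_unique:
  assumes "is_line L" "q \<in> L" "dist (x::'x) q \<le> dist x (proj L x)"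
  shows "proj L x = q"
proof -
  have "(dist x q)\<^sup>2 \<le> (dist x (proj L x))\<^sup>2" using assms by (intro power_mono) auto
  hence "(dist (proj L x) q)\<^sup>2 \<le> 0" using proj_pythagoras[OF assms(1,2), of x] by linarith
  thus ?thesis by simp
qed

lemma proj_ident: "is_line L \<Longrightarrow> p \<in> L \<Longrightarrow> proj L (p::'x) = p"
  by (rule proj_unique) auto

text \<open>The right angles at the two feet bound the diagonals of the quadrilateral from below,
  and \<open>quadrilateral\<close> bounds them from above.\<close>

lemma proj_lipschitz:
  assumes L: "is_line L"
  shows "dist (proj L (x::'x)) (proj L y) \<le> dist x y"
proof -
  have "(dist x (proj L x))\<^sup>2 + (dist (proj L x) (proj L y))\<^sup>2 \<le> (dist x (proj L y))\<^sup>2"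
    "(dist y (proj L y))\<^sup>2 + (dist (proj L y) (proj L x))\<^sup>2 \<le> (dist y (proj L x))\<^sup>2"
    by (intro proj_pythagoras L proj_in)+
  hence "(dist (proj L x) (proj L y))\<^sup>2 \<le> (dist x y)\<^sup>2"
    using quadrilateral[of x "proj L y" y "proj L x"]
    unfolding dist_commute[of "proj L y" "proj L x"] dist_commute[of "proj L y" y]
      dist_commute[of "proj L x" x] dist_commute[of y x] by linarith
  thus ?thesis by (rule power2_le_imp_le) simp
qed

lemma proj_between:
  assumes "is_line L" "dist (x::'x) m + dist m (proj L x) = dist x (proj L x)"
  shows "proj L m = proj L x"
proof (rule proj_unique[OF assms(1) proj_in[OF assms(1)]])
  have "dist x (proj L x) \<le> dist x (proj L m)" by (intro proj_le proj_in assms)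
  thus "dist m (proj L x) \<le> dist m (proj L m)"
    using assms(2) dist_triangle[of x "proj L m" m] by linarith
qed

lemma height_lipschitz:
  assumes "is_line L"
  shows "dist (y::'x) (proj L y) \<le> dist x (proj L x) + dist x y"
  using proj_le[OF assms proj_in[OF assms], of y x] dist_triangle[of y "proj L x" x]
  by (simp add: dist_commute)

lemma height_convex:
  assumes L: "is_line L" and l: "0 \<le> l" "l \<le> 1"
    and m: "dist (x::'x) m = l * dist x y" "dist m y = (1 - l) * dist x y"
  shows "dist m (proj L m) \<le> (1 - l) * dist x (proj L x) + l * dist y (proj L y)"
proof -
  obtain q where q: "q \<in> L" "dist (proj L x) q = l * dist (proj L x) (proj L y)"
     "dist q (proj L y) = (1 - l) * dist (proj L x) (proj L y)"
    using line_fraction_ex[OF L proj_in[OF L] proj_in[OF L] l] by blast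
  have "dist m (proj L m) \<le> dist m q" by (rule proj_le[OF L q(1)])
  also have "\<dots> \<le> (1 - l) * dist x (proj L x) + l * dist y (proj L y)"
    by (rule dist_fractions[OF l m q(2,3)])
  finally show ?thesis .
qed

lemma height_between:
  assumes L: "is_line L" and m: "dist (x::'x) m + dist m y = dist x y"
    and "dist x (proj L x) \<le> H" "dist y (proj L y) \<le> H"
  shows "dist m (proj L m) \<le> H"
proof (cases "dist x y = 0")
  case True
  hence "x = m" using m by (metis add_nonneg_eq_0_iff dist_eq_0_iff zero_le_dist)
  thus ?thesis using assms by simp
next
  case False
  define l where "l = dist x m / dist x y"
  have le: "dist x m \<le> dist x y" using m zero_le_dist[of m y] by linarith
  have 1: "dist x m = l * dist x y" using False by (simp add: l_def)
  have l: "0 \<le> l" "l \<le> 1" using le False by (auto simp: l_def divide_le_eq_1)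
  have "dist m (proj L m) \<le> (1 - l) * dist x (proj L x) + l * dist y (proj L y)"
    using m 1 by (intro height_convex L l) (auto simp: algebra_simps)
  also have "\<dots> \<le> (1 - l) * H + l * H" using l assms by (intro add_mono mult_left_mono) auto
  finally show ?thesis by (simp add: algebra_simps)
qed

lemma contractingE:
  assumes "contracting B L" "B < dist (proj L x) (proj L y)"
  obtains m where "dist (x::'x) m + dist m y = dist x y" "dist m (proj L x) \<le> B"
  using assms unfolding contracting_def by blast

text \<open>The form used in length estimates: a detour through the entry point costs at most
  \<open>2 * B\<close>.\<close>

lemma contracting_dist:
  assumes "contracting B L" "B < dist (proj L x) (proj L y)"
  shows "dist (x::'x) (proj L x) + dist (proj L x) y \<le> dist x y + 2 * B"
proof -
  obtain m where "dist x m + dist m y = dist x y" "dist m (proj L x) \<le> B"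
    using contractingE[OF assms] by blast
  thus ?thesis using dist_triangle[of x "proj L x" m] dist_triangle3[of "proj L x" y m] by linarith
qed

text \<open>A geodesic that passes within \<open>B\<close> of \<open>proj L x\<close> has spent all
  of its length except \<open>B\<close> by then, so its end \<open>y\<close> is within
  \<open>B\<close> of that passage.\<close>

lemma contracting_ball:
  assumes L: "is_line L" and B: "contracting B L" and xy: "dist x y \<le> dist (x::'x) (proj L x)"
  shows "dist (proj L x) (proj L y) \<le> 2 * B"
proof (rule ccontr)
  assume neg: "\<not> ?thesis"
  have B0: "0 \<le> B" using B by (simp add: contracting_def)
  hence "B < dist (proj L x) (proj L y)" using neg by linarith
  then obtain m where m: "dist x m + dist m y = dist x y" "dist m (proj L x) \<le> B"
    using contractingE[OF B] by blast
  have "dist x (proj L x) \<le> dist x m + B" using m dist_triangle[of x "proj L x" m] by linarith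
  hence "dist m y \<le> B" using m xy by linarith
  hence "dist (proj L m) (proj L y) \<le> B" using proj_lipschitz[OF L, of m y] by linarith
  moreover have "dist (proj L m) (proj L x) \<le> B"
    using proj_lipschitz[OF L, of m "proj L x"] m by (simp add: proj_ident[OF L proj_in[OF L]])
  ultimately show False using neg dist_triangle3[of "proj L x" "proj L y" "proj L m"] by linarith
qed

lemma is_line_image:
  assumes "is_line L" "\<And>x y. dist (f x) (f y) = dist x (y::'x)"
  shows "is_line (f ` L :: 'x set)"
proof -
  obtain c :: "real \<Rightarrow> 'x" where "isometric_embedding_on UNIV c" "L = range c" by (rule is_lineE[OF assms(1)])
  thus ?thesis unfolding is_line_def using assms(2)
    by (intro exI[of _ "f \<circ> c"]) (auto simp: isometric_embedding_on_def image_comp)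
qed

lemma proj_image:
  assumes "is_line L" "\<And>x y. dist (f x) (f y) = dist x (y::'x)"
  shows "proj (f ` L) (f x) = (f (proj L x) :: 'x)"
proof (rule proj_unique[OF is_line_image[OF assms]])
  show "f (proj L x) \<in> f ` L" using proj_in[OF assms(1)] by auto
  obtain p where "p \<in> L" "proj (f ` L) (f x) = f p" using proj_in[OF is_line_image[OF assms]] by auto
  thus "dist (f x) (f (proj L x)) \<le> dist (f x) (proj (f ` L) (f x))"
    using assms(2) proj_le[OF assms(1)] by auto
qed

lemma contracting_image:
  assumes "is_line L" "contracting B L" "\<And>x y. dist (f x) (f y) = dist x (y::'x)" "surj f"
  shows "contracting B (f ` L :: 'x set)"
  unfolding contracting_def
proof (intro conjI allI impI)
  show "0 \<le> B" using assms by (simp add: contracting_def)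
  fix x y assume *: "B < dist (proj (f ` L) x) (proj (f ` L) y)"
  obtain x' y' where xy: "x = f x'" "y = f y'" using assms(4) by (meson surjD)
  have "B < dist (proj L x') (proj L y')" using * xy assms(3) proj_image[OF assms(1,3)] by simp
  then obtain m where "dist x' m + dist m y' = dist x' y'" "dist m (proj L x') \<le> B"
    using contractingE[OF assms(2)] by blast
  thus "\<exists>m. dist x m + dist m y = dist x y \<and> dist m (proj (f ` L) x) \<le> B"
    using xy assms(3) proj_image[OF assms(1,3)] by (intro exI[of _ "f m"]) simp
qed

text \<open>If two lines project into small balls of each other, a point can be far from at most one of
  these balls: its geodesic to \<open>Y\<close> would otherwise run along \<open>Z\<close>, which has small image in \<open>Y\<close>.\<close>

lemma behrstock:
  assumes Y: "is_line Y" and Z: "is_line Z" "contracting B Z"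
    and YZ: "\<And>p. p \<in> Z \<Longrightarrow> dist (proj Y p) e \<le> c" and ZY: "\<And>p. p \<in> Y \<Longrightarrow> dist (proj Z p) s \<le> c"
    and z: "B + c < dist (proj Z (z::'x)) s"
  shows "dist (proj Y z) e \<le> B + c"
proof -
  have "dist (proj Z (proj Y z)) s \<le> c" using ZY proj_in[OF Y] by blast
  hence "B < dist (proj Z z) (proj Z (proj Y z))"
    using z dist_triangle[of "proj Z z" s "proj Z (proj Y z)"] by linarith
  then obtain m where m: "dist z m + dist m (proj Y z) = dist z (proj Y z)" "dist m (proj Z z) \<le> B"
    using contractingE[OF Z(2)] by blast
  have "proj Y m = proj Y z" by (rule proj_between[OF Y m(1)])
  hence "dist (proj Y z) (proj Y (proj Z z)) \<le> B" using proj_lipschitz[OF Y, of m "proj Z z"] m by simp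
  moreover have "dist (proj Y (proj Z z)) e \<le> c" using YZ proj_in[OF Z(1)] by blast
  ultimately show ?thesis using dist_triangle[of "proj Y z" e "proj Y (proj Z z)"] by linarith
qed

end

section \<open>Geodesics as continuous paths\<close>

context proper_CAT0
begin

text \<open>The bridge from betweenness to paths, so that compactness and the intermediate value
  theorem apply to the points between \<open>x\<close> and \<open>y\<close>.\<close>

lemma between_path:
  assumes "dist (x::'x) y = d"
  obtains c where "c 0 = x" "c d = y" "continuous_on {0..d} c"
    "\<And>t. t \<in> {0..d} \<Longrightarrow> dist x (c t) = t \<and> dist (c t) y = d - t"
    "\<And>m. dist x m + dist m y = d \<Longrightarrow> dist x m \<in> {0..d} \<and> m = c (dist x m)"
proof -
  obtain c where c: "geodesic_path c x y" by (rule geodesic_ex)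
  hence iso: "\<And>s t. s \<in> {0..d} \<Longrightarrow> t \<in> {0..d} \<Longrightarrow> dist (c s) (c t) = \<bar>s - t\<bar>"
    and e: "c 0 = x" "c d = y"
    using assms unfolding geodesic_path_def by auto
  have d: "0 \<le> d" using assms by auto
  have "continuous_on {0..d} c"
    unfolding continuous_on_iff using iso by (metis dist_real_def)
  moreover have 1: "dist x (c t) = t \<and> dist (c t) y = d - t" if "t \<in> {0..d}" for t
    using iso[of 0 t] iso[of t d] e that d by auto
  moreover have "dist x m \<in> {0..d} \<and> m = c (dist x m)" if m: "dist x m + dist m y = d" for m
  proof -
    have "dist x m \<le> d" using m zero_le_dist[of m y] by linarith
    hence *: "dist x m \<in> {0..d}" by simp
    have "m = c (dist x m)"
      using m assms 1[OF *] by (intro between_unique[of x m y]) auto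
    thus ?thesis using * by simp
  qed
  ultimately show ?thesis using that e by blast
qed

lemma between_trans:
  assumes "dist (x::'x) m + dist m y = dist x y" "dist x n + dist n m = dist x m"
  shows "dist x n + dist n y = dist x y"
  using assms dist_triangle[of n y m] dist_triangle[of x y n] by linarith

lemma between_trans':
  assumes "dist (x::'x) m + dist m y = dist x y" "dist m n + dist n y = dist m y"
  shows "dist x n + dist n y = dist x y"
  using assms dist_triangle[of x n m] dist_triangle[of x y n] by linarith

lemma continuous_proj: "is_line L \<Longrightarrow> continuous_on A (proj L :: 'x \<Rightarrow> 'x)"
  unfolding continuous_on_iff using proj_lipschitz by (meson le_less_trans)

end

section \<open>From contraction of balls of half radius to contraction along geodesics\<close>

locale half_contracting_line = proper_CAT0 T for T :: "'x::metric_space itself" +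
  fixes L :: "'x set" and B0 :: real
  assumes line: "is_line L" and B0: "0 < B0"
    and half: "\<And>x y. dist x y \<le> dist x (proj L x) / 2 \<Longrightarrow> dist (proj L x) (proj L y) \<le> B0"
begin

text \<open>At height at least \<open>H\<close>, each step of length \<open>H / 2\<close> falls
  under \<open>half\<close> and moves the projection by at most \<open>B0\<close>.\<close>

lemma proj_steps:
  assumes H: "0 < H" and "\<And>m. dist x m + dist m y = dist x y \<Longrightarrow> H \<le> dist m (proj L m)"
    and "dist x y \<le> real n * (H / 2)"
  shows "dist (proj L x) (proj L y) \<le> real n * B0"
  using assms(2,3)
proof (induction n arbitrary: x)
  case 0
  thus ?case by simp
next
  case (Suc n)
  have Hx: "H \<le> dist x (proj L x)" by (rule Suc.prems) simp
  show ?case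
  proof (cases "dist x y \<le> H / 2")
    case True
    hence "dist (proj L x) (proj L y) \<le> B0" using Hx by (intro half) simp
    thus ?thesis using B0 by (simp add: algebra_simps add_increasing2)
  next
    case False
    then obtain m where m: "dist x m = H / 2" "dist m y = dist x y - H / 2"
      using H between_ex[of "H/2" x y] by auto
    have "dist (proj L m) (proj L y) \<le> real n * B0"
    proof (rule Suc.IH)
      show "dist m y \<le> real n * (H / 2)" using m Suc.prems(2) by (simp add: algebra_simps)
      fix n assume "dist m n + dist n y = dist m y"
      thus "H \<le> dist n (proj L n)" using m by (intro Suc.prems between_trans'[of x m y n]) auto
    qed
    moreover have "dist (proj L x) (proj L m) \<le> B0" using Hx m by (intro half) simp
    ultimately show ?thesis
      using dist_triangle[of "proj L x" "proj L y" "proj L m"] by (simp add: algebra_simps)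
  qed
qed

text \<open>Beyond distance \<open>3 s + 2 H\<close> from the lowest point \<open>w\<close>, the geodesic from \<open>w\<close> to \<open>x\<close> follows the perpendicular
  from \<open>x\<close> to \<open>L\<close> so closely that a single application of the contraction property suffices; this avoids
  a logarithmic number of steps.\<close>

lemma proj_bound_lowest:
  assumes H: "dist w (proj L w) = H" "16 * B0 \<le> H"
    and low: "\<And>m. dist w m + dist m x = dist w x \<Longrightarrow> H \<le> dist m (proj L m)"
  shows "dist (proj L w) (proj L x) \<le> 16 * B0"
proof -
  define s where "s = dist (proj L w) (proj L x)"
  define t where "t = dist w x"
  define U where "U = 3 * s + 2 * H"
  have H0: "0 < H" using H B0 by linarith
  have s0: "0 \<le> s" by (simp add: s_def)
  have U0: "0 < U" using H0 s0 by (simp add: U_def)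
  have steps: "dist (proj L w) (proj L m) \<le> (2 * U / H + 1) * B0"
    if m: "dist w m + dist m x = t" "dist w m \<le> U" for m
  proof -
    define n where "n = nat \<lceil>2 * U / H\<rceil>"
    have "0 \<le> 2 * U / H" using U0 H0 by simp
    hence n: "2 * U / H \<le> real n" "real n \<le> 2 * U / H + 1" unfolding n_def by linarith+
    have "dist (proj L w) (proj L m) \<le> real n * B0"
    proof (rule proj_steps[OF H0])
      show "dist w m \<le> real n * (H / 2)" using m n(1) H0 by (simp add: field_simps)
      fix k assume "dist w k + dist k m = dist w m"
      thus "H \<le> dist k (proj L k)" using m by (intro low between_trans[of w m x k]) (auto simp: t_def)
    qed
    also have "\<dots> \<le> (2 * U / H + 1) * B0" using n B0 by (intro mult_right_mono) auto
    finally show ?thesis .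
  qed
  \<comment> \<open>Since \<open>w\<close> is lowest, no point of the geodesic is closer to the foot
    of \<open>w\<close> than \<open>w\<close> itself, so there is a right angle at
    \<open>w\<close>.\<close>
  have "(dist (proj L w) w)\<^sup>2 + (dist w x)\<^sup>2 \<le> (dist (proj L w) x)\<^sup>2"
  proof (rule pythagoras_le)
    fix l :: real assume l: "0 < l" "l \<le> 1"
    obtain m where m: "dist w m = l * dist w x" "dist m x = (1 - l) * dist w x"
      using fraction_ex[of l] l by auto
    have "H \<le> dist m (proj L m)" using m by (intro low) (simp add: algebra_simps)
    also have "\<dots> \<le> dist m (proj L w)" by (intro proj_le proj_in line)
    finally have "dist (proj L w) w \<le> dist (proj L w) m" using H by (simp add: dist_commute)
    thus "\<exists>m. dist w m = l * dist w x \<and> dist m x = (1 - l) * dist w x \<and> dist (proj L w) w \<le> dist (proj L w) m"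
      using m by blast
  qed
  hence "t\<^sup>2 \<le> (dist (proj L w) x)\<^sup>2" unfolding t_def using zero_le_power2[of "dist (proj L w) w"] by linarith
  hence "t \<le> dist (proj L w) x" by (rule power2_le_imp_le) simp
  hence hx: "t - s \<le> dist x (proj L x)"
    using dist_triangle[of "proj L w" x "proj L x"] by (simp add: s_def dist_commute)
  have "s \<le> (2 * U / H + 2) * B0"
  proof (cases "t \<le> U")
    case True
    hence "s \<le> (2 * U / H + 1) * B0" unfolding s_def using steps[of x] by (simp add: t_def)
    thus ?thesis using B0 by (simp add: algebra_simps)
  next
    case False
    define l where "l = U / t"
    have l: "0 < l" "l < 1" "l * t = U" using False U0 by (auto simp: l_def)
    have l': "0 \<le> 1 - l" "1 - l \<le> 1" using l by auto
    obtain m where m: "dist x m = (1 - l) * dist x w" "dist m w = (1 - (1 - l)) * dist x w"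
      using fraction_ex[OF l'] by metis
    obtain x' where x': "dist x x' = (1 - l) * dist x (proj L x)"
        "dist x' (proj L x) = (1 - (1 - l)) * dist x (proj L x)"
      using fraction_ex[OF l'] by metis
    have wm: "dist w m = U" using m l by (simp add: t_def dist_commute)
    have "dist m x' \<le> (1 - l) * dist w (proj L x)" by (rule dist_fractions_vertex[OF l' m x'])
    also have "\<dots> \<le> 1 * dist w (proj L x)" using l by (intro mult_right_mono) auto
    also have "\<dots> \<le> H + s" using dist_triangle[of w "proj L x" "proj L w"] H by (simp add: s_def)
    finally have mx: "dist m x' \<le> H + s" by simp
    have px: "proj L x' = proj L x" using x' by (intro proj_between line) (simp add: algebra_simps)
    have "dist x' (proj L x') = l * dist x (proj L x)" using px x' by simp
    moreover have "l * (t - s) \<le> l * dist x (proj L x)" using hx l by (intro mult_left_mono) auto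
    moreover have "l * s \<le> s" using l s0 mult_right_mono[of l 1 s] by simp
    ultimately have "U - s \<le> dist x' (proj L x')" using l by (simp add: algebra_simps)
    hence "dist (proj L x') (proj L m) \<le> B0"
      using mx by (intro half) (simp add: U_def dist_commute)
    moreover have "dist (proj L w) (proj L m) \<le> (2 * U / H + 1) * B0"
    proof (rule steps)
      have "dist w m + dist m x = l * dist x w + (1 - l) * dist x w" using m by (simp add: dist_commute)
      also have "\<dots> = t" by (simp add: t_def dist_commute algebra_simps)
      finally show "dist w m + dist m x = t" .
    qed (simp add: wm)
    ultimately show ?thesis
      using px dist_triangle2[of "proj L w" "proj L x" "proj L m"] by (simp add: s_def algebra_simps)
  qed
  also have "\<dots> = (6 * s / H + 6) * B0" using H0 by (simp add: U_def field_simps)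
  also have "\<dots> = 6 * s * (B0 / H) + 6 * B0" by (simp add: algebra_simps)
  \<comment> \<open>Height at least \<open>16 * B0\<close> brings the coefficient of
    \<open>s\<close> below 1, and \<open>s\<close> can be absorbed into the left side.\<close>
  also have "\<dots> \<le> 6 * s * (1 / 16) + 6 * B0"
    using H(2) H0 s0 by (intro add_right_mono mult_left_mono) (auto simp: field_simps)
  finally show ?thesis using B0 unfolding s_def[symmetric] by simp
qed

text \<open>Cut the geodesic at its lowest point; \<open>proj_bound_lowest\<close> bounds both
  halves.\<close>

lemma proj_bound_high:
  assumes high: "\<And>m. dist x m + dist m y = dist x y \<Longrightarrow> 16 * B0 \<le> dist m (proj L m)"
  shows "dist (proj L x) (proj L y) \<le> 32 * B0"
proof -
  obtain c where c: "c 0 = x" "c (dist x y) = y" "continuous_on {0..dist x y} c"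
    "\<And>t. t \<in> {0..dist x y} \<Longrightarrow> dist x (c t) = t \<and> dist (c t) y = dist x y - t"
    "\<And>m. dist x m + dist m y = dist x y \<Longrightarrow> dist x m \<in> {0..dist x y} \<and> m = c (dist x m)"
    using between_path[OF refl] by blast
  have "continuous_on {0..dist x y} (\<lambda>t. dist (c t) (proj L (c t)))"
    by (intro continuous_on_dist[OF c(3) continuous_on_compose2[OF continuous_proj[OF line, of UNIV] c(3) subset_UNIV]])
  then obtain t0 where t0: "t0 \<in> {0..dist x y}"
     "\<forall>t\<in>{0..dist x y}. dist (c t0) (proj L (c t0)) \<le> dist (c t) (proj L (c t))"
    using continuous_attains_inf[of "{0..dist x y}" "\<lambda>t. dist (c t) (proj L (c t))"] by auto
  define w where "w = c t0"
  have w: "dist x w + dist w y = dist x y" using c(4)[OF t0(1)] by (simp add: w_def)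
  have low: "dist w (proj L w) \<le> dist m (proj L m)" if "dist x m + dist m y = dist x y" for m
    using t0(2) c(5)[OF that] unfolding w_def by metis
  have "dist (proj L w) (proj L y) \<le> 16 * B0"
    by (rule proj_bound_lowest[OF refl high[OF w]], rule low, rule between_trans'[OF w])
  moreover have "dist (proj L w) (proj L x) \<le> 16 * B0"
  proof (rule proj_bound_lowest[OF refl high[OF w]], rule low)
    fix m assume "dist w m + dist m x = dist w x"
    thus "dist x m + dist m y = dist x y" by (intro between_trans[OF w]) (simp add: dist_commute)
  qed
  ultimately show ?thesis using dist_triangle3[of "proj L x" "proj L y" "proj L w"] by linarith
qed

text \<open>Follow the geodesic from \<open>x\<close> to its first point of height at most
  \<open>16 * B0\<close>, which exists because otherwise \<open>proj_bound_high\<close> applies to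
  all of it. Up to there the projection moves by at most \<open>32 * B0\<close>, and the point is
  \<open>16 * B0\<close> away from its own projection.\<close>

lemma contracting_48: "contracting (48 * B0) L"
  unfolding contracting_def
proof (intro conjI allI impI)
  show "0 \<le> 48 * B0" using B0 by simp
  fix x y assume far: "48 * B0 < dist (proj L x) (proj L y)"
  define h where "h m = dist m (proj L m)" for m
  show "\<exists>m. dist x m + dist m y = dist x y \<and> dist m (proj L x) \<le> 48 * B0"
  proof (cases "h x \<le> 16 * B0")
    case True
    thus ?thesis using B0 by (intro exI[of _ x]) (simp add: h_def)
  next
    case False
    obtain c where c: "c 0 = x" "c (dist x y) = y" "continuous_on {0..dist x y} c"
      "\<And>t. t \<in> {0..dist x y} \<Longrightarrow> dist x (c t) = t \<and> dist (c t) y = dist x y - t"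
      "\<And>m. dist x m + dist m y = dist x y \<Longrightarrow> dist x m \<in> {0..dist x y} \<and> m = c (dist x m)"
      using between_path[OF refl] by blast
    have hc: "continuous_on {0..dist x y} (\<lambda>t. h (c t))" unfolding h_def
      by (intro continuous_on_dist[OF c(3) continuous_on_compose2[OF continuous_proj[OF line, of UNIV] c(3) subset_UNIV]])
    have "\<not> (\<forall>m. dist x m + dist m y = dist x y \<longrightarrow> 16 * B0 \<le> h m)"
      using proj_bound_high[of x y] far B0 unfolding h_def by fastforce
    then obtain t1 where t1: "t1 \<in> {0..dist x y}" "h (c t1) \<le> 16 * B0"
      using c(5) by (metis less_eq_real_def not_le)
    let ?S = "{t \<in> {0..dist x y}. h (c t) \<le> 16 * B0}"
    have "compact ?S"
    proof -
      have "?S = {0..dist x y} \<inter> (\<lambda>t. h (c t)) -` {..16 * B0}" by auto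
      moreover have "closed ({0..dist x y} \<inter> (\<lambda>t. h (c t)) -` {..16 * B0})"
        by (intro continuous_closed_preimage hc) auto
      ultimately show ?thesis by (metis compact_Icc compact_Int_closed inf_left_idem)
    qed
    then obtain t2 where t2: "t2 \<in> ?S" "\<And>t. t \<in> ?S \<Longrightarrow> t2 \<le> t"
      using compact_attains_inf[of ?S] t1 by blast
    \<comment> \<open>The height at the first such point is exactly \<open>16 * B0\<close>, so the
      closed condition of \<open>proj_bound_high\<close> also holds at this end.\<close>
    have "\<exists>t\<ge>0. t \<le> t2 \<and> h (c t) = 16 * B0"
      using t2(1) False c(1) by (intro IVT2') (auto intro: continuous_on_subset[OF hc])
    then obtain t where t: "0 \<le> t" "t \<le> t2" "h (c t) = 16 * B0" by blast
    hence "t = t2" using t2(1) t2(2)[of t] by auto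
    hence ht: "h (c t2) = 16 * B0" using t by simp
    have t2': "dist x (c t2) = t2" "dist (c t2) y = dist x y - t2" using c(4) t2(1) by auto
    have "dist (proj L x) (proj L (c t2)) \<le> 32 * B0"
    proof (rule proj_bound_high)
      fix m assume m: "dist x m + dist m (c t2) = dist x (c t2)"
      hence mt: "dist x m \<le> t2" using t2' zero_le_dist[of m "c t2"] by linarith
      have "dist x m + dist m y = dist x y"
        using m t2' by (intro between_trans[of x "c t2" y m]) auto
      hence mc: "dist x m \<in> {0..dist x y}" "m = c (dist x m)" using c(5) by auto
      show "16 * B0 \<le> dist m (proj L m)"
      proof (rule ccontr)
        assume neg: "\<not> ?thesis"
        hence "dist x m \<in> ?S" using mc by (simp add: h_def)
        hence "dist x m = t2" using t2(2)[of "dist x m"] mt by linarith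
        thus False using neg ht mc by (simp add: h_def)
      qed
    qed
    hence "dist (c t2) (proj L x) \<le> 48 * B0"
      using ht dist_triangle2[of "c t2" "proj L x" "proj L (c t2)"] by (simp add: h_def)
    thus ?thesis using t2' by (intro exI[of _ "c t2"]) simp
  qed
qed

end

section \<open>Half-flats\<close>

text \<open>Only the translations of the axis by multiples of its period matter for the limit
  argument; the group is left out here.\<close>

locale translated_line = proper_CAT0 T for T :: "'x::metric_space itself" +
  fixes c :: "real \<Rightarrow> 'x" and a :: real
  assumes isometric: "isometric_embedding_on UNIV c" and period: "0 < a"
    and shifts: "\<exists>F. (\<forall>x y. dist (F x) (F y) = dist x y) \<and> (\<forall>t. F (c t) = c (t + of_int k * a))"
begin

lemma dist_line: "dist (c s) (c t) = \<bar>s - t\<bar>"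
  by (rule isometric_lineD[OF isometric])

lemma line: "is_line (range c)"
  using isometric by (auto simp: is_line_def)

text \<open>Averaging: of \<open>N\<close> equal pieces of a geodesic with projection longer than
  \<open>N * S\<close>, one has projection at least \<open>S\<close>. The factor 1/2 in the
  hypothesis keeps the whole geodesic at height at least its own length, so the piece is short
  compared with its height.\<close>

lemma thin_pieces:
  fixes N :: nat
  assumes N: "1 \<le> N" and S: "0 \<le> S"
    and fail: "\<And>B. 0 < B \<Longrightarrow> \<exists>x y. dist x y \<le> dist x (proj (range c) x) / 2 \<and> B < dist (proj (range c) x) (proj (range c) y)"
  obtains x y where "dist x y \<le> dist x (proj (range c) x) / N" "S \<le> dist (proj (range c) x) (proj (range c) y)"
proof -
  let ?p = "proj (range c)"
  obtain x y where xy: "dist x y \<le> dist x (?p x) / 2" "N * S + 1 < dist (?p x) (?p y)"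
    using fail[of "N * S + 1"] N S by (auto simp: add_nonneg_pos)
  define d where "d = dist x y"
  obtain p where p: "p 0 = x" "p d = y" "continuous_on {0..d} p"
    "\<And>t. t \<in> {0..d} \<Longrightarrow> dist x (p t) = t \<and> dist (p t) y = d - t"
    "\<And>m. dist x m + dist m y = d \<Longrightarrow> dist x m \<in> {0..d} \<and> m = p (dist x m)"
    by (rule between_path[OF d_def[symmetric]]) (rule that)
  define q where "q i = p (real i * (d / N))" for i :: nat
  have in_range: "real i * (d / N) \<in> {0..d}" if "i \<le> N" for i
  proof -
    have "real i * d \<le> real N * d" using that by (intro mult_right_mono) (auto simp: d_def)
    thus ?thesis using N by (auto simp: d_def field_simps)
  qed
  have q0: "q 0 = x" "q N = y" using p(1,2) N by (auto simp: q_def)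
  have "\<exists>i<N. S \<le> dist (?p (q i)) (?p (q (Suc i)))"
  proof (rule ccontr)
    assume "\<not> ?thesis"
    hence small: "\<And>i. i < N \<Longrightarrow> dist (?p (q i)) (?p (q (Suc i))) \<le> S" by force
    have "dist (?p (q 0)) (?p (q k)) \<le> real k * S" if "k \<le> N" for k
      using that
    proof (induction k)
      case (Suc k)
      thus ?case using small[of k] dist_triangle[of "?p (q 0)" "?p (q (Suc k))" "?p (q k)"]
        by (simp add: algebra_simps)
    qed simp
    thus False using xy q0 by fastforce
  qed
  then obtain i where i: "i < N" "S \<le> dist (?p (q i)) (?p (q (Suc i)))" by blast
  have pi: "dist x (q i) = i * (d / N)" "dist (q i) y = d - i * (d / N)"
    "dist x (q (Suc i)) = Suc i * (d / N)" "dist (q (Suc i)) y = d - Suc i * (d / N)"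
    using p(4)[OF in_range[of i]] p(4)[OF in_range[of "Suc i"]] i by (auto simp: q_def)
  have "0 \<le> d / N" by (simp add: d_def)
  hence "dist (q i) (q (Suc i)) = Suc i * (d / N) - i * (d / N)"
    using pi mult_right_mono[of "real i" "real (Suc i)" "d / N"]
    by (subst between_dist[of x _ y]) (simp_all add: d_def[symmetric] del: times_divide_eq_right)
  hence "dist (q i) (q (Suc i)) = d / N" by (simp add: algebra_simps add_divide_distrib)
  also have "d \<le> dist (q i) (?p (q i))"
  proof -
    have "dist x (q i) \<le> d" using in_range[of i] i pi by auto
    thus ?thesis using height_lipschitz[OF line, of x "q i"] xy by (simp add: d_def dist_commute)
  qed
  hence "d / N \<le> dist (q i) (?p (q i)) / N" using N by (intro divide_right_mono) auto
  finally show ?thesis using that i by blast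
qed

text \<open>The point \<open>\<rho> (t, u)\<close> is the candidate for the image of \<open>(t, u)\<close> in a half-flat over \<open>c\<close>.\<close>

definition almost_flat :: "real \<Rightarrow> (real \<times> real \<Rightarrow> 'x) \<Rightarrow> bool" where
  "almost_flat n \<rho> \<longleftrightarrow> (\<forall>t s u v. \<bar>t\<bar> \<le> n \<and> \<bar>s\<bar> \<le> n \<and> 0 \<le> u \<and> u \<le> n \<and> 0 \<le> v \<and> v \<le> n \<longrightarrow>
     \<rho> (t, 0) = c t \<and> dist (\<rho> (t, u)) (\<rho> (t, v)) = \<bar>u - v\<bar> \<and>
     dist (\<rho> (t, u)) (\<rho> (s, u)) \<le> \<bar>t - s\<bar> + 1 / n \<and> u \<le> dist (\<rho> (t, u)) (c s))"

text \<open>The perpendiculars from \<open>L\<close> to a thin piece span the strip. Its upper edge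
  is short compared with its height, hence near \<open>L\<close> the perpendiculars hardly converge;
  a translation moves the strip to the origin.\<close>

lemma almost_flat_ex:
  fixes n :: nat
  assumes n: "1 \<le> n"
    and fail: "\<And>B. 0 < B \<Longrightarrow> \<exists>x y. dist x y \<le> dist x (proj (range c) x) / 2 \<and> B < dist (proj (range c) x) (proj (range c) y)"
  shows "\<exists>\<rho>. almost_flat n \<rho>"
proof -
  let ?p = "proj (range c)"
  \<comment> \<open>Two errors of at most \<open>2 * n / N\<close> each occur in
    \<open>r_level\<close>; with this \<open>N\<close> they sum to \<open>1 / n\<close>.\<close>
  define N where "N = 4 * n^2"
  have N: "1 \<le> N" "2 \<le> N" using n by (auto simp: N_def power2_eq_square)
  \<comment> \<open>A window of length \<open>2 * n\<close> centred at a multiple of the period fits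
    into an interval of length \<open>2 * n + a\<close>.\<close>
  define S where "S = 2 * real n + a"
  have S: "0 \<le> S" using period by (simp add: S_def)
  obtain x y where xy: "dist x y \<le> dist x (?p x) / N" "S \<le> dist (?p x) (?p y)"
    by (rule thin_pieces[OF N(1) S fail])
  define H where "H = dist x (?p x)"
  have "S \<le> H / N" using xy proj_lipschitz[OF line, of x y] by (simp add: H_def)
  hence "N * S \<le> H" using N by (simp add: field_simps)
  moreover have "2 * n \<le> S" using period by (simp add: S_def)
  moreover have "1 * S \<le> N * S" using N S by (intro mult_right_mono) auto
  ultimately have H: "2 * n \<le> H" "0 < H" using n by linarith+
  have HN: "H / N \<le> H / 2" using N H by (intro divide_left_mono) auto
  have "\<exists>t. ?p m = c t" for m using proj_in[OF line, of m] by auto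
  then obtain f where f: "\<And>m. ?p m = c (f m)" by metis
  have f_lip: "\<bar>f m - f m'\<bar> \<le> dist m m'" for m m'
    using proj_lipschitz[OF line, of m m'] f by (simp add: dist_line)
  define d where "d = dist x y"
  have d: "0 \<le> d" by (simp add: d_def)
  obtain p where p: "p 0 = x" "p d = y" "continuous_on {0..d} p"
    "\<And>t. t \<in> {0..d} \<Longrightarrow> dist x (p t) = t \<and> dist (p t) y = d - t"
    "\<And>m. dist x m + dist m y = d \<Longrightarrow> dist x m \<in> {0..d} \<and> m = p (dist x m)"
    by (rule between_path[OF d_def[symmetric]]) (rule that)
  have fp: "continuous_on {0..d} (\<lambda>t. f (p t))"
    unfolding continuous_on_iff
  proof safe
    fix t e :: real assume "t \<in> {0..d}" "0 < e"
    then obtain r where "r > 0" "\<forall>t'\<in>{0..d}. dist t' t < r \<longrightarrow> dist (p t') (p t) < e"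
      using p(3) unfolding continuous_on_iff by blast
    thus "\<exists>r>0. \<forall>t'\<in>{0..d}. dist t' t < r \<longrightarrow> dist (f (p t')) (f (p t)) < e"
      using f_lip by (metis dist_real_def le_less_trans)
  qed
  define lo where "lo = min (f x) (f y)"
  define hi where "hi = max (f x) (f y)"
  have "\<bar>f x - f y\<bar> = dist (?p x) (?p y)" using f by (simp add: dist_line)
  hence hilo: "lo + S \<le> hi" using xy(2) by (auto simp: lo_def hi_def min_def max_def)
  have hit: "\<exists>z. dist x z + dist z y = d \<and> ?p z = c t" if t: "lo \<le> t" "t \<le> hi" for t
  proof -
    have "\<exists>r\<in>{0..d}. f (p r) = t"
    proof (cases "f x \<le> f y")
      case True
      hence "\<exists>r\<ge>0. r \<le> d \<and> f (p r) = t" using t d p(1,2) by (intro IVT' fp) (auto simp: lo_def hi_def)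
      thus ?thesis by auto
    next
      case False
      hence "\<exists>r\<ge>0. r \<le> d \<and> f (p r) = t" using t d p(1,2) by (intro IVT2' fp) (auto simp: lo_def hi_def)
      thus ?thesis by auto
    qed
    then obtain r where "r \<in> {0..d}" "f (p r) = t" by blast
    thus ?thesis using p(4)[of r] f by (intro exI[of _ "p r"]) auto
  qed
  define k where "k = \<lceil>(lo + n) / a\<rceil>"
  have "(lo + n) / a \<le> k" "k \<le> (lo + n) / a + 1" unfolding k_def by linarith+
  hence k: "lo + n \<le> k * a" "k * a \<le> lo + n + a" using period by (auto simp: field_simps)
  have "\<exists>z. \<bar>t\<bar> \<le> real n \<longrightarrow> dist x z + dist z y = d \<and> ?p z = c (t + k * a)" for t
    using hit[of "t + k * a"] k hilo by (cases "\<bar>t\<bar> \<le> real n") (auto simp: S_def)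
  then obtain z where z: "\<And>t. \<bar>t\<bar> \<le> real n \<Longrightarrow> dist x (z t) + dist (z t) y = d"
    "\<And>t. \<bar>t\<bar> \<le> real n \<Longrightarrow> ?p (z t) = c (t + k * a)" by metis
  define h where "h t = dist (c (t + k * a)) (z t)" for t
  have hp: "h t = dist (z t) (?p (z t))" if "\<bar>t\<bar> \<le> real n" for t using z(2)[OF that] by (simp add: h_def dist_commute)
  have zz: "dist (z t) (z s) \<le> H / N" if ts: "\<bar>t\<bar> \<le> real n" "\<bar>s\<bar> \<le> real n" for t s
  proof -
    have *: "dist x (z t) \<le> d" if "\<bar>t\<bar> \<le> real n" for t using z(1)[OF that] zero_le_dist[of "z t" y] by linarith
    have "dist (z t) (z s) = \<bar>dist x (z t) - dist x (z s)\<bar>"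
      using between_dist[of x "z t" y "z s"] between_dist[of x "z s" y "z t"] z(1) ts
      by (cases "dist x (z t) \<le> dist x (z s)") (auto simp: d_def dist_commute)
    also have "\<dots> \<le> d" using *[OF ts(1)] *[OF ts(2)] zero_le_dist[of x "z t"] zero_le_dist[of x "z s"] by linarith
    finally show ?thesis using xy by (simp add: d_def H_def)
  qed
  have hH: "H / 2 \<le> h t" if t: "\<bar>t\<bar> \<le> real n" for t
  proof -
    have "dist x (z t) \<le> d" using z(1)[OF t] zero_le_dist[of "z t" y] by linarith
    hence "H \<le> h t + H / N"
      using height_lipschitz[OF line, of x "z t"] xy hp[OF t] by (simp add: d_def H_def dist_commute)
    thus ?thesis using HN by linarith
  qed
  have "\<exists>m. \<bar>t\<bar> \<le> real n \<and> 0 \<le> u \<and> u \<le> h t \<longrightarrow> dist (c (t + k * a)) m = u \<and> dist m (z t) = h t - u" for t u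
    using between_ex[of u "c (t + k * a)" "z t"] by (metis h_def)
  then obtain r where r: "\<And>t u. \<bar>t\<bar> \<le> real n \<Longrightarrow> 0 \<le> u \<Longrightarrow> u \<le> h t \<Longrightarrow> dist (c (t + k * a)) (r t u) = u"
    "\<And>t u. \<bar>t\<bar> \<le> real n \<Longrightarrow> 0 \<le> u \<Longrightarrow> u \<le> h t \<Longrightarrow> dist (r t u) (z t) = h t - u" by metis
  have r_vert: "dist (r t u) (r t v) = \<bar>u - v\<bar>"
    if t: "\<bar>t\<bar> \<le> real n" "0 \<le> u" "u \<le> h t" "0 \<le> v" "v \<le> h t" for t u v
    using between_dist[of "c (t + k * a)" "r t u" "z t" "r t v"] between_dist[of "c (t + k * a)" "r t v" "z t" "r t u"]
      r(1)[OF t(1,2,3)] r(1)[OF t(1,4,5)] r(2)[OF t(1,2,3)] r(2)[OF t(1,4,5)] h_def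
    by (cases "u \<le> v") (auto simp: dist_commute)
  have r_level: "dist (r t u) (r s u) \<le> \<bar>t - s\<bar> + 1 / n"
    if ts: "\<bar>t\<bar> \<le> real n" "\<bar>s\<bar> \<le> real n" and u: "0 \<le> u" "u \<le> real n" for t s u
  proof -
    have uh: "u \<le> h t" "u \<le> h s" "0 < h t" "0 < h s" using hH ts u H by fastforce+
    \<comment> \<open>The points of height \<open>u\<close> divide the two perpendiculars in
      different ratios. The comparison is made at the common ratio \<open>l\<close>, followed by a
      slide along the second perpendicular.\<close>
    define l where "l = u / h t"
    have l: "0 \<le> l" "l \<le> 1" "l * h t = u" using uh u by (auto simp: l_def)
    have ls: "0 \<le> l * h s" "l * h s \<le> h s" using l uh mult_right_mono[of l 1 "h s"] by auto
    have "dist (r t u) (r s (l * h s)) \<le> (1 - l) * dist (c (t + k * a)) (c (s + k * a)) + l * dist (z t) (z s)"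
    proof (rule dist_fractions[OF l(1,2)])
      show "dist (c (t + k * a)) (r t u) = l * dist (c (t + k * a)) (z t)"
        "dist (r t u) (z t) = (1 - l) * dist (c (t + k * a)) (z t)"
        "dist (c (s + k * a)) (r s (l * h s)) = l * dist (c (s + k * a)) (z s)"
        "dist (r s (l * h s)) (z s) = (1 - l) * dist (c (s + k * a)) (z s)"
        unfolding h_def[of t, symmetric] h_def[of s, symmetric] r(1)[OF ts(1) u(1) uh(1)] r(2)[OF ts(1) u(1) uh(1)]
          r(1)[OF ts(2) ls] r(2)[OF ts(2) ls] using l(3) by (simp_all add: left_diff_distrib)
    qed
    also have "\<dots> \<le> \<bar>t - s\<bar> + l * (H / N)"
    proof (rule add_mono)
      have "(1 - l) * \<bar>t - s\<bar> \<le> 1 * \<bar>t - s\<bar>" using l by (intro mult_right_mono) auto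
      thus "(1 - l) * dist (c (t + k * a)) (c (s + k * a)) \<le> \<bar>t - s\<bar>" by (simp add: dist_line)
      show "l * dist (z t) (z s) \<le> l * (H / N)" using zz ts l by (intro mult_left_mono) auto
    qed
    finally have 1: "dist (r t u) (r s (l * h s)) \<le> \<bar>t - s\<bar> + l * (H / N)" .
    have "dist (r s (l * h s)) (r s u) = \<bar>l * h s - l * h t\<bar>" using r_vert[OF ts(2) ls u(1) uh(2)] l by simp
    also have "\<dots> = l * \<bar>h s - h t\<bar>" by (metis abs_mult abs_of_nonneg l(1) right_diff_distrib)
    also have "\<dots> \<le> l * (H / N)"
    proof (rule mult_left_mono)
      have "\<bar>h s - h t\<bar> \<le> dist (z t) (z s)"
        using height_lipschitz[OF line, of "z s" "z t"] height_lipschitz[OF line, of "z t" "z s"]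
        by (simp add: hp ts dist_commute)
      thus "\<bar>h s - h t\<bar> \<le> H / N" using zz[OF ts] by linarith
    qed (use l in auto)
    finally have 2: "dist (r s (l * h s)) (r s u) \<le> l * (H / N)" .
    have "l \<le> n / (H / 2)" unfolding l_def using u uh hH[OF ts(1)] H by (intro frac_le) auto
    hence "l * (H / N) \<le> n / (H / 2) * (H / N)" using H by (intro mult_right_mono) auto
    also have "\<dots> = 2 * n / N" using H by simp
    also have "\<dots> = 1 / (2 * n)" using n by (simp add: N_def power2_eq_square)
    finally have "2 * (l * (H / N)) \<le> 1 / n" by simp
    moreover define e where "e = l * (H / N)"
    ultimately show ?thesis using 1 2 dist_triangle[of "r t u" "r s u" "r s (l * h s)"]
      unfolding e_def[symmetric] by linarith
  qed
  have r_height: "u \<le> dist (r t u) (c s)" if t: "\<bar>t\<bar> \<le> real n" "0 \<le> u" "u \<le> real n" for t u s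
  proof -
    have uh: "u \<le> h t" using hH[OF t(1)] t H by linarith
    have "?p (r t u) = ?p (z t)"
      using r(1)[OF t(1,2) uh] r(2)[OF t(1,2) uh] z(2)[OF t(1)]
      by (intro proj_between line) (simp add: h_def dist_commute)
    hence "dist (r t u) (?p (r t u)) = u" using r(1)[OF t(1,2) uh] z(2)[OF t(1)] by (simp add: dist_commute)
    thus ?thesis using proj_le[OF line, of "c s" "r t u"] by simp
  qed
  obtain F where F: "\<And>x y. dist (F x) (F y) = dist x y" "\<And>t. F (c t) = c (t + of_int (- k) * a)"
    using shifts by blast
  have "almost_flat n (\<lambda>(t, u). F (r t u))"
    unfolding almost_flat_def
  proof (intro allI impI, elim conjE, unfold prod.case, intro conjI)
    fix t s u v :: real assume A: "\<bar>t\<bar> \<le> real n" "\<bar>s\<bar> \<le> real n" "0 \<le> u" "u \<le> real n" "0 \<le> v" "v \<le> real n"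
    have uh: "u \<le> h t" "v \<le> h t" "0 \<le> h t" using hH[OF A(1)] A H by linarith+
    have "r t 0 = c (t + k * a)" using r(1)[OF A(1), of 0] uh by simp
    thus "F (r t 0) = c t" using F by (simp add: algebra_simps)
    show "dist (F (r t u)) (F (r t v)) = \<bar>u - v\<bar>" using F r_vert A uh by simp
    show "dist (F (r t u)) (F (r s u)) \<le> \<bar>t - s\<bar> + 1 / n" using F r_level A by simp
    have "u \<le> dist (r t u) (c (s + k * a))" using r_height A by simp
    also have "\<dots> = dist (F (r t u)) (c s)"
      using F(1)[of "r t u" "c (s + k * a)"] F(2)[of "s + k * a"] by simp
    finally show "u \<le> dist (F (r t u)) (c s)" .
  qed
  thus ?thesis by blast
qed

text \<open>A pointwise limit by Tychonoff's theorem: \<open>almost_flat\<close> is a closed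
  condition in the product topology, the values lie in compact balls, and finitely many of the
  conditions hold simultaneously by \<open>almost_flat_ex\<close> with the largest
  parameter.\<close>

lemma flat_ex:
  assumes fail: "\<And>B. 0 < B \<Longrightarrow> \<exists>x y. dist x y \<le> dist x (proj (range c) x) / 2 \<and> B < dist (proj (range c) x) (proj (range c) y)"
  obtains \<rho> where "\<And>t. \<rho> (t, 0) = c t" "\<And>t u v. 0 \<le> u \<Longrightarrow> 0 \<le> v \<Longrightarrow> dist (\<rho> (t, u)) (\<rho> (t, v)) = \<bar>u - v\<bar>"
    "\<And>t s u. 0 \<le> u \<Longrightarrow> dist (\<rho> (t, u)) (\<rho> (s, u)) \<le> \<bar>t - s\<bar>" "\<And>t s u. 0 \<le> u \<Longrightarrow> u \<le> dist (\<rho> (t, u)) (c s)"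
proof -
  define D where "D = (\<lambda>(t, u). cball (c t) \<bar>u\<bar>)"
  let ?D = "PiE UNIV D"
  let ?K = "\<lambda>n::nat. {\<rho>. almost_flat (real (Suc n)) \<rho>}"
  have K1: "compact ?D"
  proof -
    have "compactin (product_topology (\<lambda>i. euclidean) UNIV) ?D"
      unfolding compactin_PiE using proper by (auto simp: proper_space_def D_def)
    thus ?thesis by (simp add: euclidean_product_topology)
  qed
  have K2: "closed (?K n)" for n
  proof -
    have ev: "continuous_on UNIV (\<lambda>\<rho>. \<rho> i :: 'x)" for i :: "real \<times> real" by (rule continuous_on_product_coordinates)
    have "closed {\<rho>. \<rho> (t, 0 :: real) = c t}" for t
      by (intro closed_Collect_eq ev continuous_on_const)
    moreover have "closed {\<rho>. dist (\<rho> (t, u) :: 'x) (\<rho> (t, v)) = \<bar>u - v\<bar>}" for t u v :: real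
      by (intro closed_Collect_eq continuous_on_dist ev continuous_on_const)
    moreover have "closed {\<rho>. dist (\<rho> (t, u) :: 'x) (\<rho> (s, u)) \<le> \<bar>t - s\<bar> + 1 / real (Suc n)}" for t s u :: real
      by (intro closed_Collect_le continuous_on_dist ev continuous_on_const)
    moreover have "closed {\<rho>. u \<le> dist (\<rho> (t, u)) (c s)}" for t s u :: real
      by (intro closed_Collect_le continuous_on_dist ev continuous_on_const)
    ultimately show ?thesis
      unfolding almost_flat_def by (intro closed_Collect_all closed_Collect_imp open_Collect_const closed_Collect_conj)
  qed
  have K3: "?D \<inter> (\<Inter>n\<in>I. ?K n) \<noteq> {}" if I: "finite I" for I
  proof -
    obtain M where M: "\<forall>n\<in>I. n \<le> M" using I by (meson finite_nat_set_iff_bounded_le)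
    obtain \<rho> where \<rho>: "almost_flat (Suc M) \<rho>" using almost_flat_ex[OF _ fail, of "Suc M"] by auto
    \<comment> \<open>Outside the controlled rectangle the value \<open>c t\<close> keeps the map
      inside the product of balls.\<close>
    define \<rho>' :: "real \<times> real \<Rightarrow> 'x" where "\<rho>' = (\<lambda>(t, u). if \<bar>t\<bar> \<le> real (Suc M) \<and> 0 \<le> u \<and> u \<le> real (Suc M) then \<rho> (t, u) else c t)"
    have "almost_flat (Suc n) \<rho>'" if n: "n \<in> I" for n
    proof -
      have nM: "real (Suc n) \<le> real (Suc M)" using M n by simp
      hence div: "1 / real (Suc M) \<le> 1 / real (Suc n)" by (intro divide_left_mono) auto
      show ?thesis unfolding almost_flat_def
      proof (intro allI impI, elim conjE)
        fix t s u v :: real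
        assume A: "\<bar>t\<bar> \<le> real (Suc n)" "\<bar>s\<bar> \<le> real (Suc n)" "0 \<le> u" "u \<le> real (Suc n)" "0 \<le> v" "v \<le> real (Suc n)"
        hence A': "\<bar>t\<bar> \<le> real (Suc M)" "\<bar>s\<bar> \<le> real (Suc M)" "0 \<le> u" "u \<le> real (Suc M)" "0 \<le> v" "v \<le> real (Suc M)"
          using nM by linarith+
        have "\<rho>' (t, u) = \<rho> (t, u)" "\<rho>' (t, v) = \<rho> (t, v)" "\<rho>' (s, u) = \<rho> (s, u)" "\<rho>' (t, 0) = \<rho> (t, 0)"
          using A' by (auto simp: \<rho>'_def)
        moreover have "\<rho> (t, 0) = c t \<and> dist (\<rho> (t, u)) (\<rho> (t, v)) = \<bar>u - v\<bar> \<and>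
             dist (\<rho> (t, u)) (\<rho> (s, u)) \<le> \<bar>t - s\<bar> + 1 / real (Suc M) \<and> u \<le> dist (\<rho> (t, u)) (c s)"
          using \<rho> A' unfolding almost_flat_def by blast
        ultimately show "\<rho>' (t, 0) = c t \<and> dist (\<rho>' (t, u)) (\<rho>' (t, v)) = \<bar>u - v\<bar> \<and>
             dist (\<rho>' (t, u)) (\<rho>' (s, u)) \<le> \<bar>t - s\<bar> + 1 / real (Suc n) \<and> u \<le> dist (\<rho>' (t, u)) (c s)"
          using div by auto
      qed
    qed
    moreover have "\<rho>' \<in> ?D"
    proof -
      have "\<rho>' (t, u) \<in> D (t, u)" for t u
      proof (cases "\<bar>t\<bar> \<le> real (Suc M) \<and> 0 \<le> u \<and> u \<le> real (Suc M)")
        case True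
        hence "\<rho> (t, 0) = c t" "dist (\<rho> (t, 0)) (\<rho> (t, u)) = \<bar>0 - u\<bar>"
          using \<rho> unfolding almost_flat_def by (metis abs_ge_zero of_nat_0_le_iff order_refl)+
        thus ?thesis using True by (simp add: \<rho>'_def D_def)
      qed (auto simp: \<rho>'_def D_def)
      thus ?thesis by (simp add: PiE_UNIV_domain Pi_iff)
    qed
    ultimately show ?thesis by blast
  qed
  have "?D \<inter> (\<Inter>n\<in>UNIV. ?K n) \<noteq> {}" by (rule compact_imp_fip_image[OF K1 K2 K3])
  then obtain \<rho> where \<rho>: "\<And>n. almost_flat (real (Suc n)) \<rho>" by blast
  have ex: "\<exists>n. \<bar>t\<bar> \<le> real (Suc n) \<and> \<bar>s\<bar> \<le> real (Suc n) \<and> u \<le> real (Suc n) \<and> v \<le> real (Suc n) \<and> m \<le> n" for t s u v m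
  proof -
    obtain n where "max \<bar>t\<bar> (max \<bar>s\<bar> (max u (max v (real m)))) \<le> real n" using real_arch_simple by blast
    thus ?thesis by (intro exI[of _ n]) auto
  qed
  have all: "\<exists>n\<ge>m. \<rho> (t, 0) = c t \<and> dist (\<rho> (t, u)) (\<rho> (t, v)) = \<bar>u - v\<bar> \<and>
     dist (\<rho> (t, u)) (\<rho> (s, u)) \<le> \<bar>t - s\<bar> + 1 / real (Suc n) \<and> u \<le> dist (\<rho> (t, u)) (c s)"
    if "0 \<le> u" "0 \<le> v" for t s u v m
  proof -
    obtain n where "\<bar>t\<bar> \<le> real (Suc n)" "\<bar>s\<bar> \<le> real (Suc n)" "u \<le> real (Suc n)" "v \<le> real (Suc n)" "m \<le> n"
      using ex[of t s u v m] by blast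
    thus ?thesis using \<rho>[of n] that unfolding almost_flat_def by blast
  qed
  show ?thesis
  proof (rule that[of \<rho>])
    show "\<rho> (t, 0) = c t" for t using all[of 0 0] by blast
    show "dist (\<rho> (t, u)) (\<rho> (t, v)) = \<bar>u - v\<bar>" if "0 \<le> u" "0 \<le> v" for t u v using all that by blast
    show "u \<le> dist (\<rho> (t, u)) (c s)" if "0 \<le> u" for t s u using all that by blast
    show "dist (\<rho> (t, u)) (\<rho> (s, u)) \<le> \<bar>t - s\<bar>" if u: "0 \<le> u" for t s u
    proof (rule field_le_epsilon)
      fix e :: real assume "0 < e"
      then obtain m :: nat where m: "1 / real (Suc m) < e" using nat_approx_posE by blast
      obtain n where "m \<le> n" "dist (\<rho> (t, u)) (\<rho> (s, u)) \<le> \<bar>t - s\<bar> + 1 / real (Suc n)"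
        using all[OF u u] by blast
      moreover have "1 / real (Suc n) \<le> 1 / real (Suc m)" using \<open>m \<le> n\<close> by (intro divide_left_mono) auto
      ultimately show "dist (\<rho> (t, u)) (\<rho> (s, u)) \<le> \<bar>t - s\<bar> + e" using m by linarith
    qed
  qed
qed

text \<open>The row at height \<open>u\<close> is a geodesic, and its points have distance at least
  \<open>v - u\<close> from \<open>\<rho> (s, v)\<close>, since descending from the row to
  \<open>c\<close> costs only \<open>u\<close>. So there is a right angle at
  \<open>\<rho> (s, u)\<close>.\<close>

lemma flat_pythagoras_le:
  assumes \<rho>: "\<And>t. \<rho> (t, 0) = c t" "\<And>t u v. 0 \<le> u \<Longrightarrow> 0 \<le> v \<Longrightarrow> dist (\<rho> (t, u)) (\<rho> (t, v)) = \<bar>u - v\<bar>"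
    "\<And>t s u. 0 \<le> u \<Longrightarrow> dist (\<rho> (t, u)) (\<rho> (s, u)) = \<bar>t - s\<bar>" "\<And>t s u. 0 \<le> u \<Longrightarrow> u \<le> dist (\<rho> (t, u)) (c s)"
    and uv: "0 \<le> u" "u \<le> v"
  shows "(v - u)\<^sup>2 + (s - t)\<^sup>2 \<le> (dist (\<rho> (s, v)) (\<rho> (t, u)))\<^sup>2"
proof -
  have e: "dist (\<rho> (s, v)) (\<rho> (s, u)) = v - u" "dist (\<rho> (s, u)) (\<rho> (t, u)) = \<bar>s - t\<bar>" using \<rho> uv by auto
  have "(dist (\<rho> (s, v)) (\<rho> (s, u)))\<^sup>2 + (dist (\<rho> (s, u)) (\<rho> (t, u)))\<^sup>2 \<le> (dist (\<rho> (s, v)) (\<rho> (t, u)))\<^sup>2"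
  proof (rule pythagoras_le)
    fix l :: real assume l: "0 < l" "l \<le> 1"
    let ?r = "s + l * (t - s)"
    let ?m = "\<rho> (?r, u)"
    have "v \<le> dist (\<rho> (s, v)) (c ?r)" using \<rho>(4) uv by auto
    also have "\<dots> \<le> dist (\<rho> (s, v)) ?m + dist ?m (\<rho> (?r, 0))" unfolding \<rho>(1) by (rule dist_triangle)
    also have "dist ?m (\<rho> (?r, 0)) = u" using \<rho>(2)[of u 0] uv by simp
    finally have "dist (\<rho> (s, v)) (\<rho> (s, u)) \<le> dist (\<rho> (s, v)) ?m" using e by simp
    moreover have "\<bar>s - ?r\<bar> = l * \<bar>s - t\<bar>" using l by (simp add: abs_mult abs_minus_commute)
    moreover have "\<bar>?r - t\<bar> = (1 - l) * \<bar>s - t\<bar>"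
    proof -
      have "?r - t = (1 - l) * (s - t)" by (simp add: algebra_simps)
      thus ?thesis using l by (simp add: abs_mult)
    qed
    ultimately show "\<exists>m. dist (\<rho> (s, u)) m = l * dist (\<rho> (s, u)) (\<rho> (t, u)) \<and>
        dist m (\<rho> (t, u)) = (1 - l) * dist (\<rho> (s, u)) (\<rho> (t, u)) \<and> dist (\<rho> (s, v)) (\<rho> (s, u)) \<le> dist (\<rho> (s, v)) m"
      using \<rho>(3) uv by (intro exI[of _ ?m]) auto
  qed
  thus ?thesis using e by simp
qed

text \<open>In each coordinate rectangle of the limit map, \<open>quadrilateral\<close> bounds the
  sum of the squared diagonals by exactly the sum of the lower bounds from
  \<open>flat_pythagoras_le\<close>. Both diagonals are therefore Euclidean.\<close>

theorem bounds_half_flat_if_not_half_contracting: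
  assumes fail: "\<And>B. 0 < B \<Longrightarrow> \<exists>x y. dist x y \<le> dist x (proj (range c) x) / 2 \<and> B < dist (proj (range c) x) (proj (range c) y)"
  shows "bounds_half_flat (range c)"
proof -
  obtain \<rho> where \<rho>: "\<And>t. \<rho> (t, 0) = c t" "\<And>t u v. 0 \<le> u \<Longrightarrow> 0 \<le> v \<Longrightarrow> dist (\<rho> (t, u)) (\<rho> (t, v)) = \<bar>u - v\<bar>"
    "\<And>t s u. 0 \<le> u \<Longrightarrow> dist (\<rho> (t, u)) (\<rho> (s, u)) \<le> \<bar>t - s\<bar>" "\<And>t s u. 0 \<le> u \<Longrightarrow> u \<le> dist (\<rho> (t, u)) (c s)"
    using flat_ex[OF fail] by blast
  have pr: "proj (range c) (\<rho> (t, u)) = c t" if u: "0 \<le> u" for t u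
  proof (rule proj_unique[OF line])
    obtain s where "proj (range c) (\<rho> (t, u)) = c s" using proj_in[OF line, of "\<rho> (t, u)"] by auto
    thus "dist (\<rho> (t, u)) (c t) \<le> dist (\<rho> (t, u)) (proj (range c) (\<rho> (t, u)))"
      using \<rho>(4)[OF u] \<rho>(2)[of u 0 t] u \<rho>(1) by simp
  qed simp
  have lev: "dist (\<rho> (t, u)) (\<rho> (s, u)) = \<bar>t - s\<bar>" if u: "0 \<le> u" for t s u
    using \<rho>(3)[OF u, of t s] proj_lipschitz[OF line, of "\<rho> (t, u)" "\<rho> (s, u)"] pr[OF u] by (simp add: dist_line)
  note low = flat_pythagoras_le[OF \<rho>(1,2) lev \<rho>(4)]
  have sq: "(dist (\<rho> (s, v)) (\<rho> (t, u)))\<^sup>2 = (s - t)\<^sup>2 + (v - u)\<^sup>2" if uv: "0 \<le> u" "u \<le> v" for s t u v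
  proof -
    have "(dist (\<rho> (s, v)) (\<rho> (t, u)))\<^sup>2 + (dist (\<rho> (s, u)) (\<rho> (t, v)))\<^sup>2
       \<le> (v - u)\<^sup>2 + (s - t)\<^sup>2 + (v - u)\<^sup>2 + (s - t)\<^sup>2"
      using quadrilateral[of "\<rho> (s, v)" "\<rho> (t, u)" "\<rho> (s, u)" "\<rho> (t, v)"] \<rho>(2) lev uv
      by (simp add: power2_commute)
    moreover have "(v - u)\<^sup>2 + (s - t)\<^sup>2 \<le> (dist (\<rho> (s, v)) (\<rho> (t, u)))\<^sup>2" by (rule low[OF _ _ _ _ uv])
    moreover have "(v - u)\<^sup>2 + (s - t)\<^sup>2 \<le> (dist (\<rho> (s, u)) (\<rho> (t, v)))\<^sup>2"
      using low[OF _ _ _ _ uv, of t s] by (simp add: dist_commute power2_commute)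
    ultimately show ?thesis by linarith
  qed
  define h :: "real^2 \<Rightarrow> 'x" where "h v = \<rho> (v $ 1, v $ 2)" for v
  have "dist (h v) (h w) = dist v w" if vw: "0 \<le> v $ 2" "0 \<le> w $ 2" for v w
  proof -
    have "(dist (h v) (h w))\<^sup>2 = (v $ 1 - w $ 1)\<^sup>2 + (v $ 2 - w $ 2)\<^sup>2"
      using sq[of "w $ 2" "v $ 2" "v $ 1" "w $ 1"] sq[of "v $ 2" "w $ 2" "w $ 1" "v $ 1"] vw
      by (cases "w $ 2 \<le> v $ 2") (auto simp: h_def dist_commute power2_commute)
    also have "\<dots> = (dist v w)\<^sup>2"
      by (simp add: dist_vec_def L2_set_def UNIV_2 dist_real_def)
    finally show ?thesis by (simp add: power2_eq_iff_nonneg)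
  qed
  moreover have "h ` {v. v $ 2 = 0} = range c"
  proof safe
    fix v :: "real^2" assume "v $ 2 = 0"
    thus "h v \<in> range c" by (simp add: h_def \<rho>)
  next
    fix t
    have "h (vector [t, 0]) = c t" by (simp add: h_def \<rho>)
    thus "c t \<in> h ` {v. v $ 2 = 0}" by (intro image_eqI[of _ _ "vector [t, 0]"]) auto
  qed
  ultimately show ?thesis unfolding bounds_half_flat_def isometric_embedding_on_def by blast
qed

corollary contracting_if_not_bounds_half_flat:
  assumes "\<not> bounds_half_flat (range c)"
  shows "\<exists>B. contracting B (range c)"
proof -
  obtain B where "0 < B" "\<And>x y. dist x y \<le> dist x (proj (range c) x) / 2 \<Longrightarrow>
      dist (proj (range c) x) (proj (range c) y) \<le> B"
    using bounds_half_flat_if_not_half_contracting assms by (meson not_le)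
  then interpret half_contracting_line T "range c" B by unfold_locales (use line in auto)
  show ?thesis using contracting_48 by blast
qed

end

section \<open>Contracting axes in group actions\<close>

locale isometric_action = group G + proper_CAT0 "TYPE('x)"
  for G :: "('g, 'm) monoid_scheme" (structure) and \<phi> :: "'g \<Rightarrow> 'x::metric_space \<Rightarrow> 'x" +
  assumes act_mult: "g \<in> carrier G \<Longrightarrow> h \<in> carrier G \<Longrightarrow> \<phi> (g \<otimes> h) p = \<phi> g (\<phi> h p)"
    and act_one: "\<phi> \<one> p = p"
    and act_dist: "g \<in> carrier G \<Longrightarrow> dist (\<phi> g p) (\<phi> g q) = dist p q"
    and finite_displacement: "finite {g \<in> carrier G. dist p (\<phi> g p) \<le> r}"
begin

lemma act_inv: "g \<in> carrier G \<Longrightarrow> \<phi> (inv g) (\<phi> g p) = p" "g \<in> carrier G \<Longrightarrow> \<phi> g (\<phi> (inv g) p) = p"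
  using act_mult[of "inv g" g p] act_mult[of g "inv g" p] act_one by auto

lemma act_inv_dist: "g \<in> carrier G \<Longrightarrow> dist (\<phi> (inv g) p) q = dist p (\<phi> g q)"
  using act_dist[of g "\<phi> (inv g) p" q] act_inv by simp

lemma act_inv_dist': "g \<in> carrier G \<Longrightarrow> dist q (\<phi> (inv g) p) = dist (\<phi> g q) p"
  using act_inv_dist[of g p q] by (simp add: dist_commute)

lemma act_surj: "g \<in> carrier G \<Longrightarrow> surj (\<phi> g)"
  using act_inv(2) by (metis surjI)

lemma is_line_act: "is_line L \<Longrightarrow> g \<in> carrier G \<Longrightarrow> is_line (\<phi> g ` L)"
  by (rule is_line_image) (auto simp: act_dist)

lemma proj_act: "is_line L \<Longrightarrow> g \<in> carrier G \<Longrightarrow> proj (\<phi> g ` L) (\<phi> g x) = \<phi> g (proj L x)"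
  by (rule proj_image) (auto simp: act_dist)

lemma contracting_act: "is_line L \<Longrightarrow> contracting B L \<Longrightarrow> g \<in> carrier G \<Longrightarrow> contracting B (\<phi> g ` L)"
  by (rule contracting_image) (auto simp: act_dist act_surj)

lemma act_int_pow:
  fixes c :: "real \<Rightarrow> 'x"
  assumes g: "g \<in> carrier G" and translate: "\<And>t. \<phi> g (c t) = c (t + a)"
  shows "\<phi> (g [^] (k :: int)) (c t) = c (t + of_int k * a)"
proof -
  have nat: "\<phi> (g [^] int n) (c t) = c (t + real n * a)" for n t
  proof (induction n arbitrary: t)
    case 0
    thus ?case by (simp add: act_one)
  next
    case (Suc n)
    have "\<phi> (g [^] int (Suc n)) (c t) = \<phi> (g [^] int n) (\<phi> g (c t))"
      using g by (simp only: int_pow_int) (simp add: act_mult)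
    thus ?case using Suc by (simp add: translate algebra_simps)
  qed
  show ?thesis
  proof (cases "0 \<le> k")
    case True
    thus ?thesis using nat[of "nat k"] by simp
  next
    case False
    define n where "n = nat (- k)"
    have k: "k = - int n" using False by (simp add: n_def)
    have "\<phi> (g [^] k) (\<phi> (g [^] int n) (c (t + of_int k * a))) = c (t + of_int k * a)"
      unfolding k using g act_inv(1)[of "g [^] int n"] by (simp add: int_pow_neg)
    thus ?thesis using k nat[of n "t + of_int k * a"] by simp
  qed
qed

end

section \<open>Elements commensurating the axis\<close>

locale contracting_axis = isometric_action G \<phi>
  for G :: "('g, 'm) monoid_scheme" (structure) and \<phi> :: "'g \<Rightarrow> 'x::metric_space \<Rightarrow> 'x" +
  fixes g :: 'g and c :: "real \<Rightarrow> 'x" and a B :: real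
  assumes g: "g \<in> carrier G" and iso: "isometric_embedding_on UNIV c" and a: "0 < a"
    and translate: "\<phi> g (c t) = c (t + a)" and contr: "contracting B (range c)"
begin

abbreviation "L \<equiv> range c"
abbreviation "bp \<equiv> c 0"
abbreviation gpow :: "int \<Rightarrow> 'g" where "gpow k \<equiv> g [^] k"

definition len :: "'g \<Rightarrow> real" where "len x = dist bp (\<phi> x bp)"

text \<open>The commensurator of the infinite cyclic group generated by \<open>g\<close>; it plays
  the role of the maximal elementary subgroup containing \<open>g\<close>.\<close>

definition commensurating :: "'g \<Rightarrow> bool" where
  "commensurating h \<longleftrightarrow> h \<in> carrier G \<and> (\<exists>k l. k \<noteq> 0 \<and> l \<noteq> 0 \<and> h \<otimes> gpow k = gpow l \<otimes> h)"

lemma dist_axis: "dist (c s) (c t) = \<bar>s - t\<bar>"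
  by (rule isometric_lineD[OF iso])

lemma line: "is_line L"
  using iso by (auto simp: is_line_def)

lemma B_nonneg: "0 \<le> B"
  using contr by (simp add: contracting_def)

lemma pow_closed [simp]: "gpow k \<in> carrier G"
  using g by simp

lemma act_pow: "\<phi> (gpow k) (c t) = c (t + of_int k * a)"
  by (rule act_int_pow[where c = c and a = a, OF g translate])

lemma act_pow_line: "\<phi> (gpow k) ` L = L"
proof -
  have "c t \<in> \<phi> (gpow k) ` L" for t
    using act_pow[of k "t - of_int k * a"] by (metis diff_add_cancel image_eqI rangeI)
  thus ?thesis by (auto simp: act_pow)
qed

lemma pow_add: "gpow (k + l) = gpow k \<otimes> gpow l"
  using g by (rule int_pow_mult)

lemma pow_inj: "gpow k = gpow l \<Longrightarrow> k = l"
  using act_pow[of k 0] act_pow[of l 0] dist_axis[of "k * a" "l * a"] a by simp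

lemma proj_pow: "proj L (\<phi> (gpow k) x) = \<phi> (gpow k) (proj L x)"
  using proj_act[OF line, of "gpow k" x] by (simp add: act_pow_line)

lemma near_orbit:
  assumes "dist p (proj L p) \<le> H"
  obtains j where "dist p (\<phi> (gpow j) bp) \<le> H + a"
proof -
  obtain s where s: "proj L p = c s" using proj_in[OF line, of p] by auto
  define j where "j = \<lfloor>s / a\<rfloor>"
  have "j \<le> s / a" "s / a \<le> j + 1" unfolding j_def by linarith+
  hence "\<bar>s - j * a\<bar> \<le> a" using a by (auto simp: field_simps)
  hence "dist (proj L p) (\<phi> (gpow j) bp) \<le> a" by (simp add: s act_pow dist_axis)
  thus ?thesis using that[of j] assms dist_triangle[of p "\<phi> (gpow j) bp" "proj L p"] by linarith
qed

lemma cancel_eq: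
  assumes h: "h \<in> carrier G" "h' \<in> carrier G" and eq: "inv (gpow j) \<otimes> h = inv (gpow j') \<otimes> h'"
  shows "h = gpow (j - j') \<otimes> h'"
proof -
  have "h = gpow j \<otimes> (inv (gpow j) \<otimes> h)" using h by (simp add: m_assoc[symmetric])
  also have "\<dots> = gpow j \<otimes> inv (gpow j') \<otimes> h'" using h by (simp add: eq m_assoc)
  also have "gpow j \<otimes> inv (gpow j') = gpow (j - j')" using g by (simp add: int_pow_diff)
  finally show ?thesis .
qed

text \<open>Correct each \<open>h \<otimes> gpow i\<close> on the left by the power of
  \<open>g\<close> that brings it back near \<open>bp\<close>. There are more indices than elements
  of the resulting length, so two corrected elements coincide, which is the relation sought.\<close>

lemma commensurating_if_near:
  assumes h: "h \<in> carrier G" and I: "card {x \<in> carrier G. len x \<le> H + a} < card I"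
    and near: "\<And>i. i \<in> I \<Longrightarrow> dist (\<phi> h (c (of_int i * a))) (proj L (\<phi> h (c (of_int i * a)))) \<le> H"
  shows "commensurating h"
proof -
  let ?F = "{x \<in> carrier G. len x \<le> H + a}"
  have "\<exists>j. i \<in> I \<longrightarrow> dist (\<phi> h (\<phi> (gpow i) bp)) (\<phi> (gpow j) bp) \<le> H + a" for i
    using near_orbit near[of i] by (metis act_pow add_0)
  then obtain j where j: "\<And>i. i \<in> I \<Longrightarrow> dist (\<phi> h (\<phi> (gpow i) bp)) (\<phi> (gpow (j i)) bp) \<le> H + a" by metis
  define f where "f i = inv (gpow (j i)) \<otimes> (h \<otimes> gpow i)" for i
  have "f ` I \<subseteq> ?F"
  proof safe
    fix i assume i: "i \<in> I"
    show "f i \<in> carrier G" using h by (simp add: f_def)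
    have "len (f i) = dist (\<phi> h (\<phi> (gpow i) bp)) (\<phi> (gpow (j i)) bp)"
      unfolding len_def f_def using h by (simp add: act_mult dist_commute[of bp] act_inv_dist)
    thus "len (f i) \<le> H + a" using j[OF i] by simp
  qed
  hence "card (f ` I) \<le> card ?F"
    by (rule card_mono[rotated]) (use finite_displacement[of bp "H + a"] in \<open>simp add: len_def\<close>)
  hence "card (f ` I) < card I" using I by linarith
  then obtain i i' where i: "i \<noteq> i'" "f i = f i'"
    using pigeonhole by (meson inj_on_def)
  have eq: "h \<otimes> gpow i = gpow (j i - j i') \<otimes> (h \<otimes> gpow i')"
    by (rule cancel_eq) (use h i in \<open>auto simp: f_def\<close>)
  have eq': "h \<otimes> gpow (i - i') = gpow (j i - j i') \<otimes> h"
  proof -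
    have "h \<otimes> gpow (i - i') = (h \<otimes> gpow i) \<otimes> gpow (- i')" using h pow_add[of i "- i'"] by (simp add: m_assoc)
    also have "\<dots> = gpow (j i - j i') \<otimes> h \<otimes> (gpow i' \<otimes> gpow (- i'))" using h by (simp add: eq m_assoc)
    also have "\<dots> = gpow (j i - j i') \<otimes> h" using h pow_add[of i' "- i'"] by simp
    finally show ?thesis .
  qed
  have "j i \<noteq> j i'"
  proof
    assume "j i = j i'"
    hence "h \<otimes> gpow (i - i') = h \<otimes> gpow 0" using eq' h by simp
    hence "gpow (i - i') = gpow 0"
      using h Units_l_cancel[of h "gpow (i - i')" "gpow 0"] Units_eq pow_closed by blast
    thus False using pow_inj i by fastforce
  qed
  thus ?thesis unfolding commensurating_def using h eq' i
    by (intro conjI exI[of _ "i - i'"] exI[of _ "j i - j i'"]) auto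
qed

lemma commensurating_inv:
  assumes "commensurating h"
  shows "commensurating (inv h)"
proof -
  obtain k l where kl: "h \<in> carrier G" "k \<noteq> 0" "l \<noteq> 0" "h \<otimes> gpow k = gpow l \<otimes> h"
    using assms unfolding commensurating_def by blast
  have "inv h \<otimes> gpow l = inv h \<otimes> (gpow l \<otimes> h) \<otimes> inv h" using kl(1) by (simp add: m_assoc)
  also have "\<dots> = gpow k \<otimes> inv h" using kl(1) by (simp add: m_assoc[symmetric] flip: kl(4))
  finally show ?thesis unfolding commensurating_def using kl by auto
qed

text \<open>Otherwise half of \<open>h L\<close> stays close to \<open>L\<close>, and proper discontinuity applies.\<close>

lemma bounded_projection:
  assumes h: "h \<in> carrier G" and "\<not> commensurating h"
  shows "\<exists>K. \<forall>p \<in> \<phi> h ` L. dist (proj L p) bp \<le> K"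
proof (rule ccontr)
  assume unbounded: "\<not> ?thesis"
  define e where "e t = \<phi> h (c t)" for t
  have de: "dist (e s) (e t) = \<bar>s - t\<bar>" for s t using h by (simp add: e_def act_dist dist_axis)
  define H where "H = max (dist (e 0) (proj L (e 0))) B"
  define N where "N = card {x \<in> carrier G. len x \<le> H + a} + 1"
  \<comment> \<open>So large that the point where the geodesic along \<open>h L\<close> meets the
    neighbourhood of \<open>L\<close> is at least \<open>real N * a\<close> away from
    \<open>e 0\<close>, which leaves room for \<open>N\<close> translates.\<close>
  define K where "K = dist (proj L (e 0)) bp + 2 * B + real N * a + H"
  have "\<exists>t. K < dist (proj L (e t)) bp" using unbounded unfolding e_def by (force simp: not_le)
  then obtain t where t: "K < dist (proj L (e t)) bp" by blast
  have H0: "0 \<le> H" by (simp add: H_def max.coboundedI1)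
  have far: "2 * B + real N * a + H < dist (proj L (e t)) (proj L (e 0))"
    using t dist_triangle[of "proj L (e t)" bp "proj L (e 0)"] by (simp add: K_def)
  hence "B < dist (proj L (e t)) (proj L (e 0))" using B_nonneg H0 a by (smt (verit) mult_nonneg_nonneg of_nat_0_le_iff)
  then obtain m where m: "dist (e t) m + dist m (e 0) = dist (e t) (e 0)" "dist m (proj L (e t)) \<le> B"
    using contractingE[OF contr] by blast
  define d where "d = dist m (e 0)"
  have dt: "d \<le> \<bar>t\<bar>" using m(1) zero_le_dist[of "e t" m] de[of t 0] unfolding d_def diff_0_right by linarith
  have "dist (proj L (e t)) (proj L (e 0)) \<le> B + d + dist (e 0) (proj L (e 0))"
    using m(2) dist_triangle[of "proj L (e t)" "proj L (e 0)" m] dist_triangle[of m "proj L (e 0)" "e 0"]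
    by (simp add: d_def dist_commute)
  hence d: "real N * a \<le> d" using far B_nonneg unfolding H_def by linarith
  define sg where "sg = (if 0 \<le> t then 1 else - 1 :: int)"
  have "m = e (of_int sg * d)"
  proof (rule between_unique[of "e 0" m "e t"])
    have "\<bar>of_int sg * d\<bar> = d" by (auto simp: sg_def d_def)
    thus "dist (e 0) m = dist (e 0) (e (of_int sg * d))" by (simp add: de) (simp add: d_def dist_commute)
    show "dist (e 0) (e (of_int sg * d)) + dist (e (of_int sg * d)) (e t) = dist (e 0) (e t)"
      using dt by (auto simp: de sg_def d_def)
    show "dist (e 0) m + dist m (e t) = dist (e 0) (e t)" using m(1) by (simp add: dist_commute)
  qed
  hence hm: "dist (e (of_int sg * d)) (proj L (e (of_int sg * d))) \<le> H"
    using m(2) proj_le[OF line proj_in[OF line], of m "e t"] by (simp add: H_def)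
  have "commensurating h"
  proof (rule commensurating_if_near[OF h])
    let ?I = "(\<lambda>i. sg * int i) ` {..<N}"
    have "inj_on (\<lambda>i. sg * int i) {..<N}" by (auto simp: inj_on_def sg_def)
    hence "card ?I = N" by (simp add: card_image)
    thus "card {x \<in> carrier G. len x \<le> H + a} < card ?I" by (simp add: N_def)
    fix i assume "i \<in> ?I"
    then obtain n where n: "n < N" "i = sg * int n" by auto
    have na: "real n * a \<le> d" using n a by (intro order_trans[OF mult_right_mono d]) auto
    have ia: "of_int i * a = of_int sg * (real n * a)" using n by simp
    have along: "dist (e 0) (e (of_int sg * x)) + dist (e (of_int sg * x)) (e (of_int sg * y)) = dist (e 0) (e (of_int sg * y))"
      if "0 \<le> x" "x \<le> y" for x y using that by (cases "0 \<le> t") (auto simp: de sg_def)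
    have "dist (e (of_int i * a)) (proj L (e (of_int i * a))) \<le> H"
    proof (rule height_between[OF line])
      show "dist (e 0) (e (of_int i * a)) + dist (e (of_int i * a)) (e (of_int sg * d)) = dist (e 0) (e (of_int sg * d))"
        unfolding ia by (rule along) (use a na in auto)
    qed (use hm in \<open>auto simp: H_def\<close>)
    thus "dist (\<phi> h (c (of_int i * a))) (proj L (\<phi> h (c (of_int i * a)))) \<le> H" by (simp add: e_def)
  qed
  thus False using assms by blast
qed

text \<open>The bound does not depend on \<open>h\<close>. The height along \<open>h L\<close> is
  periodic, some point of \<open>h L\<close> is within \<open>B\<close> of \<open>L\<close> by
  contraction, and \<open>e 0\<close> lies between this point and a translate of it, so convexity of
  the height applies.\<close>

lemma commensurating_near:
  assumes "commensurating h"
  shows "dist (\<phi> h bp) (proj L (\<phi> h bp)) \<le> B"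
proof -
  obtain k l where kl: "h \<in> carrier G" "k \<noteq> 0" "l \<noteq> 0" "h \<otimes> gpow k = gpow l \<otimes> h"
    using assms unfolding commensurating_def by blast
  have kln: "h \<otimes> gpow (k * int n) = gpow (l * int n) \<otimes> h" for n
  proof (induction n)
    case (Suc n)
    have "h \<otimes> gpow (k * int (Suc n)) = h \<otimes> gpow (k * int n) \<otimes> gpow k"
      using kl pow_add[of "k * int n" k] by (simp add: m_assoc algebra_simps)
    also have "\<dots> = gpow (l * int n) \<otimes> (h \<otimes> gpow k)" using kl Suc by (simp add: m_assoc)
    also have "\<dots> = gpow (l * int (Suc n)) \<otimes> h"
      using kl(1,4) pow_add[of "l * int n" l] by (simp add: m_assoc algebra_simps)
    finally show ?case .
  qed (use kl in simp)
  define e where "e t = \<phi> h (c t)" for t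
  have de: "dist (e s) (e t) = \<bar>s - t\<bar>" for s t using kl by (simp add: e_def act_dist dist_axis)
  have e_shift: "e (t + of_int (k * int n) * a) = \<phi> (gpow (l * int n)) (e t)" for t n
    using kl(1) kln[of n] unfolding e_def by (metis act_mult act_pow pow_closed)
  have height_shift: "dist (e (t + of_int (k * int n) * a)) (proj L (e (t + of_int (k * int n) * a)))
      = dist (e t) (proj L (e t))" for t n
    by (simp only: e_shift proj_pow) (simp add: act_dist)
  obtain N :: nat where N: "B < real N * a" using a reals_Archimedean3 by blast
  have "dist (proj L (e (of_int (k * int N) * a))) (proj L (e 0)) = \<bar>of_int (l * int N) * a\<bar>"
  proof -
    obtain s where s: "proj L (e 0) = c s" using proj_in[OF line, of "e 0"] by auto
    show ?thesis using e_shift[of 0 N] by (simp add: proj_pow s act_pow dist_axis)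
  qed
  also have "\<dots> = \<bar>of_int l\<bar> * (real N * a)" using a by (simp add: abs_mult)
  also have "1 * (real N * a) \<le> \<bar>of_int l\<bar> * (real N * a)" using kl(3) a by (intro mult_right_mono) auto
  finally have "B < dist (proj L (e (of_int (k * int N) * a))) (proj L (e 0))" using N by simp
  then obtain m where m: "dist (e (of_int (k * int N) * a)) m + dist m (e 0) = dist (e (of_int (k * int N) * a)) (e 0)"
    "dist m (proj L (e (of_int (k * int N) * a))) \<le> B"
    using contractingE[OF contr] by blast
  define T where "T = of_int (k * int N) * a"
  define d where "d = dist m (e 0)"
  have dT: "d \<le> \<bar>T\<bar>" using m(1) zero_le_dist[of "e T" m] de[of T 0] unfolding T_def[symmetric] d_def diff_0_right by linarith
  define r where "r = (if 0 \<le> T then d else - d)"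
  have "m = e r"
  proof (rule between_unique[of "e 0" m "e T"])
    show "dist (e 0) m = dist (e 0) (e r)" by (simp add: de r_def) (simp add: d_def dist_commute)
    show "dist (e 0) (e r) + dist (e r) (e T) = dist (e 0) (e T)"
      using dT by (auto simp: de r_def d_def)
    show "dist (e 0) m + dist m (e T) = dist (e 0) (e T)" using m(1) by (simp add: T_def dist_commute)
  qed
  hence er: "dist (e r) (proj L (e r)) \<le> B"
    using m(2) proj_le[OF line proj_in[OF line], of m "e T"] by (simp add: T_def)
  \<comment> \<open>Since \<open>r\<close> lies between 0 and \<open>T\<close>, the parameters
    \<open>r - T\<close> and \<open>r\<close> enclose 0.\<close>
  have rT: "dist (e (r - T)) (proj L (e (r - T))) \<le> B"
    using height_shift[of "r - T" N] er by (simp add: T_def)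
  have "dist (e 0) (proj L (e 0)) \<le> B"
  proof (rule height_between[OF line _ er rT])
    show "dist (e r) (e 0) + dist (e 0) (e (r - T)) = dist (e r) (e (r - T))"
      using dT by (auto simp: de r_def d_def)
  qed
  thus ?thesis by (simp add: e_def)
qed

text \<open>An infinite set of commensurating elements yields, by pigeonhole, a nontrivial power of
  \<open>g\<close> in \<open>N\<close>. Conjugates of its powers by any \<open>x\<close> stay in
  \<open>N\<close>, hence near \<open>L\<close>, so \<open>x\<close> is commensurating too. Then all
  of \<open>G\<close> is at bounded distance from the powers of \<open>g\<close>.\<close>

lemma elementary_if_all_commensurating:
  assumes N: "N \<lhd> G" "infinite N" and all: "\<And>h. h \<in> N \<Longrightarrow> commensurating h"
  shows "elementary G"
proof -
  interpret N: normal N G by fact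
  have fin: "finite {x \<in> carrier G. len x \<le> r}" for r
    using finite_displacement[of bp r] unfolding len_def by simp
  have coset: "\<exists>j. inv (gpow j) \<otimes> h \<in> {x \<in> carrier G. len x \<le> B + a}" if h: "commensurating h" for h
  proof -
    have hG: "h \<in> carrier G" using h by (simp add: commensurating_def)
    obtain j where j: "dist (\<phi> h bp) (\<phi> (gpow j) bp) \<le> B + a" using near_orbit[OF commensurating_near[OF h]] .
    have "len (inv (gpow j) \<otimes> h) = dist (\<phi> h bp) (\<phi> (gpow j) bp)"
      unfolding len_def using hG by (simp add: act_mult dist_commute[of bp] act_inv_dist)
    thus ?thesis using j hG by (intro exI[of _ j]) simp
  qed
  then obtain j where j: "\<And>h. commensurating h \<Longrightarrow> inv (gpow (j h)) \<otimes> h \<in> {x \<in> carrier G. len x \<le> B + a}" by metis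
  have "\<exists>h\<in>N. \<exists>h'\<in>N. h \<noteq> h' \<and> inv (gpow (j h)) \<otimes> h = inv (gpow (j h')) \<otimes> h'"
  proof (rule ccontr)
    assume "\<not> ?thesis"
    hence "inj_on (\<lambda>h. inv (gpow (j h)) \<otimes> h) N" by (auto simp: inj_on_def)
    moreover have "finite ((\<lambda>h. inv (gpow (j h)) \<otimes> h) ` N)"
      by (rule finite_subset[OF _ fin[of "B + a"]]) (use j all in blast)
    ultimately show False using N(2) finite_imageD by blast
  qed
  then obtain h h' where hh: "h \<in> N" "h' \<in> N" "h \<noteq> h'" "inv (gpow (j h)) \<otimes> h = inv (gpow (j h')) \<otimes> h'" by blast
  have hG: "h \<in> carrier G" "h' \<in> carrier G" using hh N.subset by auto
  define k where "k = j h - j h'"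
  have eq: "h = gpow k \<otimes> h'" unfolding k_def using cancel_eq[OF hG hh(4)] .
  have k0: "k \<noteq> 0" using eq hh hG by auto
  have "gpow k = h \<otimes> inv h'" using eq hG by (simp add: m_assoc)
  hence kN: "gpow k \<in> N" using hh by (simp add: N.m_closed)
  have knN: "gpow (k * int n) \<in> N" for n
    using N.subgroup_axioms kN by (induction n) (simp_all add: pow_add distrib_left N.m_closed N.one_closed)
  have all_comm: "commensurating x" if x: "x \<in> carrier G" for x
  proof -
    define H where "H = B + len (inv x)"
    define M where "M = card {y \<in> carrier G. len y \<le> H + a} + 1"
    let ?I = "(\<lambda>n. k * int n) ` {..<M}"
    have "inj_on (\<lambda>n. k * int n) {..<M}" using k0 by (auto simp: inj_on_def)
    hence "card ?I = M" by (simp add: card_image)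
    hence card: "card {y \<in> carrier G. len y \<le> H + a} < card ?I" by (simp add: M_def)
    show ?thesis
    proof (rule commensurating_if_near[OF x card])
      fix i assume "i \<in> ?I"
      hence iN: "gpow i \<in> N" using knN by auto
      let ?y = "x \<otimes> gpow i \<otimes> inv x"
      have "?y \<in> N" using N.inv_op_closed2[OF x iN] .
      hence "dist (\<phi> ?y bp) (proj L (\<phi> ?y bp)) \<le> B" using all commensurating_near by blast
      moreover have "dist (\<phi> ?y bp) (\<phi> x (\<phi> (gpow i) bp)) = len (inv x)"
        using x by (simp add: act_mult act_dist len_def dist_commute)
      ultimately show "dist (\<phi> x (c (of_int i * a))) (proj L (\<phi> x (c (of_int i * a)))) \<le> H"
        using height_lipschitz[OF line, of "\<phi> x (\<phi> (gpow i) bp)" "\<phi> ?y bp"] by (simp add: H_def act_pow)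
    qed
  qed
  define P where "P = range gpow"
  have P: "subgroup P G" unfolding P_def using subgroup_of_powers[OF g] by simp
  have "cyclic_group (G\<lparr>carrier := P\<rparr>)"
  proof -
    have "P = generate G {g}" unfolding P_def by (auto simp: generate_pow[OF g])
    hence "G\<lparr>carrier := P\<rparr> = subgroup_generated G {g}" using g by (simp add: subgroup_generated_def)
    thus ?thesis using cyclic_group_generated by simp
  qed
  moreover have "finite (rcosets P)"
  proof (rule finite_subset)
    show "rcosets P \<subseteq> (\<lambda>x. P #> x) ` {x \<in> carrier G. len x \<le> B + a}"
    proof
      fix A assume "A \<in> rcosets P"
      then obtain x where x: "x \<in> carrier G" "A = P #> x" by (auto simp: RCOSETS_def)
      have y: "inv (gpow (j x)) \<otimes> x \<in> {x \<in> carrier G. len x \<le> B + a}" by (rule j[OF all_comm[OF x(1)]])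
      have "inv (gpow (j x)) \<in> P" by (rule subgroup.m_inv_closed[OF P]) (simp add: P_def)
      hence "inv (gpow (j x)) \<otimes> x \<in> P #> x" by (auto simp: r_coset_def)
      hence "P #> x = P #> (inv (gpow (j x)) \<otimes> x)" by (rule repr_independence[OF _ x(1) P])
      thus "A \<in> (\<lambda>x. P #> x) ` {x \<in> carrier G. len x \<le> B + a}" using x y by blast
    qed
  qed (use fin in blast)
  ultimately show ?thesis unfolding elementary_def using P by blast
qed

end

section \<open>Free products along a barrier\<close>

definition (in monoid) word :: "'a \<Rightarrow> 'a list \<Rightarrow> 'a" where
  "word f ws = foldr (\<lambda>x u. x \<otimes> (f \<otimes> u)) ws \<one>"

lemma (in monoid) word_simps [simp]: "word f [] = \<one>" "word f (x # ws) = x \<otimes> (f \<otimes> word f ws)"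
  by (simp_all add: word_def)

lemma (in monoid) word_closed: "f \<in> carrier G \<Longrightarrow> set ws \<subseteq> carrier G \<Longrightarrow> word f ws \<in> carrier G"
  by (induction ws) auto

text \<open>\<open>Y\<close> is a barrier between \<open>p\<close> and \<open>f p\<close> which the letters in \<open>F\<close> neither approach nor cross.\<close>

locale barrier = isometric_action G \<phi>
  for G :: "('g, 'm) monoid_scheme" (structure) and \<phi> :: "'g \<Rightarrow> 'x::metric_space \<Rightarrow> 'x" +
  fixes p :: 'x and Y :: "'x set" and f :: 'g and F :: "'g set" and B K D :: real
  assumes K0: "0 \<le> K" and Y: "is_line Y" and contr_Y: "contracting B Y" and f: "f \<in> carrier G" and F: "F \<subseteq> carrier G"
    and before: "x \<in> F \<Longrightarrow> dist (proj Y p) (proj Y (\<phi> (inv x) p)) \<le> K"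
    and after: "x \<in> F \<Longrightarrow> dist (proj Y (\<phi> f p)) (proj Y (\<phi> f (\<phi> x p))) \<le> K"
    and D: "dist (\<phi> f p) (proj Y (\<phi> f p)) \<le> D" "dist (\<phi> f p) p \<le> D"
    and long: "x \<in> F \<Longrightarrow> 20 * (B + K + D) < dist p (\<phi> x p)"
    and wide: "2 * K + 4 * B < dist (proj Y p) (proj Y (\<phi> f p))"
    and separated: "x \<in> F \<Longrightarrow> y \<in> F \<Longrightarrow> x \<noteq> y \<Longrightarrow> 20 * (B + K + D) < dist (\<phi> x p) (\<phi> y p)"
    and not_past: "x \<in> F \<Longrightarrow> y \<in> F \<Longrightarrow> dist p (\<phi> x p) < dist p (\<phi> y p) \<Longrightarrow>
      K + 6 * B < dist (proj Y (\<phi> f p)) (proj Y (\<phi> (inv x) (\<phi> y p)))"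
begin

lemma B0: "0 \<le> B"
  using contr_Y by (simp add: contracting_def)

lemma D0: "0 \<le> D"
  using D(2) zero_le_dist[of "\<phi> f p" p] by linarith

text \<open>By \<open>wide\<close>, more than \<open>B\<close> of the barrier remains between the
  two projections after subtracting \<open>K\<close> at one end and \<open>K + 3 * B\<close> at the
  other.\<close>

lemma passes_barrier:
  assumes x: "x \<in> F" and v: "dist (proj Y (\<phi> f p)) (proj Y v) \<le> K + 3 * B"
  obtains m where "dist v m + dist m (\<phi> (inv x) p) = dist v (\<phi> (inv x) p)" "dist m (proj Y v) \<le> B"
    "dist m (\<phi> f p) \<le> K + 4 * B + D"
proof -
  have "dist (proj Y p) (proj Y (\<phi> f p))
      \<le> dist (proj Y p) (proj Y (\<phi> (inv x) p)) + dist (proj Y v) (proj Y (\<phi> (inv x) p)) + dist (proj Y (\<phi> f p)) (proj Y v)"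
    using dist_triangle[of "proj Y p" "proj Y (\<phi> f p)" "proj Y (\<phi> (inv x) p)"]
      dist_triangle[of "proj Y (\<phi> (inv x) p)" "proj Y (\<phi> f p)" "proj Y v"]
    by (simp add: dist_commute)
  hence "B < dist (proj Y v) (proj Y (\<phi> (inv x) p))" using before[OF x] v wide by linarith
  then obtain m where m: "dist v m + dist m (\<phi> (inv x) p) = dist v (\<phi> (inv x) p)" "dist m (proj Y v) \<le> B"
    using contractingE[OF contr_Y] by blast
  have "dist m (\<phi> f p) \<le> dist m (proj Y v) + dist (proj Y (\<phi> f p)) (proj Y v) + dist (\<phi> f p) (proj Y (\<phi> f p))"
    using dist_triangle[of m "\<phi> f p" "proj Y v"] dist_triangle[of "proj Y v" "\<phi> f p" "proj Y (\<phi> f p)"]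
    by (simp add: dist_commute)
  thus ?thesis using that[OF m] m v D by linarith
qed

text \<open>The geodesic from \<open>f p\<close> to \<open>f w p\<close> passes near \<open>f x p\<close>, where \<open>x\<close> is the first letter;
  it would have to come back from there in order to make progress along \<open>Y\<close>.\<close>

lemma word_stays_behind:
  assumes "set ws \<subseteq> F"
  shows "dist (proj Y (\<phi> f p)) (proj Y (\<phi> f (\<phi> (word f ws) p))) \<le> K + 3 * B"
  using assms
proof (induction ws)
  case Nil
  show ?case using B0 K0 by (simp add: act_one)
next
  case (Cons x ws)
  have x: "x \<in> F" "x \<in> carrier G" and ws: "set ws \<subseteq> carrier G" using Cons.prems F by auto
  let ?w = "\<phi> (word f ws) p" and ?P = "proj Y"
  let ?z = "\<phi> f (\<phi> x (\<phi> f ?w))"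
  have z: "\<phi> f (\<phi> (word f (x # ws)) p) = ?z" using x f ws by (simp add: act_mult word_closed)
  obtain m0 where m0: "dist (\<phi> f ?w) m0 + dist m0 (\<phi> (inv x) p) = dist (\<phi> f ?w) (\<phi> (inv x) p)"
     "dist m0 (\<phi> f p) \<le> K + 4 * B + D"
    using passes_barrier[OF x(1) Cons.IH] Cons.prems by auto
  define m where "m = \<phi> f (\<phi> x m0)"
  have m: "dist ?z m + dist m (\<phi> f p) = dist ?z (\<phi> f p)"
    using m0(1) x f by (simp add: m_def act_dist act_inv_dist')
  have "dist m0 p \<le> K + 4 * B + 2 * D" using m0(2) D dist_triangle[of m0 p "\<phi> f p"] by linarith
  hence mx: "dist m (\<phi> f (\<phi> x p)) \<le> K + 4 * B + 2 * D" using x f by (simp add: m_def act_dist)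
  have fx: "20 * (B + K + D) < dist (\<phi> f p) (\<phi> f (\<phi> x p))" using long[OF x(1)] f by (simp add: act_dist)
  have "dist (\<phi> f p) (\<phi> f (\<phi> x p)) \<le> D + K + dist (\<phi> f (\<phi> x p)) (?P (\<phi> f (\<phi> x p)))"
    using D(1) after[OF x(1)] dist_triangle[of "\<phi> f p" "\<phi> f (\<phi> x p)" "?P (\<phi> f p)"]
      dist_triangle[of "?P (\<phi> f p)" "\<phi> f (\<phi> x p)" "?P (\<phi> f (\<phi> x p))"]
    by (simp add: dist_commute)
  \<comment> \<open>The point \<open>\<phi> f (\<phi> x p)\<close> is farther from \<open>Y\<close>
    than from \<open>m\<close>: by \<open>after\<close> it projects near \<open>\<phi> f p\<close>,
    from which it is far by \<open>long\<close>.\<close>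
  hence "dist (?P (\<phi> f (\<phi> x p))) (?P m) \<le> 2 * B"
    using fx mx B0 D0 K0 by (intro contracting_ball Y contr_Y) (simp add: dist_commute)
  hence Pm: "dist (?P (\<phi> f p)) (?P m) \<le> K + 2 * B"
    using after[OF x(1)] dist_triangle[of "?P (\<phi> f p)" "?P m" "?P (\<phi> f (\<phi> x p))"] by linarith
  have "dist (?P m) (?P ?z) \<le> B"
  proof (rule ccontr)
    assume "\<not> ?thesis"
    hence "B < dist (?P m) (?P ?z)" by simp
    then obtain m' where m': "dist m m' + dist m' ?z = dist m ?z" "dist m' (?P m) \<le> B"
      using contractingE[OF contr_Y] by blast
    have "dist (\<phi> f p) m' \<le> dist (\<phi> f p) (?P (\<phi> f p)) + dist (?P (\<phi> f p)) (?P m) + dist m' (?P m)"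
      using dist_triangle[of "\<phi> f p" m' "?P (\<phi> f p)"] dist_triangle[of "?P (\<phi> f p)" m' "?P m"]
      by (simp add: dist_commute)
    hence 1: "dist (\<phi> f p) m' \<le> D + (K + 2 * B) + B" using D(1) Pm m'(2) by linarith
    have "dist (\<phi> f p) m \<le> dist (\<phi> f p) m'"
      using m m'(1) dist_triangle[of "\<phi> f p" ?z m'] zero_le_dist[of m m'] dist_commute[of m ?z]
        dist_commute[of ?z "\<phi> f p"] dist_commute[of m "\<phi> f p"] by linarith
    moreover have "dist (\<phi> f p) (\<phi> f (\<phi> x p)) \<le> dist (\<phi> f p) m + (K + 4 * B + 2 * D)"
      using mx dist_triangle[of "\<phi> f p" "\<phi> f (\<phi> x p)" m] by linarith
    ultimately show False using 1 fx B0 D0 K0 unfolding distrib_left by linarith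
  qed
  thus ?case unfolding z using Pm dist_triangle[of "?P (\<phi> f p)" "?P ?z" "?P m"] by linarith
qed

text \<open>Here \<open>m\<close> and \<open>n\<close> mark the copies of \<open>f\<close> after
  \<open>x\<close> and after \<open>y\<close> on one geodesic. If \<open>n\<close> comes clearly
  closer to \<open>v\<close>, the geodesic has not yet met \<open>Y\<close> at \<open>n\<close>: the
  projection of \<open>n\<close> is still near that of \<open>\<phi> f p\<close>, and
  \<open>n\<close> is far from \<open>Y\<close>. Then \<open>\<phi> (inv x) (\<phi> y p)\<close>,
  which is near \<open>n\<close>, contradicts \<open>not_past\<close>.\<close>

lemma first_letter_aux:
  assumes x: "x \<in> F" and y: "y \<in> F" and v: "dist (proj Y (\<phi> f p)) (proj Y v) \<le> K + 3 * B"
    and m: "dist v m + dist m (\<phi> (inv x) p) = dist v (\<phi> (inv x) p)" "dist m (\<phi> f p) \<le> K + 4 * B + D"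
    and n: "dist v n + dist n (\<phi> (inv x) p) = dist v (\<phi> (inv x) p)" "dist n (\<phi> (inv x) (\<phi> y (\<phi> f p))) \<le> K + 4 * B + D"
    and mn: "dist m (\<phi> (inv x) p) + (3 * K + 12 * B + 4 * D) < dist n (\<phi> (inv x) p)"
  shows False
proof -
  let ?P = "proj Y" and ?s = "\<phi> (inv x) p" and ?z = "\<phi> (inv x) (\<phi> y p)"
  have xy: "x \<in> carrier G" "y \<in> carrier G" using x y F by auto
  have nv: "dist (?P v) (?P n) \<le> B"
  proof (rule ccontr)
    assume "\<not> ?thesis"
    hence "B < dist (?P v) (?P n)" by simp
    then obtain k where k: "dist v k + dist k n = dist v n" "dist k (?P v) \<le> B"
      using contractingE[OF contr_Y] by blast
    have "dist k m \<le> dist k (?P v) + dist (?P (\<phi> f p)) (?P v) + dist (\<phi> f p) (?P (\<phi> f p)) + dist m (\<phi> f p)"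
      using dist_triangle[of k m "?P v"] dist_triangle[of "?P v" m "?P (\<phi> f p)"] dist_triangle[of "?P (\<phi> f p)" m "\<phi> f p"]
      by (simp add: dist_commute)
    hence "dist k m \<le> B + (K + 3 * B) + D + (K + 4 * B + D)" using k(2) v D(1) m(2) by linarith
    moreover have "dist k ?s \<le> dist k m + dist m ?s" by (rule dist_triangle)
    moreover have "dist n ?s \<le> dist k ?s"
      using n(1) k(1) dist_triangle[of v ?s k] zero_le_dist[of k n] by linarith
    ultimately show False using mn B0 D0 K0 by linarith
  qed
  have nf: "dist (?P (\<phi> f p)) (?P n) \<le> K + 4 * B"
    using nv v dist_triangle[of "?P (\<phi> f p)" "?P n" "?P v"] by linarith
  have "dist n ?z \<le> dist n (\<phi> (inv x) (\<phi> y (\<phi> f p))) + dist (\<phi> f p) p"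
    using dist_triangle[of n ?z "\<phi> (inv x) (\<phi> y (\<phi> f p))"] xy by (simp add: act_dist)
  hence nz: "dist n ?z \<le> K + 4 * B + 2 * D" using n(2) D(2) by linarith
  have "dist n m \<le> dist n (?P n) + dist (?P (\<phi> f p)) (?P n) + dist (\<phi> f p) (?P (\<phi> f p)) + dist m (\<phi> f p)"
    using dist_triangle[of n m "?P n"] dist_triangle[of "?P n" m "?P (\<phi> f p)"] dist_triangle[of "?P (\<phi> f p)" m "\<phi> f p"]
    by (simp add: dist_commute)
  moreover have "dist n ?s \<le> dist n m + dist m ?s" by (rule dist_triangle)
  ultimately have "dist n ?z \<le> dist n (?P n)" using mn nf nz D(1) m(2) by linarith
  hence "dist (?P n) (?P ?z) \<le> 2 * B" by (intro contracting_ball Y contr_Y)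
  hence "dist (?P (\<phi> f p)) (?P ?z) \<le> K + 6 * B"
    using nf dist_triangle[of "?P (\<phi> f p)" "?P ?z" "?P n"] by linarith
  moreover have "dist p (\<phi> x p) < dist p (\<phi> y p)"
  proof -
    have "dist n ?s \<le> dist n ?z + dist ?z ?s" by (rule dist_triangle)
    moreover have "dist ?z ?s = dist p (\<phi> y p)" using xy by (simp add: act_dist dist_commute)
    moreover have "dist p (\<phi> x p) = dist ?s p" using xy by (simp add: act_inv_dist)
    moreover have "dist ?s p \<le> dist m ?s + dist m (\<phi> f p) + dist (\<phi> f p) p"
      using dist_triangle[of ?s p m] dist_triangle[of m p "\<phi> f p"] by (simp add: dist_commute)
    ultimately show ?thesis using mn nz m(2) D(2) B0 K0 by linarith
  qed
  ultimately show False using not_past[OF x y] by linarith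
qed

text \<open>Equal words give two barrier passages on the geodesic between the same endpoints.
  Applying \<open>first_letter_aux\<close> in both directions keeps the passages close together,
  hence also \<open>\<phi> x p\<close> and \<open>\<phi> y p\<close>, against
  \<open>separated\<close>.\<close>

lemma first_letter:
  assumes x: "x \<in> F" "set ws \<subseteq> F" and y: "y \<in> F" "set ws' \<subseteq> F"
    and eq: "x \<otimes> (f \<otimes> word f ws) = y \<otimes> (f \<otimes> word f ws')"
  shows "x = y"
proof (rule ccontr)
  assume neq: "x \<noteq> y"
  have G: "x \<in> carrier G" "y \<in> carrier G" "word f ws \<in> carrier G" "word f ws' \<in> carrier G"
    using x y F f by (auto intro!: word_closed)
  let ?v = "\<phi> f (\<phi> (word f ws) p)" and ?v' = "\<phi> f (\<phi> (word f ws') p)"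
  have u: "\<phi> x ?v = \<phi> y ?v'" using arg_cong[OF eq, of "\<lambda>u. \<phi> u p"] G f by (simp add: act_mult)
  note vK = word_stays_behind[OF x(2)] and vK' = word_stays_behind[OF y(2)]
  obtain m where m: "dist ?v m + dist m (\<phi> (inv x) p) = dist ?v (\<phi> (inv x) p)" "dist m (\<phi> f p) \<le> K + 4 * B + D"
    using passes_barrier[OF x(1) vK] by blast
  obtain n where n: "dist ?v' n + dist n (\<phi> (inv y) p) = dist ?v' (\<phi> (inv y) p)" "dist n (\<phi> f p) \<le> K + 4 * B + D"
    using passes_barrier[OF y(1) vK'] by blast
  define M N U where "M = \<phi> x m" and "N = \<phi> y n" and "U = \<phi> x ?v"
  have M: "dist U M + dist M p = dist U p" "dist M (\<phi> x (\<phi> f p)) \<le> K + 4 * B + D"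
    using m G by (auto simp: M_def U_def act_inv_dist' act_dist)
  have N: "dist U N + dist N p = dist U p" "dist N (\<phi> y (\<phi> f p)) \<le> K + 4 * B + D"
    using n G by (auto simp: N_def U_def act_inv_dist' act_dist u)
  have tr: "dist ?v (\<phi> (inv x) N) + dist (\<phi> (inv x) N) (\<phi> (inv x) p) = dist ?v (\<phi> (inv x) p)"
    "dist ?v' (\<phi> (inv y) M) + dist (\<phi> (inv y) M) (\<phi> (inv y) p) = dist ?v' (\<phi> (inv y) p)"
    using M N G u by (simp_all add: act_inv_dist' act_inv act_dist U_def) 
  have xN: "\<not> dist M p + (3 * K + 12 * B + 4 * D) < dist N p"
  proof
    assume "dist M p + (3 * K + 12 * B + 4 * D) < dist N p"
    thus False using N(2) G
      by (intro first_letter_aux[OF x(1) y(1) vK m tr(1)]) (auto simp: act_inv_dist' act_inv act_dist M_def)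
  qed
  have yM: "\<not> dist N p + (3 * K + 12 * B + 4 * D) < dist M p"
  proof
    assume "dist N p + (3 * K + 12 * B + 4 * D) < dist M p"
    thus False using M(2) G
      by (intro first_letter_aux[OF y(1) x(1) vK' n tr(2)]) (auto simp: act_inv_dist' act_inv act_dist N_def)
  qed
  have "dist M N = \<bar>dist p M - dist p N\<bar>"
    using between_dist[of p M U N] between_dist[of p N U M] M(1) N(1)
    by (cases "dist p M \<le> dist p N") (auto simp: dist_commute)
  hence MN: "dist M N \<le> 3 * K + 12 * B + 4 * D" using xN yM by (auto simp: dist_commute)
  have "dist (\<phi> x p) (\<phi> y p) \<le> dist (\<phi> x p) (\<phi> x (\<phi> f p)) + dist (\<phi> x (\<phi> f p)) M + dist M N + dist N (\<phi> y (\<phi> f p)) + dist (\<phi> y (\<phi> f p)) (\<phi> y p)"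
    using dist_triangle[of "\<phi> x p" "\<phi> y p" "\<phi> x (\<phi> f p)"] dist_triangle[of "\<phi> x (\<phi> f p)" "\<phi> y p" M]
      dist_triangle[of M "\<phi> y p" N] dist_triangle[of N "\<phi> y p" "\<phi> y (\<phi> f p)"] by linarith
  also have "\<dots> \<le> D + (K + 4 * B + D) + (3 * K + 12 * B + 4 * D) + (K + 4 * B + D) + D"
    using M(2) N(2) MN D(2) G by (intro add_mono) (auto simp: act_dist dist_commute)
  also have "\<dots> = 20 * B + 5 * K + 8 * D" by simp
  also have "\<dots> \<le> 20 * (B + K + D)" using K0 D0 by simp
  finally show False using separated[OF x(1) y(1) neq] by linarith
qed

lemma word_inj: "inj_on (word f) {ws. set ws \<subseteq> F \<and> length ws = k}"
proof -
  have "ws = ws'" if "set ws \<subseteq> F" "set ws' \<subseteq> F" "length ws = length ws'" "word f ws = word f ws'" for ws ws'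
    using that(3,1,2,4)
  proof (induction ws ws' rule: list_induct2)
    case (Cons x ws y ws')
    have eq: "x \<otimes> (f \<otimes> word f ws) = y \<otimes> (f \<otimes> word f ws')" using Cons.prems by simp
    have xy: "x = y" by (rule first_letter[OF _ _ _ _ eq]) (use Cons.prems in auto)
    have G: "x \<in> carrier G" "word f ws \<in> carrier G" "word f ws' \<in> carrier G"
      using Cons.prems F f by (auto intro!: word_closed)
    have "f \<otimes> word f ws = f \<otimes> word f ws'" using eq G f xy Units_l_cancel[of x] Units_eq by (metis m_closed)
    hence "word f ws = word f ws'" using G f Units_l_cancel[of f] Units_eq by metis
    thus ?case using Cons xy by auto
  qed simp
  thus ?thesis by (auto simp: inj_on_def)
qed

end

section \<open>Shortest coset representatives\<close>

locale axis_and_normal = contracting_axis G \<phi> g c a B + normal N G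
  for G :: "('g, 'm) monoid_scheme" (structure) and \<phi> :: "'g \<Rightarrow> 'x::metric_space \<Rightarrow> 'x"
    and g c a B and N :: "'g set"
begin

definition minimal :: "'g \<Rightarrow> bool" where
  "minimal h \<longleftrightarrow> h \<in> carrier G \<and> (\<forall>y\<in>N. len h \<le> len (y \<otimes> h))"

lemma minimal_closed: "minimal h \<Longrightarrow> h \<in> carrier G"
  and minimal_le: "minimal h \<Longrightarrow> y \<in> N \<Longrightarrow> len h \<le> len (y \<otimes> h)"
  by (simp_all add: minimal_def)

text \<open>By normality, \<open>h \<otimes> y\<close> is also a left multiple of \<open>h\<close>
  by an element of \<open>N\<close>.\<close>

lemma minimal_right:
  assumes h: "minimal h" and y: "y \<in> N"
  shows "len h \<le> len (h \<otimes> y)"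
proof -
  have G: "h \<in> carrier G" "y \<in> carrier G" using minimal_closed[OF h] y subset by auto
  have "len h \<le> len (h \<otimes> y \<otimes> inv h \<otimes> h)" by (rule minimal_le[OF h inv_op_closed2[OF G(1) y]])
  thus ?thesis using G by (simp add: m_assoc)
qed

end

text \<open>The factor 100 is a round number exceeding every sum of error terms below, so that one
  passage along an axis of length \<open>real n * a\<close> outweighs them all.\<close>

locale normal_with_independent = axis_and_normal G \<phi> g c a B N
  for G :: "('g, 'm) monoid_scheme" (structure) and \<phi> :: "'g \<Rightarrow> 'x::metric_space \<Rightarrow> 'x"
    and g c a B and N :: "'g set" +
  fixes \<gamma> :: 'g and \<kappa> :: real and n :: nat
  assumes \<gamma>: "\<gamma> \<in> N"
    and out_proj: "q \<in> L \<Longrightarrow> dist (proj L (\<phi> \<gamma> q)) bp \<le> \<kappa>"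
    and back_proj: "q \<in> L \<Longrightarrow> dist (proj L (\<phi> (inv \<gamma>) q)) bp \<le> \<kappa>"
    and large: "100 * (B + \<kappa>) < real n * a"
begin

lemma \<gamma>_closed [simp]: "\<gamma> \<in> carrier G"
  using \<gamma> subset by blast

lemma \<kappa>: "0 \<le> \<kappa>"
  using out_proj[of bp] zero_le_dist order_trans by blast

text \<open>An element of \<open>N\<close> that moves \<open>bp\<close> past two long lines: out
  along \<open>L\<close>, across by \<open>\<gamma>\<close>, and along \<open>\<gamma> L\<close>
  with the opposite power. It is trivial in the quotient, so following its path is a waste for a
  shortest representative.\<close>

definition bump :: 'g where "bump = gpow (int n) \<otimes> \<gamma> \<otimes> gpow (- int n)"

text \<open>The element \<open>f = bump \<gamma> bump \<gamma> bump\<close> moves \<open>bp\<close> along the six lines \<open>Z 0\<close>, ..., \<open>Z 5\<close>, following \<open>Z i\<close>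
  from \<open>H i bp\<close> to \<open>E i bp\<close>. The outer four lines absorb what a minimal element before or after
  \<open>f\<close> may cancel, so that \<open>Z 2\<close> and \<open>Z 3\<close> remain.\<close>

fun H :: "nat \<Rightarrow> 'g" where
  "H 0 = \<one>"
| "H (Suc i) = H i \<otimes> gpow (if even i then int n else - int n) \<otimes> \<gamma>"

definition E :: "nat \<Rightarrow> 'g" where "E i = H i \<otimes> gpow (if even i then int n else - int n)"

definition Z :: "nat \<Rightarrow> 'x set" where "Z i = \<phi> (H i) ` L"

definition f where "f = E 5"

lemma H_closed [simp]: "H i \<in> carrier G"
  by (induction i) auto

lemma E_closed [simp]: "E i \<in> carrier G"
  by (simp add: E_def)

lemma H_Suc: "H (Suc i) = E i \<otimes> \<gamma>"
  by (simp add: E_def)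

declare H.simps(2) [simp del]

lemma bump_closed [simp]: "bump \<in> carrier G"
  by (simp add: bump_def)

lemma f_closed [simp]: "f \<in> carrier G"
  by (simp add: f_def)

lemma bump_N: "bump \<in> N"
  using inv_op_closed2[of "gpow (int n)" \<gamma>] \<gamma> g by (simp add: bump_def int_pow_neg)

lemma E_odd: "even i \<Longrightarrow> E (Suc i) = H i \<otimes> bump"
  by (simp add: E_def H.simps(2) bump_def m_assoc)

lemma Z_line: "is_line (Z i)" and Z_contracting: "contracting B (Z i)"
  unfolding Z_def by (auto intro: is_line_act contracting_act line contr)

lemma Z_E: "Z i = \<phi> (E i) ` L"
proof -
  have "\<phi> (E i) ` L = \<phi> (H i) ` \<phi> (gpow (if even i then int n else - int n)) ` L"
    by (auto simp: E_def act_mult image_image)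
  thus ?thesis by (simp add: act_pow_line Z_def)
qed

lemma start_in: "\<phi> (H i) bp \<in> Z i"
  by (simp add: Z_def)

lemma end_in: "\<phi> (E i) bp \<in> Z i"
  by (simp add: Z_E)

lemma start_end: "dist (\<phi> (H i) bp) (\<phi> (E i) bp) = real n * a"
  using a by (simp add: E_def act_mult act_dist act_pow dist_axis)

lemma next_proj: "p \<in> Z (Suc i) \<Longrightarrow> dist (proj (Z i) p) (\<phi> (E i) bp) \<le> \<kappa>"
  unfolding Z_E[of i] unfolding Z_def H_Suc using out_proj
  by (auto simp: act_mult proj_act line act_dist)

lemma prev_proj: "p \<in> Z i \<Longrightarrow> dist (proj (Z (Suc i)) p) (\<phi> (H (Suc i)) bp) \<le> \<kappa>"
proof -
  assume "p \<in> Z i"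
  then obtain q where q: "q \<in> L" "p = \<phi> (E i) q" unfolding Z_E by blast
  have "p = \<phi> (H (Suc i)) (\<phi> (inv \<gamma>) q)" using q by (simp add: H_Suc act_mult act_inv)
  thus ?thesis using back_proj[OF q(1)] by (simp add: Z_def proj_act line act_dist)
qed

text \<open>Consecutive lines have bounded projections to each other at the marked points. The
  inequality \<open>behrstock\<close> carries this down the chain, because on each line the two
  marked points are far apart.\<close>

lemma later_proj:
  assumes "i < j" "p \<in> Z j"
  shows "dist (proj (Z i) p) (\<phi> (E i) bp) \<le> B + \<kappa>"
  using assms(1)
proof (induction "j - i" arbitrary: i)
  case (Suc k)
  show ?case
  proof (cases "j = Suc i")
    case True
    thus ?thesis using next_proj[of p i] assms(2) B_nonneg by simp
  next
    case False
    hence "dist (proj (Z (Suc i)) p) (\<phi> (E (Suc i)) bp) \<le> B + \<kappa>" using Suc by auto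
    hence "B + \<kappa> < dist (proj (Z (Suc i)) p) (\<phi> (H (Suc i)) bp)"
      using start_end[of "Suc i"] large B_nonneg \<kappa>
        dist_triangle3[of "\<phi> (H (Suc i)) bp" "\<phi> (E (Suc i)) bp" "proj (Z (Suc i)) p"]
      unfolding distrib_left by linarith
    thus ?thesis
      by (intro behrstock[OF Z_line Z_line Z_contracting]) (auto intro: next_proj prev_proj)
  qed
qed simp

lemma earlier_proj:
  assumes "j < i" "p \<in> Z j"
  shows "dist (proj (Z i) p) (\<phi> (H i) bp) \<le> B + \<kappa>"
  using assms(1)
proof (induction i)
  case (Suc i)
  show ?case
  proof (cases "j = i")
    case True
    thus ?thesis using prev_proj[of p i] assms(2) B_nonneg by simp
  next
    case False
    hence "dist (proj (Z i) p) (\<phi> (H i) bp) \<le> B + \<kappa>" using Suc by auto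
    hence "B + \<kappa> < dist (proj (Z i) p) (\<phi> (E i) bp)"
      using start_end[of i] large B_nonneg \<kappa>
        dist_triangle3[of "\<phi> (H i) bp" "\<phi> (E i) bp" "proj (Z i) p"]
      unfolding distrib_left by linarith
    thus ?thesis
      by (intro behrstock[OF Z_line Z_line Z_contracting]) (auto intro: next_proj prev_proj)
  qed
qed simp

lemma bp_in: "bp \<in> Z 0" and f_bp_in: "\<phi> f bp \<in> Z 5"
  using end_in[of 5] by (auto simp: Z_def f_def act_one)

text \<open>From \<open>Z j\<close> to \<open>bp\<close> one has to traverse \<open>Z 1\<close>
  backwards. Stopping at its end \<open>\<phi> bump bp\<close> saves the length of that
  line.\<close>

lemma before_Z1:
  assumes "2 \<le> j" "q \<in> Z j"
  shows "dist q (\<phi> bump bp) + real n * a \<le> dist q bp + (5 * B + 3 * \<kappa>)"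
proof -
  have Ex: "E 1 = bump" "E (Suc 0) = bump" using E_odd[of 0] by simp_all
  have 1: "dist (proj (Z 1) q) (\<phi> bump bp) \<le> B + \<kappa>"
    using later_proj[of 1 j q] assms by (simp add: Ex)
  have 2: "dist (proj (Z 1) bp) (\<phi> (H 1) bp) \<le> B + \<kappa>" by (rule earlier_proj[OF _ bp_in]) simp
  have se: "dist (\<phi> (H 1) bp) (\<phi> bump bp) = real n * a" using start_end[of 1] by (simp add: Ex)
  have "proj (Z 1) (\<phi> bump bp) = \<phi> bump bp" using end_in[of 1] by (intro proj_ident Z_line) (simp add: Ex)
  hence "dist (\<phi> bump bp) (proj (Z 1) bp) \<le> dist (\<phi> bump bp) bp" using proj_lipschitz[OF Z_line, of 1 "\<phi> bump bp" bp] by simp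
  hence 3: "real n * a \<le> dist (\<phi> bump bp) bp + (B + \<kappa>)"
    using 2 se dist_triangle[of "\<phi> (H 1) bp" "\<phi> bump bp" "proj (Z 1) bp"] by (simp add: dist_commute)
  have "B < dist (proj (Z 1) q) (proj (Z 1) bp)"
    using 1 2 se large B_nonneg \<kappa> dist_triangle[of "\<phi> (H 1) bp" "\<phi> bump bp" "proj (Z 1) bp"]
      dist_triangle3[of "proj (Z 1) bp" "\<phi> bump bp" "proj (Z 1) q"]
    unfolding distrib_left dist_commute[of "\<phi> (H 1) bp" "proj (Z 1) bp"] by linarith
  hence "dist q (proj (Z 1) q) + dist (proj (Z 1) q) bp \<le> dist q bp + 2 * B"
    by (rule contracting_dist[OF Z_contracting])
  moreover have "dist q (\<phi> bump bp) \<le> dist q (proj (Z 1) q) + (B + \<kappa>)"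
    using 1 dist_triangle[of q "\<phi> bump bp" "proj (Z 1) q"] by linarith
  moreover have "dist (\<phi> bump bp) bp \<le> (B + \<kappa>) + dist (proj (Z 1) q) bp"
    using 1 dist_triangle3[of "\<phi> bump bp" bp "proj (Z 1) q"] by linarith
  ultimately show ?thesis using 3 by linarith
qed

text \<open>The mirror image of \<open>before_Z1\<close>, with \<open>Z 4\<close> traversed
  forwards.\<close>

lemma after_Z4:
  assumes "q \<in> Z 3"
  shows "dist q (\<phi> (H 4) bp) + real n * a \<le> dist q (\<phi> f bp) + (5 * B + 3 * \<kappa>)"
proof -
  have 1: "dist (proj (Z 4) q) (\<phi> (H 4) bp) \<le> B + \<kappa>" by (rule earlier_proj[OF _ assms]) simp
  have 2: "dist (proj (Z 4) (\<phi> f bp)) (\<phi> (E 4) bp) \<le> B + \<kappa>" by (rule later_proj[OF _ f_bp_in]) simp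
  have "proj (Z 4) (\<phi> (H 4) bp) = \<phi> (H 4) bp" by (intro proj_ident Z_line start_in)
  hence "dist (\<phi> (H 4) bp) (proj (Z 4) (\<phi> f bp)) \<le> dist (\<phi> (H 4) bp) (\<phi> f bp)"
    using proj_lipschitz[OF Z_line, of 4 "\<phi> (H 4) bp" "\<phi> f bp"] by simp
  hence 3: "real n * a \<le> dist (\<phi> (H 4) bp) (\<phi> f bp) + (B + \<kappa>)"
    using 2 start_end[of 4] dist_triangle[of "\<phi> (H 4) bp" "\<phi> (E 4) bp" "proj (Z 4) (\<phi> f bp)"] by linarith
  have "B < dist (proj (Z 4) q) (proj (Z 4) (\<phi> f bp))"
    using 1 2 start_end[of 4] large B_nonneg \<kappa>
      dist_triangle[of "\<phi> (H 4) bp" "\<phi> (E 4) bp" "proj (Z 4) (\<phi> f bp)"]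
      dist_triangle3[of "\<phi> (H 4) bp" "proj (Z 4) (\<phi> f bp)" "proj (Z 4) q"]
    unfolding distrib_left by linarith
  hence "dist q (proj (Z 4) q) + dist (proj (Z 4) q) (\<phi> f bp) \<le> dist q (\<phi> f bp) + 2 * B"
    by (rule contracting_dist[OF Z_contracting])
  moreover have "dist q (\<phi> (H 4) bp) \<le> dist q (proj (Z 4) q) + (B + \<kappa>)"
    using 1 dist_triangle[of q "\<phi> (H 4) bp" "proj (Z 4) q"] by linarith
  moreover have "dist (\<phi> (H 4) bp) (\<phi> f bp) \<le> (B + \<kappa>) + dist (proj (Z 4) q) (\<phi> f bp)"
    using 1 dist_triangle3[of "\<phi> (H 4) bp" "\<phi> f bp" "proj (Z 4) q"] by linarith
  ultimately show ?thesis using 3 by linarith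
qed

text \<open>Otherwise the geodesic from \<open>bp\<close> to \<open>inv h bp\<close> follows the path of \<open>bump\<close>, and \<open>h \<otimes> bump\<close> is shorter.\<close>

lemma minimal_before:
  assumes h: "minimal h" and j: "2 \<le> j"
  shows "dist (proj (Z j) bp) (proj (Z j) (\<phi> (inv h) bp)) \<le> B"
proof (rule ccontr)
  assume "\<not> ?thesis"
  hence "B < dist (proj (Z j) (\<phi> (inv h) bp)) (proj (Z j) bp)" by (simp add: dist_commute)
  hence 1: "dist (\<phi> (inv h) bp) (proj (Z j) (\<phi> (inv h) bp)) + dist (proj (Z j) (\<phi> (inv h) bp)) bp
      \<le> dist (\<phi> (inv h) bp) bp + 2 * B"
    by (rule contracting_dist[OF Z_contracting])
  have hG: "h \<in> carrier G" using minimal_closed[OF h] by auto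
  have "dist (\<phi> (inv h) bp) bp = len h" "dist (\<phi> (inv h) bp) (\<phi> bump bp) = len (h \<otimes> bump)"
    using hG by (simp_all add: act_inv_dist len_def act_mult)
  moreover have "len h \<le> len (h \<otimes> bump)" by (rule minimal_right[OF h bump_N])
  moreover have "dist (\<phi> (inv h) bp) (\<phi> bump bp)
      \<le> dist (\<phi> (inv h) bp) (proj (Z j) (\<phi> (inv h) bp)) + dist (proj (Z j) (\<phi> (inv h) bp)) (\<phi> bump bp)"
    by (rule dist_triangle)
  moreover note before_Z1[OF j proj_in[OF Z_line], of "\<phi> (inv h) bp"]
  ultimately show False using 1 large B_nonneg \<kappa> unfolding distrib_left by linarith
qed

text \<open>A geodesic from \<open>\<phi> f bp\<close> to \<open>\<phi> f (\<phi> h bp)\<close>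
  returning to \<open>Z 3\<close> would traverse the last bump of \<open>f\<close> backwards. As
  \<open>f = H 4 \<otimes> bump\<close>, the product \<open>bump \<otimes> h\<close> would then be
  shorter than \<open>h\<close>.\<close>

lemma minimal_after:
  assumes h: "minimal h"
  shows "dist (proj (Z 3) (\<phi> f bp)) (proj (Z 3) (\<phi> f (\<phi> h bp))) \<le> B"
proof (rule ccontr)
  let ?v = "\<phi> f (\<phi> h bp)"
  assume "\<not> ?thesis"
  hence "B < dist (proj (Z 3) ?v) (proj (Z 3) (\<phi> f bp))" by (simp add: dist_commute)
  hence 1: "dist ?v (proj (Z 3) ?v) + dist (proj (Z 3) ?v) (\<phi> f bp) \<le> dist ?v (\<phi> f bp) + 2 * B"
    by (rule contracting_dist[OF Z_contracting])
  have hG: "h \<in> carrier G" using minimal_closed[OF h] by auto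
  have "f = H 4 \<otimes> bump" using E_odd[of 4] by (simp add: f_def)
  hence "dist ?v (\<phi> f bp) = len h" "dist ?v (\<phi> (H 4) bp) = len (bump \<otimes> h)"
    using hG by (simp_all add: act_dist act_mult len_def dist_commute)
  moreover have "len h \<le> len (bump \<otimes> h)" by (rule minimal_le[OF h bump_N])
  moreover have "dist ?v (\<phi> (H 4) bp) \<le> dist ?v (proj (Z 3) ?v) + dist (proj (Z 3) ?v) (\<phi> (H 4) bp)"
    by (rule dist_triangle)
  moreover note after_Z4[OF proj_in[OF Z_line], of ?v]
  ultimately show False using 1 large B_nonneg \<kappa> unfolding distrib_left by linarith
qed

lemma Z3_bp: "dist (proj (Z 3) bp) (\<phi> (H 3) bp) \<le> B + \<kappa>"
  and Z3_f: "dist (proj (Z 3) (\<phi> f bp)) (\<phi> (E 3) bp) \<le> B + \<kappa>"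
  by (rule earlier_proj[OF _ bp_in] later_proj[OF _ f_bp_in]; simp)+

text \<open>The conjugate of \<open>bump\<close> moving the start of \<open>Z 2\<close> to the end of \<open>Z 3\<close> would shorten \<open>h'\<close>.\<close>

lemma minimal_not_past:
  assumes h: "minimal h" and h': "minimal h'"
  shows "7 * B < dist (proj (Z 3) (\<phi> f bp)) (proj (Z 3) (\<phi> (inv h) (\<phi> h' bp)))"
proof (rule ccontr)
  let ?v = "\<phi> (inv h) (\<phi> h' bp)" and ?s = "\<phi> (inv h) bp"
  let ?S2 = "\<phi> (H 2) bp" and ?E3 = "\<phi> (E 3) bp" and ?S3 = "\<phi> (H 3) bp" and ?E2 = "\<phi> (E 2) bp"
  assume "\<not> ?thesis"
  hence v: "dist (proj (Z 3) (\<phi> f bp)) (proj (Z 3) ?v) \<le> 7 * B" by simp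
  have G: "h \<in> carrier G" "h' \<in> carrier G" using minimal_closed h h' by auto
  have vE: "dist (proj (Z 3) ?v) ?E3 \<le> 8 * B + \<kappa>"
    using v Z3_f dist_triangle3[of "proj (Z 3) ?v" ?E3 "proj (Z 3) (\<phi> f bp)"] by linarith
  note s3 = minimal_before[OF h, of 3] and s2 = minimal_before[OF h, of 2]
  \<comment> \<open>The line \<open>Z 3\<close> forces the geodesic from \<open>?s\<close> to
    \<open>?v\<close> close to \<open>?E3\<close>.\<close>
  have "real n * a \<le> dist (proj (Z 3) ?v) ?E3 + dist (proj (Z 3) ?v) (proj (Z 3) ?s)
      + dist (proj (Z 3) bp) (proj (Z 3) ?s) + dist (proj (Z 3) bp) ?S3"
    using start_end[of 3] dist_triangle[of ?S3 ?E3 "proj (Z 3) ?v"] dist_triangle[of ?S3 "proj (Z 3) ?v" "proj (Z 3) ?s"]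
      dist_triangle[of ?S3 "proj (Z 3) ?s" "proj (Z 3) bp"] by (simp add: dist_commute)
  hence "B < dist (proj (Z 3) ?v) (proj (Z 3) ?s)"
    using vE s3 Z3_bp large B_nonneg \<kappa> unfolding distrib_left by linarith
  hence "dist ?v (proj (Z 3) ?v) + dist (proj (Z 3) ?v) ?s \<le> dist ?v ?s + 2 * B"
    by (rule contracting_dist[OF Z_contracting])
  moreover have "dist ?v ?s = len h'" using G by (simp add: act_dist len_def dist_commute)
  moreover have "dist ?v ?E3 \<le> dist ?v (proj (Z 3) ?v) + dist (proj (Z 3) ?v) ?E3" by (rule dist_triangle)
  moreover have "dist ?s ?E3 \<le> dist (proj (Z 3) ?v) ?s + dist (proj (Z 3) ?v) ?E3" by (rule dist_triangle3)
  ultimately have A: "dist ?v ?E3 + dist ?s ?E3 \<le> len h' + 18 * B + 2 * \<kappa>" using vE by linarith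
  have bp2: "dist (proj (Z 2) bp) ?S2 \<le> B + \<kappa>" by (rule earlier_proj[OF _ bp_in]) simp
  have E32: "dist (proj (Z 2) ?E3) ?E2 \<le> B + \<kappa>" by (rule later_proj[OF _ end_in]) simp
  have sS: "dist (proj (Z 2) ?s) ?S2 \<le> 2 * B + \<kappa>"
    using bp2 s2 dist_triangle3[of "proj (Z 2) ?s" ?S2 "proj (Z 2) bp"] by linarith
  have M: "real n * a \<le> dist ?S2 (proj (Z 2) ?E3) + (B + \<kappa>)"
    using start_end[of 2] E32 dist_triangle[of ?S2 ?E2 "proj (Z 2) ?E3"] by linarith
  have "proj (Z 2) ?S2 = ?S2" by (intro proj_ident Z_line start_in)
  hence M': "real n * a \<le> dist ?S2 ?E3 + (B + \<kappa>)" using M proj_lipschitz[OF Z_line, of 2 ?S2 ?E3] by simp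
  \<comment> \<open>The line \<open>Z 2\<close> likewise forces the part from \<open>?s\<close> to
    \<open>?E3\<close> close to \<open>?S2\<close>. The stretch from \<open>?S2\<close> to
    \<open>?E3\<close> has length about \<open>real n * a\<close> and is what \<open>y\<close>
    skips.\<close>
  have "B < dist (proj (Z 2) ?s) (proj (Z 2) ?E3)"
    using sS M large B_nonneg \<kappa> dist_triangle3[of ?S2 "proj (Z 2) ?E3" "proj (Z 2) ?s"]
    unfolding distrib_left by linarith
  hence "dist ?s (proj (Z 2) ?s) + dist (proj (Z 2) ?s) ?E3 \<le> dist ?s ?E3 + 2 * B"
    by (rule contracting_dist[OF Z_contracting])
  moreover have "dist ?s ?S2 \<le> dist ?s (proj (Z 2) ?s) + dist (proj (Z 2) ?s) ?S2" by (rule dist_triangle)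
  moreover have "dist ?S2 ?E3 \<le> dist (proj (Z 2) ?s) ?S2 + dist (proj (Z 2) ?s) ?E3" by (rule dist_triangle3)
  ultimately have "dist ?v ?E3 + dist ?s ?S2 < len h'"
    using A sS M' large B_nonneg \<kappa> unfolding distrib_left by linarith
  moreover define y where "y = H 2 \<otimes> bump \<otimes> inv (H 2)"
  have yN: "y \<in> N" unfolding y_def by (rule inv_op_closed2[OF H_closed bump_N])
  hence yG: "y \<in> carrier G" using subset by blast
  have "\<phi> y ?S2 = ?E3" using E_odd[of 2] by (simp add: y_def act_mult act_inv)
  hence "dist (\<phi> y ?s) ?v \<le> dist ?s ?S2 + dist ?v ?E3"
    using dist_triangle[of "\<phi> y ?s" ?v ?E3] act_dist[OF yG, of ?s ?S2] by (simp add: dist_commute)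
  moreover have "dist (\<phi> y ?s) ?v = len (h \<otimes> inv y \<otimes> inv h \<otimes> h')"
  proof -
    have "len (h \<otimes> inv y \<otimes> inv h \<otimes> h') = dist bp (\<phi> h (\<phi> (inv y) ?v))"
      using G yG by (simp add: len_def act_mult)
    also have "\<dots> = dist ?s (\<phi> (inv y) ?v)" by (rule act_inv_dist[OF G(1), symmetric])
    also have "\<dots> = dist (\<phi> y ?s) ?v" by (rule act_inv_dist'[OF yG])
    finally show ?thesis by simp
  qed
  moreover have "len h' \<le> len (h \<otimes> inv y \<otimes> inv h \<otimes> h')"
    by (rule minimal_le[OF h' inv_op_closed2[OF G(1) m_inv_closed[OF yN]]])
  ultimately show False by linarith
qed

text \<open>\<open>Z 3\<close> is a barrier with \<open>K = B\<close>: the preceding lemmas provide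
  \<open>before\<close>, \<open>after\<close> and \<open>not_past\<close>, where
  \<open>7 * B\<close> is \<open>K + 6 * B\<close>. The bound \<open>R\<close> depends on
  \<open>f\<close> only and not on the finite set of letters chosen later.\<close>

lemma minimal_word_inj:
  "\<exists>R. \<forall>F k. F \<subseteq> Collect minimal \<longrightarrow> (\<forall>h\<in>F. R < len h) \<longrightarrow>
      (\<forall>h\<in>F. \<forall>h'\<in>F. h \<noteq> h' \<longrightarrow> R < dist (\<phi> h bp) (\<phi> h' bp)) \<longrightarrow>
      inj_on (word f) {ws. set ws \<subseteq> F \<and> length ws = k}"
proof (intro exI allI impI)
  define D where "D = dist (\<phi> f bp) (proj (Z 3) (\<phi> f bp)) + dist (\<phi> f bp) bp"
  fix F k assume F: "F \<subseteq> Collect minimal" and long: "\<forall>h\<in>F. 20 * (B + B + D) < len h"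
    and sep: "\<forall>h\<in>F. \<forall>h'\<in>F. h \<noteq> h' \<longrightarrow> 20 * (B + B + D) < dist (\<phi> h bp) (\<phi> h' bp)"
  have FG: "F \<subseteq> carrier G" using F minimal_closed by auto
  interpret barrier G \<phi> bp "Z 3" f F B B D
  proof
    show "2 * B + 4 * B < dist (proj (Z 3) bp) (proj (Z 3) (\<phi> f bp))"
      using Z3_bp Z3_f start_end[of 3] large B_nonneg \<kappa> dist_triangle3[of "\<phi> (H 3) bp" "\<phi> (E 3) bp" "proj (Z 3) bp"]
        dist_triangle[of "proj (Z 3) bp" "\<phi> (E 3) bp" "proj (Z 3) (\<phi> f bp)"]
      unfolding distrib_left by linarith
    fix h assume h: "h \<in> F"
    hence min: "minimal h" using F by blast
    show "dist (proj (Z 3) bp) (proj (Z 3) (\<phi> (inv h) bp)) \<le> B" by (rule minimal_before[OF min]) simp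
    show "dist (proj (Z 3) (\<phi> f bp)) (proj (Z 3) (\<phi> f (\<phi> h bp))) \<le> B" by (rule minimal_after[OF min])
    show "20 * (B + B + D) < dist bp (\<phi> h bp)" using long h by (simp add: len_def)
    fix h' assume h': "h' \<in> F"
    show "h \<noteq> h' \<Longrightarrow> 20 * (B + B + D) < dist (\<phi> h bp) (\<phi> h' bp)" using sep h h' by blast
    have "minimal h'" using h' F by blast
    thus "B + 6 * B < dist (proj (Z 3) (\<phi> f bp)) (proj (Z 3) (\<phi> (inv h) (\<phi> h' bp)))"
      using minimal_not_past[OF min, of h'] by simp
  qed (use FG in \<open>auto simp: Z_line Z_contracting B_nonneg D_def\<close>)
  show "inj_on (word f) {ws. set ws \<subseteq> F \<and> length ws = k}" by (rule word_inj)
qed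

end

section \<open>A free semigroup, for quotients that are finite\<close>

context contracting_axis
begin

text \<open>The barrier is now \<open>L\<close> itself, with a power of \<open>g\<close> in the role
  of \<open>f\<close>. The letters are conjugates by \<open>h\<close> of two opposite powers of
  \<open>g\<close>, so they move \<open>bp\<close> roughly along \<open>h L\<close>, whose
  projection to \<open>L\<close> is bounded.\<close>

lemma free_semigroup_ex:
  assumes h: "h \<in> carrier G" and K: "\<And>q. q \<in> L \<Longrightarrow> dist (proj L (\<phi> h q)) bp \<le> K"
  obtains f x y where "f \<in> carrier G" "x \<in> carrier G" "y \<in> carrier G" "x \<noteq> y" "1 < len x" "1 < len y"
    "\<And>k. inj_on (word f) {ws. set ws \<subseteq> {x, y} \<and> length ws = k}"
proof -
  define l where "l = len (inv h)"
  have l0: "0 \<le> l" by (simp add: l_def len_def)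
  have K0: "0 \<le> K" using K[of bp] zero_le_dist order_trans by blast
  obtain n :: nat where n: "2 * (K + l) + 4 * B < real n * a" using reals_Archimedean3[OF a] by blast
  define D where "D = real n * a"
  have D0: "0 \<le> D" using a by (simp add: D_def)
  obtain m :: nat where m: "20 * (B + (K + l) + D) + 1 + 2 * l < real m * a" using reals_Archimedean3[OF a] by blast
  define w where "w i = h \<otimes> gpow i \<otimes> inv h" for i
  have wG: "w i \<in> carrier G" for i using h by (simp add: w_def)
  have w_inv: "inv (w i) = w (- i)" for i
    using h g by (simp add: w_def inv_mult_group int_pow_neg m_assoc)
  have near: "dist (proj L (\<phi> (w i) bp)) bp \<le> K + l" for i
  proof -
    have "dist (\<phi> (w i) bp) (\<phi> h (\<phi> (gpow i) bp)) = l"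
      using h by (simp add: w_def act_mult act_dist l_def len_def dist_commute)
    hence "dist (proj L (\<phi> (w i) bp)) (proj L (\<phi> h (\<phi> (gpow i) bp))) \<le> l"
      using proj_lipschitz[OF line, of "\<phi> (w i) bp" "\<phi> h (\<phi> (gpow i) bp)"] by linarith
    moreover have "dist (proj L (\<phi> h (\<phi> (gpow i) bp))) bp \<le> K" by (rule K) (simp add: act_pow)
    ultimately show ?thesis
      using dist_triangle[of "proj L (\<phi> (w i) bp)" bp "proj L (\<phi> h (\<phi> (gpow i) bp))"] by linarith
  qed
  have apart: "\<bar>of_int i - of_int j\<bar> * a - 2 * l \<le> dist (\<phi> (w i) bp) (\<phi> (w j) bp)" for i j
  proof -
    let ?q = "\<phi> (inv h) bp"
    have ql: "dist (\<phi> (gpow i) bp) (\<phi> (gpow i) ?q) = l" for i by (simp add: act_dist l_def len_def)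
    have "dist (\<phi> (gpow i) bp) (\<phi> (gpow j) bp) = \<bar>of_int i - of_int j\<bar> * a"
      using a by (simp add: act_pow dist_axis abs_mult flip: left_diff_distrib)
    moreover have "dist (\<phi> (w i) bp) (\<phi> (w j) bp) = dist (\<phi> (gpow i) ?q) (\<phi> (gpow j) ?q)"
      using h by (simp add: w_def act_mult act_dist)
    ultimately show ?thesis
      using ql[of i] ql[of j] dist_triangle[of "\<phi> (gpow i) bp" "\<phi> (gpow j) bp" "\<phi> (gpow i) ?q"]
        dist_triangle[of "\<phi> (gpow i) ?q" "\<phi> (gpow j) bp" "\<phi> (gpow j) ?q"] by (simp add: dist_commute)
  qed
  have w0: "w 0 = \<one>" using h by (simp add: w_def)
  have wlen: "20 * (B + (K + l) + D) + 1 < len (w i)" if i: "\<bar>i\<bar> = int m" for i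
  proof -
    have "\<bar>of_int i\<bar> = (real m :: real)" using i by linarith
    thus ?thesis using apart[of 0 i] m by (simp add: w0 act_one len_def)
  qed
  have wsep: "20 * (B + (K + l) + D) < dist (\<phi> (w (int m)) bp) (\<phi> (w (- int m)) bp)"
  proof -
    have "real m * a \<le> \<bar>of_int (int m) - of_int (- int m)\<bar> * a" using a by simp
    thus ?thesis using apart[of "int m" "- int m"] m by linarith
  qed
  \<comment> \<open>The letters are inverse to each other and thus equally long, so no pair
    satisfies the premise of \<open>not_past\<close>.\<close>
  have len_eq: "len (w (- int m)) = len (w (int m))"
    using act_inv_dist[OF wG, of "int m" bp bp] by (simp add: w_inv len_def dist_commute)
  let ?F = "{w (int m), w (- int m)}"
  interpret barrier G \<phi> bp L "gpow (int n)" ?F B "K + l" D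
  proof
    have pn: "proj L (\<phi> (gpow (int n)) bp) = \<phi> (gpow (int n)) bp" by (simp add: proj_pow proj_ident[OF line])
    have pb: "proj L bp = bp" by (simp add: proj_ident[OF line])
    show "2 * (K + l) + 4 * B < dist (proj L bp) (proj L (\<phi> (gpow (int n)) bp))"
      unfolding pn pb using n a by (simp add: act_pow dist_axis)
    show "dist (\<phi> (gpow (int n)) bp) (proj L (\<phi> (gpow (int n)) bp)) \<le> D" "dist (\<phi> (gpow (int n)) bp) bp \<le> D"
      unfolding pn using D0 a by (simp_all add: act_pow dist_axis D_def)
    fix x assume x: "x \<in> ?F"
    then obtain i where i: "x = w i" "\<bar>i\<bar> = int m" by force
    show "dist (proj L bp) (proj L (\<phi> (inv x) bp)) \<le> K + l"
      using near[of "- i"] by (simp add: pb i w_inv dist_commute)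
    show "dist (proj L (\<phi> (gpow (int n)) bp)) (proj L (\<phi> (gpow (int n)) (\<phi> x bp))) \<le> K + l"
      using near[of i] by (simp add: pn pb proj_pow i act_dist dist_commute)
    show "20 * (B + (K + l) + D) < dist bp (\<phi> x bp)" using wlen[OF i(2)] by (simp add: i len_def)
    fix y assume y: "y \<in> ?F"
    show "20 * (B + (K + l) + D) < dist (\<phi> x bp) (\<phi> y bp)" if "x \<noteq> y"
      using x y that wsep by (auto simp: dist_commute)
    show "K + l + 6 * B < dist (proj L (\<phi> (gpow (int n)) bp)) (proj L (\<phi> (inv x) (\<phi> y bp)))"
      if "dist bp (\<phi> x bp) < dist bp (\<phi> y bp)"
      using x y that len_eq unfolding len_def by auto
  qed (use wG line contr K0 l0 in auto)
  show ?thesis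
  proof (rule that[of "gpow (int n)" "w (int m)" "w (- int m)"])
    have "0 \<le> 20 * (B + (K + l) + D)" using B_nonneg K0 l0 D0 by simp
    thus "1 < len (w (int m))" "1 < len (w (- int m))" using wlen[of "int m"] len_eq by auto
    show "w (int m) \<noteq> w (- int m)" using wsep \<open>0 \<le> 20 * (B + (K + l) + D)\<close> by auto
  qed (use wG word_inj in auto)
qed

end

section \<open>Counting\<close>

lemma sum_words:
  fixes w :: "'a \<Rightarrow> real"
  assumes "finite F"
  shows "(\<Sum>ws | set ws \<subseteq> F \<and> length ws = k. prod_list (map w ws)) = (\<Sum>x\<in>F. w x) ^ k"
proof (induction k)
  case 0
  have "{ws. set ws \<subseteq> F \<and> length ws = 0} = {[]}" by auto
  thus ?case by simp
next
  case (Suc k)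
  let ?W = "{ws. set ws \<subseteq> F \<and> length ws = k}"
  have "{ws. set ws \<subseteq> F \<and> length ws = Suc k} = (\<lambda>(x, ws). x # ws) ` (F \<times> ?W)"
    by (auto simp: length_Suc_conv)
  hence "(\<Sum>ws | set ws \<subseteq> F \<and> length ws = Suc k. prod_list (map w ws))
      = (\<Sum>(x, ws)\<in>F \<times> ?W. w x * prod_list (map w ws))"
    by (simp add: sum.reindex inj_on_def case_prod_unfold)
  also have "\<dots> = (\<Sum>x\<in>F. w x) * (\<Sum>ws\<in>?W. prod_list (map w ws))"
    by (simp add: sum_product sum.cartesian_product)
  finally show ?case using Suc by simp
qed

lemma sum_geometric_tail:
  fixes q :: real
  assumes q: "0 < q" "q < 1" and J: "finite J" "\<And>j. j \<in> J \<Longrightarrow> k \<le> j"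
  shows "(\<Sum>j\<in>J. q ^ j) \<le> q ^ k / (1 - q)"
proof -
  obtain m where m: "\<forall>j\<in>J. j < m" using J(1) finite_nat_set_iff_bounded by blast
  have "J \<subseteq> (\<lambda>i. k + i) ` {..<m}"
  proof
    fix j assume "j \<in> J"
    hence "k \<le> j" "j < m" using J m by auto
    thus "j \<in> (\<lambda>i. k + i) ` {..<m}" by (intro image_eqI[of _ _ "j - k"]) auto
  qed
  hence "(\<Sum>j\<in>J. q ^ j) \<le> (\<Sum>j\<in>(\<lambda>i. k + i) ` {..<m}. q ^ j)" using q by (intro sum_mono2) auto
  also have "\<dots> = (\<Sum>i<m. q ^ k * q ^ i)" by (subst sum.reindex) (auto simp: power_add)
  also have "\<dots> = q ^ k * ((1 - q ^ m) / (1 - q))" using q by (simp add: sum_distrib_left[symmetric] sum_gp_strict)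
  also have "\<dots> \<le> q ^ k * (1 / (1 - q))" using q by (intro mult_left_mono divide_right_mono) auto
  finally show ?thesis by simp
qed

section \<open>Weighted sums and growth exponents\<close>

context isometric_action
begin

lemma displacement_mult:
  assumes "x \<in> carrier G" "y \<in> carrier G"
  shows "dist p (\<phi> (x \<otimes> y) p) \<le> dist p (\<phi> x p) + dist p (\<phi> y p)"
  using dist_triangle[of p "\<phi> (x \<otimes> y) p" "\<phi> x p"] assms by (simp add: act_mult act_dist)

lemma displacement_basepoint:
  assumes "x \<in> carrier G"
  shows "dist p (\<phi> x p) \<le> dist q (\<phi> x q) + 2 * dist p q"
  using dist_triangle[of p "\<phi> x p" q] dist_triangle[of q "\<phi> x p" "\<phi> x q"] assms
  by (simp add: act_dist dist_commute)

text \<open>The weights of all words of length \<open>k\<close> sum to the \<open>k\<close>-th power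
  of the letter sum, at least 1. If the exponent were below \<open>s\<close>, counting the words by
  their rounded weight would bound the same sum by a geometric tail starting at \<open>k\<close>,
  which tends to 0.\<close>

lemma growth_lower_bound:
  assumes F: "finite F" "F \<subseteq> carrier G" and f: "f \<in> carrier G" and s: "0 < s"
    and inj: "\<And>k. inj_on (word f) {ws. set ws \<subseteq> F \<and> length ws = k}"
    and long: "\<And>x. x \<in> F \<Longrightarrow> 1 \<le> dist p (\<phi> x p)"
    and sum: "1 \<le> (\<Sum>x\<in>F. exp (- s * (dist p (\<phi> x p) + dist p (\<phi> f p))))"
  shows "ereal s \<le> growth_exponent G \<phi> b"
proof (rule ccontr)
  define N where "N r = card {g \<in> carrier G. dist b (\<phi> g b) \<le> r}" for r
  assume "\<not> ?thesis"
  hence "Limsup at_top (\<lambda>r::real. ereal (1 / r * ln (real (N r)))) < ereal s"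
    unfolding growth_exponent_def N_def by simp
  then obtain s1 where s1: "Limsup at_top (\<lambda>r::real. ereal (1 / r * ln (real (N r)))) < ereal s1" "ereal s1 < ereal s"
    using ereal_dense2 by blast
  define s' where "s' = max s1 (s / 2)"
  have s': "s' < s" "0 < s'" using s s1(2) by (auto simp: s'_def)
  have "eventually (\<lambda>r::real. ereal (1 / r * ln (real (N r))) < ereal s1) at_top"
    using s1(1) by (rule Limsup_lessD)
  hence "eventually (\<lambda>r::real. real (N r) \<le> exp (s' * r)) at_top"
    using eventually_gt_at_top[of 0]
  proof eventually_elim
    case (elim r)
    hence "1 / r * ln (real (N r)) < s'" by (simp add: s'_def less_max_iff_disj)
    hence "ln (real (N r)) < s' * r" using elim by (simp add: field_simps)
    hence less: "ln (real (N r)) \<le> s' * r" by simp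
    show ?case
    proof (cases "N r = 0")
      case False
      hence "real (N r) = exp (ln (real (N r)))" by simp
      also have "\<dots> \<le> exp (s' * r)" using less by (simp only: exp_le_cancel_iff)
      finally show ?thesis .
    qed simp
  qed
  then obtain r0 where r0: "\<And>r. r0 \<le> r \<Longrightarrow> real (N r) \<le> exp (s' * r)"
    unfolding eventually_at_top_linorder by blast
  define \<beta> where "\<beta> = dist b p"
  define wt where "wt x = dist p (\<phi> x p) + dist p (\<phi> f p)" for x
  define l where "l ws = sum_list (map wt ws)" for ws
  have "dist p (\<phi> (word f ws) p) \<le> l ws \<and> real (length ws) \<le> l ws" if "set ws \<subseteq> F" for ws
    using that
  proof (induction ws)
    case (Cons x ws)
    have G: "x \<in> carrier G" "word f ws \<in> carrier G" "f \<otimes> word f ws \<in> carrier G"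
      using Cons.prems F f by (auto intro!: word_closed m_closed)
    have "1 \<le> dist p (\<phi> x p)" using Cons.prems long by auto
    moreover have lc: "l (x # ws) = dist p (\<phi> x p) + dist p (\<phi> f p) + l ws" by (simp add: l_def wt_def)
    moreover have "dist p (\<phi> (word f ws) p) \<le> l ws" "real (length ws) \<le> l ws" using Cons by auto
    ultimately have "real (length (x # ws)) \<le> l (x # ws)" "dist p (\<phi> (word f (x # ws)) p) \<le> l (x # ws)"
      using zero_le_dist[of p "\<phi> f p"] displacement_mult[OF G(1,3), of p] displacement_mult[OF f G(2), of p]
      unfolding word_simps length_Cons of_nat_Suc by linarith+
    thus ?case by blast
  qed (auto simp: l_def act_one)
  hence disp_word: "dist p (\<phi> (word f ws) p) \<le> l ws" "real (length ws) \<le> l ws" if "set ws \<subseteq> F" for ws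
    using that by auto
  define q where "q = exp (- (s - s'))"
  have q: "0 < q" "q < 1" using s' by (auto simp: q_def)
  define C where "C = exp (2 * \<beta> * s' + s)"
  have C0: "0 < C" by (simp add: C_def)
  have main: "1 \<le> C * (q ^ k / (1 - q))" if k: "r0 \<le> real k" for k
  proof -
    let ?W = "{ws. set ws \<subseteq> F \<and> length ws = k}"
    \<comment> \<open>The estimate \<open>k \<le> h ws\<close> in (h) holds because each letter
      contributes at least 1; it makes the sum a tail.\<close>
    define h where "h ws = nat \<lceil>l ws\<rceil>" for ws
    have fW: "finite ?W" by (rule finite_lists_length_eq[OF F(1)])
    have h: "l ws \<le> real (h ws)" "real (h ws) < l ws + 1" "k \<le> h ws" if "ws \<in> ?W" for ws
    proof -
      have "real k \<le> l ws" using disp_word(2)[of ws] that by auto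
      thus "l ws \<le> real (h ws)" "real (h ws) < l ws + 1" "k \<le> h ws" unfolding h_def by linarith+
    qed
    have "1 \<le> (\<Sum>x\<in>F. exp (- s * wt x)) ^ k" using sum unfolding wt_def by simp
    also have "\<dots> = (\<Sum>ws\<in>?W. prod_list (map (\<lambda>x. exp (- s * wt x)) ws))" by (rule sum_words[OF F(1), symmetric])
    also have "\<dots> = (\<Sum>ws\<in>?W. exp (- s * l ws))"
    proof (rule sum.cong)
      fix ws
      show "prod_list (map (\<lambda>x. exp (- s * wt x)) ws) = exp (- s * l ws)"
        by (induction ws) (auto simp: l_def algebra_simps simp flip: exp_add)
    qed simp
    also have "\<dots> = (\<Sum>j\<in>h ` ?W. \<Sum>ws\<in>{ws \<in> ?W. h ws = j}. exp (- s * l ws))"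
      by (rule sum.image_gen[OF fW])
    also have "\<dots> \<le> (\<Sum>j\<in>h ` ?W. C * q ^ j)"
    proof (rule sum_mono)
      fix j assume "j \<in> h ` ?W"
      hence kj: "k \<le> j" using h(3) by blast
      let ?V = "{ws \<in> ?W. h ws = j}"
      have "(\<Sum>ws\<in>?V. exp (- s * l ws)) \<le> (\<Sum>ws\<in>?V. exp (- s * (real j - 1)))"
      proof (rule sum_mono)
        fix ws assume "ws \<in> ?V"
        hence "real j - 1 \<le> l ws" using h(2)[of ws] by auto
        thus "exp (- s * l ws) \<le> exp (- s * (real j - 1))" using s by simp
      qed
      also have "\<dots> = real (card ?V) * exp (- s * (real j - 1))" by simp
      also have "real (card ?V) \<le> real (N (real j + 2 * \<beta>))"
      proof -
        have "word f ` ?V \<subseteq> {g \<in> carrier G. dist b (\<phi> g b) \<le> real j + 2 * \<beta>}"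
        proof safe
          fix ws assume ws: "set ws \<subseteq> F"
          show wG: "word f ws \<in> carrier G" using ws F f by (auto intro!: word_closed)
          assume "k = length ws" "j = h ws"
          hence "dist p (\<phi> (word f ws) p) \<le> real (h ws)"
            using h(1)[of ws] disp_word(1)[OF ws] ws by auto
          thus "dist b (\<phi> (word f ws) b) \<le> real (h ws) + 2 * \<beta>"
            using displacement_basepoint[OF wG, of b p] by (simp add: \<beta>_def)
        qed
        hence "card (word f ` ?V) \<le> N (real j + 2 * \<beta>)" unfolding N_def by (intro card_mono finite_displacement)
        moreover have "card (word f ` ?V) = card ?V"
          by (rule card_image) (rule inj_on_subset[OF inj[of k]], auto)
        ultimately show ?thesis by simp
      qed
      also have "real (N (real j + 2 * \<beta>)) \<le> exp (s' * (real j + 2 * \<beta>))"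
        using k kj by (intro r0) (auto simp: \<beta>_def intro: order_trans add_increasing2)
      also have "exp (s' * (real j + 2 * \<beta>)) * exp (- s * (real j - 1)) = C * q ^ j"
        by (simp add: C_def q_def exp_of_nat_mult[symmetric] exp_add[symmetric] algebra_simps)
      finally show "(\<Sum>ws\<in>?V. exp (- s * l ws)) \<le> C * q ^ j" by (simp add: mult_right_mono)
    qed
    also have "\<dots> = C * (\<Sum>j\<in>h ` ?W. q ^ j)" by (simp add: sum_distrib_left)
    also have "\<dots> \<le> C * (q ^ k / (1 - q))"
      using C0 fW h(3) by (intro mult_left_mono sum_geometric_tail q) auto
    finally show ?thesis .
  qed
  have "(\<lambda>k. C * (q ^ k / (1 - q))) \<longlonglongrightarrow> C * (0 / (1 - q))"
    using q by (intro tendsto_intros LIMSEQ_realpow_zero) auto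
  hence "eventually (\<lambda>k. C * (q ^ k / (1 - q)) < 1) sequentially" by (intro order_tendstoD(2)) auto
  moreover have "eventually (\<lambda>k. r0 \<le> real k) sequentially"
    by (meson eventually_sequentiallyI nat_ceiling_le_eq)
  ultimately have "eventually (\<lambda>k. False) sequentially"
    by eventually_elim (use main in force)
  thus False by simp
qed

text \<open>The source of the strict inequality: the finite sum is continuous in the exponent, so it
  stays above 1 slightly beyond \<open>s\<close>.\<close>

lemma growth_greater:
  assumes F: "finite F" "F \<subseteq> carrier G" and f: "f \<in> carrier G" and s: "0 \<le> s"
    and inj: "\<And>k. inj_on (word f) {ws. set ws \<subseteq> F \<and> length ws = k}"
    and long: "\<And>x. x \<in> F \<Longrightarrow> 1 \<le> dist p (\<phi> x p)"
    and sum: "1 < (\<Sum>x\<in>F. exp (- s * (dist p (\<phi> x p) + dist p (\<phi> f p))))"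
  shows "\<exists>s1>s. ereal s1 \<le> growth_exponent G \<phi> b"
proof -
  let ?\<theta> = "\<lambda>s. \<Sum>x\<in>F. exp (- s * (dist p (\<phi> x p) + dist p (\<phi> f p)))"
  have "(?\<theta> \<longlongrightarrow> ?\<theta> s) (at_right s)" by (intro tendsto_intros)
  hence "eventually (\<lambda>t. 1 < ?\<theta> t) (at_right s)" using sum by (rule order_tendstoD(1))
  moreover have "eventually (\<lambda>t. s < t) (at_right s)" by (rule eventually_at_right_less)
  ultimately have "eventually (\<lambda>t. s < t \<and> 1 < ?\<theta> t) (at_right s)" by eventually_elim simp
  then obtain s1 where s1: "s < s1" "1 < ?\<theta> s1"
    using eventually_happens' trivial_limit_at_right_real by blast
  have "ereal s1 \<le> growth_exponent G \<phi> b"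
    by (rule growth_lower_bound[OF F f _ inj long]) (use s s1 in auto)
  thus ?thesis using s1 by blast
qed

text \<open>A maximal separated subset keeps a fixed proportion of the weight: each of its points
  stands for boundedly many points of \<open>T\<close>, whose lengths differ from its own by at most
  \<open>\<bar>R\<bar>\<close>.\<close>

lemma separated_subset:
  assumes T: "finite T" "T \<subseteq> carrier G" and s: "0 \<le> s"
  obtains F where "F \<subseteq> T" "\<And>x y. x \<in> F \<Longrightarrow> y \<in> F \<Longrightarrow> x \<noteq> y \<Longrightarrow> R < dist (\<phi> x p) (\<phi> y p)"
    "(\<Sum>x\<in>T. exp (- s * dist p (\<phi> x p))) \<le>
      real (card {g \<in> carrier G. dist p (\<phi> g p) \<le> R} + 1) * exp (s * \<bar>R\<bar>) * (\<Sum>x\<in>F. exp (- s * dist p (\<phi> x p)))"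
proof -
  define sep where "sep F \<longleftrightarrow> (\<forall>x\<in>F. \<forall>y\<in>F. x \<noteq> y \<longrightarrow> R < dist (\<phi> x p) (\<phi> y p))" for F
  have "\<exists>F. (F \<subseteq> T \<and> sep F) \<and> (\<forall>F'. F' \<subseteq> T \<and> sep F' \<longrightarrow> card F' \<le> card F)"
    using T(1) by (intro ex_has_greatest_nat[of _ "{}" _ "Suc (card T)"]) (auto simp: sep_def less_Suc_eq_le intro: card_mono)
  then obtain F where F: "F \<subseteq> T" "sep F" "\<And>F'. F' \<subseteq> T \<Longrightarrow> sep F' \<Longrightarrow> card F' \<le> card F" by blast
  have fF: "finite F" using F(1) T(1) finite_subset by blast
  have ex: "\<exists>x\<in>F. t = x \<or> dist (\<phi> x p) (\<phi> t p) \<le> R" if t: "t \<in> T" for t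
  proof (rule ccontr)
    assume neg: "\<not> ?thesis"
    hence "sep (insert t F)" using F(2) by (auto simp: sep_def dist_commute)
    moreover have "t \<notin> F" using neg by auto
    ultimately show False using F(3)[of "insert t F"] t F(1) fF by simp
  qed
  define V where "V x = {t \<in> T. t = x \<or> dist (\<phi> x p) (\<phi> t p) \<le> R}" for x
  let ?w = "\<lambda>x. exp (- s * dist p (\<phi> x p))"
  let ?K = "real (card {g \<in> carrier G. dist p (\<phi> g p) \<le> R} + 1)"
  have cV: "real (card (V x)) \<le> ?K" if x: "x \<in> F" for x
  proof -
    have xG: "x \<in> carrier G" using x F(1) T(2) by auto
    have "V x \<subseteq> insert x ((\<lambda>g. x \<otimes> g) ` {g \<in> carrier G. dist p (\<phi> g p) \<le> R})"
    proof
      fix t assume "t \<in> V x"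
      hence t: "t \<in> carrier G" "t = x \<or> dist (\<phi> x p) (\<phi> t p) \<le> R" using T(2) by (auto simp: V_def)
      show "t \<in> insert x ((\<lambda>g. x \<otimes> g) ` {g \<in> carrier G. dist p (\<phi> g p) \<le> R})"
      proof (cases "t = x")
        case False
        have "t = x \<otimes> (inv x \<otimes> t)" using t xG by (simp add: m_assoc[symmetric])
        moreover have "dist p (\<phi> (inv x \<otimes> t) p) \<le> R"
          using t xG False by (simp add: act_mult act_inv_dist')
        ultimately show ?thesis using t xG by blast
      qed simp
    qed
    hence "card (V x) \<le> card (insert x ((\<lambda>g. x \<otimes> g) ` {g \<in> carrier G. dist p (\<phi> g p) \<le> R}))"
      by (intro card_mono) (auto intro: finite_displacement)
    also have "\<dots> \<le> card ((\<lambda>g. x \<otimes> g) ` {g \<in> carrier G. dist p (\<phi> g p) \<le> R}) + 1"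
      by (simp add: card_insert_if finite_displacement)
    also have "\<dots> \<le> card {g \<in> carrier G. dist p (\<phi> g p) \<le> R} + 1"
      by (simp add: card_image_le finite_displacement)
    finally show ?thesis by linarith
  qed
  have "\<forall>t\<in>T. \<exists>x\<in>F. t \<in> V x" using ex by (simp add: V_def)
  then obtain h where h: "\<And>t. t \<in> T \<Longrightarrow> h t \<in> F \<and> t \<in> V (h t)" by metis
  have "(\<Sum>x\<in>T. ?w x) = (\<Sum>x\<in>F. \<Sum>t\<in>{t \<in> T. h t = x}. ?w t)"
    using h by (intro sum.group[symmetric] T(1) fF) auto
  also have "\<dots> \<le> (\<Sum>x\<in>F. \<Sum>t\<in>V x. ?w t)"
    using h T(1) by (intro sum_mono sum_mono2) (auto simp: V_def)
  also have "\<dots> \<le> (\<Sum>x\<in>F. ?K * exp (s * \<bar>R\<bar>) * ?w x)"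
  proof (rule sum_mono)
    fix x assume x: "x \<in> F"
    have "(\<Sum>t\<in>V x. ?w t) \<le> (\<Sum>t\<in>V x. exp (s * \<bar>R\<bar>) * ?w x)"
    proof (rule sum_mono)
      fix t assume "t \<in> V x"
      hence "t = x \<or> dist (\<phi> x p) (\<phi> t p) \<le> R" by (simp add: V_def)
      hence "dist p (\<phi> x p) \<le> dist p (\<phi> t p) + \<bar>R\<bar>"
        using dist_triangle2[of p "\<phi> x p" "\<phi> t p"] by auto
      hence "s * dist p (\<phi> x p) \<le> s * (dist p (\<phi> t p) + \<bar>R\<bar>)" using s by (intro mult_left_mono)
      thus "?w t \<le> exp (s * \<bar>R\<bar>) * ?w x" by (simp add: exp_add[symmetric] algebra_simps)
    qed
    also have "\<dots> = real (card (V x)) * (exp (s * \<bar>R\<bar>) * ?w x)" by simp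
    also have "\<dots> \<le> ?K * (exp (s * \<bar>R\<bar>) * ?w x)" using cV[OF x] by (intro mult_right_mono) auto
    finally show "(\<Sum>t\<in>V x. ?w t) \<le> ?K * exp (s * \<bar>R\<bar>) * ?w x" by (simp add: mult.assoc)
  qed
  finally have "(\<Sum>x\<in>T. ?w x) \<le> ?K * exp (s * \<bar>R\<bar>) * (\<Sum>x\<in>F. ?w x)" by (simp add: sum_distrib_left)
  thus ?thesis using that[of F] F by (auto simp: sep_def)
qed

text \<open>Cut the geodesic between two orbit points at time \<open>r\<close> and replace the cut
  by an orbit point near it. In the constant found, the 1 allows for an infimum that need not be
  attained, and \<open>4 * e\<close> for two changes of base point.\<close>

lemma quasi_convex_split:
  assumes "quasi_convex G \<phi>"
  obtains k where "0 \<le> k" "\<And>h r t. h \<in> carrier G \<Longrightarrow> 0 \<le> r \<Longrightarrow> 0 \<le> t \<Longrightarrow> dist p (\<phi> h p) \<le> r + t \<Longrightarrow>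
    \<exists>h1\<in>carrier G. \<exists>h2\<in>carrier G. h = h1 \<otimes> h2 \<and> dist p (\<phi> h1 p) \<le> r + k \<and> dist p (\<phi> h2 p) \<le> t + k"
proof -
  obtain C x where C: "0 \<le> C" and qc: "\<And>y z. y \<in> orbit G \<phi> x \<Longrightarrow> z \<in> orbit G \<phi> x \<Longrightarrow>
      \<exists>S. geodesic_segment S y z \<and> (\<forall>p\<in>S. infdist p (orbit G \<phi> x) \<le> C)"
    using assms unfolding quasi_convex_def Let_def by blast
  define e where "e = dist p x"
  have e0: "0 \<le> e" by (simp add: e_def)
  have "\<exists>h1\<in>carrier G. \<exists>h2\<in>carrier G. h = h1 \<otimes> h2 \<and> dist p (\<phi> h1 p) \<le> r + (C + 1 + 4 * e) \<and>
      dist p (\<phi> h2 p) \<le> t + (C + 1 + 4 * e)"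
    if h: "h \<in> carrier G" and rt: "0 \<le> r" "0 \<le> t" and le: "dist p (\<phi> h p) \<le> r + t" for h r t
  proof -
    define d where "d = dist x (\<phi> h x)"
    have d: "d \<le> r + t + 2 * e" using displacement_basepoint[OF h, of x p] le by (simp add: d_def e_def dist_commute)
    have orb: "x \<in> orbit G \<phi> x" "\<phi> h x \<in> orbit G \<phi> x"
      using h act_one[of x] unfolding orbit_def by (auto intro: exI[of _ \<one>] simp: eq_commute)
    obtain c where c: "geodesic_path c x (\<phi> h x)" "\<And>u. u \<in> {0..d} \<Longrightarrow> infdist (c u) (orbit G \<phi> x) \<le> C"
      using qc[OF orb] unfolding geodesic_segment_def d_def by blast
    define u where "u = min r d"
    have u: "u \<in> {0..d}" using rt by (auto simp: u_def d_def)
    have path: "c 0 = x" "c d = \<phi> h x" "\<And>s t. s \<in> {0..d} \<Longrightarrow> t \<in> {0..d} \<Longrightarrow> dist (c s) (c t) = \<bar>s - t\<bar>"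
      using c(1) unfolding geodesic_path_def d_def by auto
    have cu: "dist x (c u) = u" "dist (c u) (\<phi> h x) = d - u"
      using path(3)[of 0 u] path(3)[of u d] u by (auto simp: path(1,2))
    have "infdist (c u) (orbit G \<phi> x) < C + 1" using c(2)[OF u] by simp
    hence "(INF y\<in>orbit G \<phi> x. dist (c u) y) < C + 1" using orb by (auto simp: infdist_def split: if_splits)
    then obtain y where "y \<in> orbit G \<phi> x" "dist (c u) y < C + 1"
      using orb by (subst (asm) cINF_less_iff) auto
    then obtain h1 where h1: "h1 \<in> carrier G" "dist (c u) (\<phi> h1 x) < C + 1" unfolding orbit_def by blast
    define h2 where "h2 = inv h1 \<otimes> h"
    have h2: "h2 \<in> carrier G" "h = h1 \<otimes> h2" using h h1 by (auto simp: h2_def m_assoc[symmetric])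
    have "dist x (\<phi> h1 x) \<le> u + (C + 1)" using cu h1 dist_triangle[of x "\<phi> h1 x" "c u"] by linarith
    hence 1: "dist p (\<phi> h1 p) \<le> r + (C + 1 + 4 * e)"
      using displacement_basepoint[OF h1(1), of p x] e0 by (simp add: e_def[symmetric] u_def)
    have "dist x (\<phi> h2 x) = dist (\<phi> h1 x) (\<phi> h x)" using h h1 by (simp add: h2_def act_mult act_inv_dist')
    also have "\<dots> \<le> (C + 1) + (d - u)" using cu h1 dist_triangle3[of "\<phi> h1 x" "\<phi> h x" "c u"] by linarith
    also have "d - u \<le> t + 2 * e" using d rt e0 by (auto simp: u_def)
    finally have "dist p (\<phi> h2 p) \<le> t + (C + 1 + 4 * e)"
      using displacement_basepoint[OF h2(1), of p x] by (simp add: e_def[symmetric])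
    thus ?thesis using h1 h2 1 by blast
  qed
  thus ?thesis using that[of "C + 1 + 4 * e"] C e0 by simp
qed

end

section \<open>Balls in the quotient group\<close>

locale quasi_convex_axis = axis_and_normal G \<phi> g c a B N
  for G :: "('g, 'm) monoid_scheme" (structure) and \<phi> :: "'g \<Rightarrow> 'x::metric_space \<Rightarrow> 'x"
    and g c a B and N :: "'g set" +
  assumes qc: "quasi_convex G \<phi>"
begin

definition rep :: "'g set \<Rightarrow> 'g" where "rep A = (SOME h. h \<in> A \<and> minimal h)"

definition coset_ball :: "real \<Rightarrow> 'g set set" where
  "coset_ball r = {A \<in> rcosets N. len (rep A) \<le> r}"

lemma finite_len: "finite {h \<in> carrier G. len h \<le> r}"
  using finite_displacement[of bp r] unfolding len_def by simp

lemma minimal_in_coset: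
  assumes "A \<in> rcosets N"
  shows "\<exists>h. h \<in> A \<and> minimal h"
proof -
  obtain h0 where h0: "h0 \<in> carrier G" "A = N #> h0" using assms by (auto simp: RCOSETS_def)
  have AG: "A \<subseteq> carrier G" using h0 r_coset_subset_G subset by blast
  let ?S = "{h \<in> A. len h \<le> len h0}"
  have fS: "finite ?S" by (rule finite_subset[OF _ finite_len[of "len h0"]]) (use AG in auto)
  have "h0 \<in> ?S" using h0 rcos_self[OF h0(1)] subgroup_axioms by simp
  define m where "m = arg_min_on len ?S"
  have m: "m \<in> ?S" "\<not> (\<exists>h\<in>?S. len h < len m)"
    unfolding m_def using arg_min_if_finite[OF fS, of len] \<open>h0 \<in> ?S\<close> by blast+
  have "minimal m"
    unfolding minimal_def
  proof (intro conjI ballI)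
    show "m \<in> carrier G" using m(1) AG by auto
    fix y assume y: "y \<in> N"
    obtain n where n: "n \<in> N" "m = n \<otimes> h0" using m(1) h0 by (auto simp: r_coset_def)
    have "y \<otimes> m = y \<otimes> n \<otimes> h0" using y n h0 subset by (simp add: m_assoc subsetD)
    hence "y \<otimes> m \<in> A" using y n h0 subgroup.m_closed[OF subgroup_axioms] by (auto simp: r_coset_def)
    moreover have "y \<otimes> m \<notin> ?S" if "len (y \<otimes> m) < len m" using m(2) that by blast
    ultimately show "len m \<le> len (y \<otimes> m)" using m(1) by fastforce
  qed
  thus ?thesis using m(1) by auto
qed

lemma rep:
  assumes "A \<in> rcosets N"
  shows "rep A \<in> A" and "minimal (rep A)" and "A = N #> rep A"
proof -
  show 1: "rep A \<in> A" "minimal (rep A)"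
    using someI_ex[OF minimal_in_coset[OF assms]] unfolding rep_def by auto
  obtain h0 where h0: "h0 \<in> carrier G" "A = N #> h0" using assms by (auto simp: RCOSETS_def)
  thus "A = N #> rep A" using repr_independence[OF _ h0(1) subgroup_axioms] 1 by simp
qed

lemma rep_closed: "A \<in> rcosets N \<Longrightarrow> rep A \<in> carrier G"
  using rep(2) minimal_closed by blast

lemma rep_le:
  assumes A: "A \<in> rcosets N" and h: "h \<in> A"
  shows "len (rep A) \<le> len h"
proof -
  obtain y where "y \<in> N" "h = y \<otimes> rep A" using h rep(3)[OF A] by (auto simp: r_coset_def)
  thus ?thesis using minimal_le[OF rep(2)[OF A]] by simp
qed

lemma rep_inj: "inj_on rep (rcosets N)"
  using rep(3) by (metis inj_onI)

lemma finite_coset_ball: "finite (coset_ball r)"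
proof (rule inj_on_finite)
  show "inj_on rep (coset_ball r)" by (rule inj_on_subset[OF rep_inj]) (auto simp: coset_ball_def)
  show "rep ` coset_ball r \<subseteq> {h \<in> carrier G. len h \<le> r}" using rep_closed by (auto simp: coset_ball_def)
qed (rule finite_len)

lemma coset_ball_mono: "r \<le> t \<Longrightarrow> card (coset_ball r) \<le> card (coset_ball t)"
  by (intro card_mono finite_coset_ball) (auto simp: coset_ball_def)

lemma coset_ballI: "h \<in> carrier G \<Longrightarrow> len h \<le> r \<Longrightarrow> N #> h \<in> coset_ball r"
  using rep_le[of "N #> h" h] rcos_self[OF _ subgroup_axioms, of h] rcosetsI[OF subset, of h]
  unfolding coset_ball_def by auto

lemma one_le_card_coset_ball: "0 \<le> r \<Longrightarrow> 1 \<le> card (coset_ball r)"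
  using coset_ballI[of \<one> r] finite_coset_ball[of r] card_gt_0_iff[of "coset_ball r"]
  by (auto simp: len_def act_one Suc_le_eq)

text \<open>Split a shortest representative by quasi-convexity; the coset is the product of the
  cosets of the two factors.\<close>

lemma coset_ball_submult:
  obtains k where "0 \<le> k"
    "\<And>r t. 0 \<le> r \<Longrightarrow> 0 \<le> t \<Longrightarrow> card (coset_ball (r + t)) \<le> card (coset_ball (r + k)) * card (coset_ball (t + k))"
proof -
  obtain k where k: "0 \<le> k" "\<And>h r t. h \<in> carrier G \<Longrightarrow> 0 \<le> r \<Longrightarrow> 0 \<le> t \<Longrightarrow> dist bp (\<phi> h bp) \<le> r + t \<Longrightarrow>
    \<exists>h1\<in>carrier G. \<exists>h2\<in>carrier G. h = h1 \<otimes> h2 \<and> dist bp (\<phi> h1 bp) \<le> r + k \<and> dist bp (\<phi> h2 bp) \<le> t + k"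
    by (rule quasi_convex_split[OF qc, where p = bp]) (rule that)
  have "card (coset_ball (r + t)) \<le> card (coset_ball (r + k)) * card (coset_ball (t + k))"
    if rt: "0 \<le> r" "0 \<le> t" for r t
  proof -
    have "coset_ball (r + t) \<subseteq> (\<lambda>(A1, A2). A1 <#> A2) ` (coset_ball (r + k) \<times> coset_ball (t + k))"
    proof
      fix A assume A: "A \<in> coset_ball (r + t)"
      hence AN: "A \<in> rcosets N" and le: "dist bp (\<phi> (rep A) bp) \<le> r + t" by (auto simp: coset_ball_def len_def)
      obtain h1 h2 where h: "h1 \<in> carrier G" "h2 \<in> carrier G" "rep A = h1 \<otimes> h2" "len h1 \<le> r + k" "len h2 \<le> t + k"
        using k(2)[OF rep_closed[OF AN] rt le] unfolding len_def by blast
      have "A = (N #> h1) <#> (N #> h2)" using rep(3)[OF AN] rcos_sum[OF h(1,2)] h(3) by simp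
      thus "A \<in> (\<lambda>(A1, A2). A1 <#> A2) ` (coset_ball (r + k) \<times> coset_ball (t + k))"
        using coset_ballI[OF h(1,4)] coset_ballI[OF h(2,5)] by auto
    qed
    hence "card (coset_ball (r + t)) \<le> card (coset_ball (r + k) \<times> coset_ball (t + k))"
      by (meson card_image_le card_mono finite_SigmaI finite_coset_ball finite_imageI le_trans)
    thus ?thesis by (simp add: card_cartesian_product)
  qed
  thus ?thesis using that k(1) by blast
qed

text \<open>The distance of two cosets is an infimum of displacements of elements of one coset, by
  normality. The change of base point costs twice its distance, and the 1 covers an infimum that
  need not be attained.\<close>

lemma quotient_count:
  "card {A \<in> carrier (G Mod N). coset_dist \<phi> b N A \<le> r} \<le> card (coset_ball (r + (2 * dist b bp + 1)))"
proof (rule card_mono[OF finite_coset_ball], safe)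
  fix A assume A: "A \<in> carrier (G Mod N)" and le: "coset_dist \<phi> b N A \<le> r"
  hence AN: "A \<in> rcosets N" by (simp add: FactGroup_def)
  let ?X = "(\<lambda>(x, y). dist (\<phi> x b) (\<phi> y b)) ` (N \<times> A)"
  have "?X \<noteq> {}" using rep(1)[OF AN] subgroup.one_closed[OF subgroup_axioms] by blast
  moreover have "Inf ?X < r + 1" using le by (simp add: coset_dist_def)
  ultimately obtain x y where xy: "x \<in> N" "y \<in> A" "dist (\<phi> x b) (\<phi> y b) < r + 1"
    using cInf_lessD[of ?X "r + 1"] by auto
  obtain n where n: "n \<in> N" "y = n \<otimes> rep A" using xy(2) rep(3)[OF AN] by (auto simp: r_coset_def)
  have G: "x \<in> carrier G" "n \<in> carrier G" "rep A \<in> carrier G" using xy n subset rep_closed[OF AN] by auto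
  have yG: "y \<in> carrier G" using n G by simp
  have "len (rep A) \<le> len (inv x \<otimes> n \<otimes> rep A)" using xy n by (intro minimal_le[OF rep(2)[OF AN]]) simp
  also have "inv x \<otimes> n \<otimes> rep A = inv x \<otimes> y" using G n by (simp add: m_assoc)
  also have "len (inv x \<otimes> y) \<le> dist b (\<phi> (inv x \<otimes> y) b) + 2 * dist b bp"
    unfolding len_def using displacement_basepoint[of "inv x \<otimes> y" bp b] G yG by (simp add: dist_commute)
  also have "dist b (\<phi> (inv x \<otimes> y) b) = dist (\<phi> x b) (\<phi> y b)"
    using G yG by (simp add: act_mult act_inv_dist')
  finally show "A \<in> coset_ball (r + (2 * dist b bp + 1))" using xy(3) AN by (simp add: coset_ball_def)
qed

text \<open>Fekete's argument. Enlarging the radius by \<open>2 * k\<close> turns the approximate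
  submultiplicativity into an exact one for \<open>P\<close>, so a single ball bounds the
  exponential rate.\<close>

lemma quotient_growth_bound:
  assumes k: "0 \<le> k" and submult: "\<And>r t. 0 \<le> r \<Longrightarrow> 0 \<le> t \<Longrightarrow>
      card (coset_ball (r + t)) \<le> card (coset_ball (r + k)) * card (coset_ball (t + k))"
    and n: "1 \<le> n" and s: "ln (real (card (coset_ball (real n + 2 * k)))) / real n < s"
  shows "quotient_growth_exponent G \<phi> b N \<le> ereal s"
proof -
  define P where "P r = real (card (coset_ball (r + 2 * k)))" for r
  have P1: "1 \<le> P r" if "0 \<le> r" for r using one_le_card_coset_ball[of "r + 2 * k"] that k by (simp add: P_def)
  have P_mult: "P (r + t) \<le> P r * P t" if "0 \<le> r" "0 \<le> t" for r t
  proof -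
    have "card (coset_ball ((r + k) + (t + k))) \<le> card (coset_ball (r + k + k)) * card (coset_ball (t + k + k))"
      using that k by (intro submult) auto
    hence "real (card (coset_ball ((r + k) + (t + k)))) \<le> real (card (coset_ball (r + k + k)) * card (coset_ball (t + k + k)))"
      by (rule of_nat_mono)
    thus ?thesis by (simp add: P_def algebra_simps)
  qed
  have P_pow: "P (real (Suc m) * real n) \<le> P (real n) ^ Suc m" for m
  proof (induction m)
    case (Suc m)
    have "P (real (Suc (Suc m)) * real n) \<le> P (real n) * P (real (Suc m) * real n)"
      using P_mult[of "real n" "real (Suc m) * real n"] by (simp add: algebra_simps)
    also have "\<dots> \<le> P (real n) * P (real n) ^ Suc m" using Suc P1[of "real n"] by (intro mult_left_mono) auto
    finally show ?case by simp
  qed simp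
  define w where "w = 2 * dist b bp + 1"
  have w: "0 \<le> w" by (simp add: w_def)
  define l where "l = ln (P (real n))"
  have l: "0 \<le> l" using P1[of "real n"] by (simp add: l_def)
  have sl: "0 < s - l / n" using s by (simp add: l_def P_def)
  \<comment> \<open>Beyond \<open>r0\<close> the bounded remainder \<open>(w / n + 1) * l\<close>
    fits into the gap between \<open>l / n\<close> and \<open>s\<close>.\<close>
  define r0 where "r0 = (w / n + 1) * l / (s - l / n)"
  have "eventually (\<lambda>r::real. 0 < r \<and> r0 \<le> r) at_top"
    by (intro eventually_conj eventually_gt_at_top eventually_ge_at_top)
  hence "eventually (\<lambda>r::real. ereal (1 / r * ln (real (card
       {A \<in> carrier (G Mod N). coset_dist \<phi> b N A \<le> r}))) \<le> ereal s) at_top"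
  proof eventually_elim
    case (elim r)
    let ?c = "real (card {A \<in> carrier (G Mod N). coset_dist \<phi> b N A \<le> r})"
    define m where "m = nat \<lfloor>(r + w) / n\<rfloor>"
    have "0 \<le> (r + w) / n" using elim w by simp
    hence "(r + w) / n \<le> real (Suc m)" and m: "real (Suc m) \<le> (r + w) / n + 1"
      unfolding m_def of_nat_Suc by linarith+
    hence rw: "r + w \<le> real (Suc m) * real n" using n by (simp add: field_simps)
    have "?c \<le> real (card (coset_ball (r + w)))" using quotient_count[of b r] by (simp add: w_def)
    also have "\<dots> \<le> P (real (Suc m) * real n)"
      unfolding P_def using rw k by (intro of_nat_mono coset_ball_mono) auto
    also have "\<dots> \<le> P (real n) ^ Suc m" by (rule P_pow)
    finally have c: "?c \<le> P (real n) ^ Suc m" .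
    have "ln ?c \<le> real (Suc m) * l"
    proof (cases "?c = 0")
      case True
      hence "ln ?c = 0" by (simp only: ln_0)
      moreover have "0 \<le> real (Suc m) * l" using l by simp
      ultimately show ?thesis by linarith
    next
      case False
      hence "ln ?c \<le> ln (P (real n) ^ Suc m)" using c P1[of "real n"] by (subst ln_le_cancel_iff) auto
      moreover have "ln (P (real n) ^ Suc m) = real (Suc m) * l"
        unfolding l_def by (rule ln_realpow)
      ultimately show ?thesis by linarith
    qed
    also have "\<dots> \<le> ((r + w) / n + 1) * l" using m l by (rule mult_right_mono)
    also have "\<dots> = r * (l / n) + (w / n + 1) * l" using n by (simp add: field_simps)
    also have "\<dots> \<le> r * (l / n) + r * (s - l / n)"
    proof -
      have "(w / n + 1) * l = r0 * (s - l / n)" using sl by (simp add: r0_def)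
      also have "\<dots> \<le> r * (s - l / n)" using elim sl by (intro mult_right_mono) auto
      finally show ?thesis by simp
    qed
    also have "\<dots> = r * s" by (simp add: algebra_simps)
    finally have "ln ?c \<le> r * s" .
    thus ?case using elim by (simp add: field_simps)
  qed
  thus ?thesis unfolding quotient_growth_exponent_def by (rule Limsup_bounded)
qed

text \<open>There are at least \<open>exp (s n)\<close> cosets in the ball of radius \<open>n + 2 k\<close>, too many for a convergent series.\<close>

lemma coset_series_diverges:
  assumes k: "0 \<le> k" and s: "0 \<le> s"
    and low: "\<And>n. 1 \<le> n \<Longrightarrow> s \<le> ln (real (card (coset_ball (real n + 2 * k)))) / real n"
    and inf: "0 < s \<or> infinite (rcosets N)"
  shows "\<exists>T. finite T \<and> T \<subseteq> rcosets N \<and> S < (\<Sum>A\<in>T. exp (- s * len (rep A)))"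
proof (cases "s = 0")
  case True
  hence "infinite (rcosets N)" using inf by simp
  moreover obtain m :: nat where m: "S < real m" using reals_Archimedean2 by blast
  ultimately obtain T where "T \<subseteq> rcosets N" "finite T" "card T = m" using infinite_arbitrarily_large by blast
  thus ?thesis using True m by (intro exI[of _ T]) simp
next
  case False
  hence s0: "0 < s" using s by simp
  let ?w = "\<lambda>A. exp (- s * len (rep A))"
  let ?\<T> = "{T. finite T \<and> T \<subseteq> rcosets N}"
  show ?thesis
  proof (rule ccontr)
    assume "\<not> ?thesis"
    hence bound: "sum ?w T \<le> S" if "finite T" "T \<subseteq> rcosets N" for T using that by (meson not_le)
    hence bdd: "bdd_above (sum ?w ` ?\<T>)" by (intro bdd_aboveI2[of _ _ S]) auto
    \<comment> \<open>With this tail bound, the cosets outside a fixed ball account for at most half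
      of the \<open>exp (s * n)\<close> cosets in the ball of radius \<open>n + 2 * k\<close>. The
      other half would have to fit into the fixed ball for all \<open>n\<close>.\<close>
    define e where "e = exp (- 2 * k * s) / 2"
    have e: "0 < e" by (simp add: e_def)
    define W where "W = Sup (sum ?w ` ?\<T>)"
    have ne: "sum ?w ` ?\<T> \<noteq> {}" by auto
    have "W - e < Sup (sum ?w ` ?\<T>)" using e by (simp add: W_def)
    then obtain T0 where T0: "finite T0" "T0 \<subseteq> rcosets N" "W - e < sum ?w T0"
      using less_cSupD[OF ne] by blast
    obtain m where m: "\<And>A. A \<in> T0 \<Longrightarrow> len (rep A) \<le> m"
      using finite_imageI[OF T0(1), of "\<lambda>A. len (rep A)"] by (meson Max_ge imageI)
    have tail: "sum ?w U \<le> e" if U: "finite U" "U \<subseteq> rcosets N" "\<And>A. A \<in> U \<Longrightarrow> m < len (rep A)" for U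
    proof -
      have "T0 \<inter> U = {}" using m U(3) by force
      hence "sum ?w T0 + sum ?w U = sum ?w (T0 \<union> U)" using T0 U by (simp add: sum.union_disjoint)
      also have "\<dots> \<le> W" unfolding W_def using T0 U by (intro cSup_upper bdd) auto
      finally show ?thesis using T0(3) by linarith
    qed
    have main: "exp (s * real n) \<le> 2 * real (card (coset_ball m))" if n: "1 \<le> n" for n
    proof -
      let ?r = "real n + 2 * k"
      let ?U = "{A \<in> coset_ball ?r. m < len (rep A)}"
      have c1: "0 < real (card (coset_ball ?r))" using one_le_card_coset_ball[of ?r] k by auto
      have "s * real n \<le> ln (real (card (coset_ball ?r)))" using low[OF n] n by (simp add: field_simps)
      hence "exp (s * real n) \<le> real (card (coset_ball ?r))" using c1 by (simp add: ln_ge_iff)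
      also have "card (coset_ball ?r) \<le> card (coset_ball m \<union> ?U)"
        by (rule card_mono) (auto simp: finite_coset_ball, auto simp: coset_ball_def)
      also have "\<dots> \<le> card (coset_ball m) + card ?U" by (rule card_Un_le)
      finally have 1: "exp (s * real n) \<le> real (card (coset_ball m)) + real (card ?U)" by simp
      have "real (card ?U) * exp (- s * ?r) = (\<Sum>A\<in>?U. exp (- s * ?r))" by simp
      also have "\<dots> \<le> sum ?w ?U" using s by (intro sum_mono) (auto simp: coset_ball_def intro!: mult_left_mono)
      also have "\<dots> \<le> e" by (rule tail) (auto simp: finite_coset_ball, auto simp: coset_ball_def)
      finally have "real (card ?U) * exp (- s * ?r) * exp (s * ?r) \<le> e * exp (s * ?r)" by (rule mult_right_mono) simp
      hence "real (card ?U) \<le> e * exp (s * ?r)" by (simp add: mult.assoc exp_add[symmetric])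
      also have "\<dots> = exp (s * real n) / 2" by (simp add: e_def exp_add[symmetric] algebra_simps)
      finally show ?thesis using 1 by linarith
    qed
    obtain n :: nat where n: "2 * real (card (coset_ball m)) < real n * s" using reals_Archimedean3[OF s0] by blast
    have "1 \<le> n" using n by (cases n) auto
    hence "exp (s * real n) < s * real n" using main[of n] n by (simp add: mult.commute)
    thus False using exp_ge_add_one_self[of "s * real n"] by linarith
  qed
qed

end

locale quasi_convex_independent = quasi_convex_axis G \<phi> g c a B N + normal_with_independent G \<phi> g c a B N \<gamma> \<kappa> n
  for G :: "('g, 'm) monoid_scheme" (structure) and \<phi> :: "'g \<Rightarrow> 'x::metric_space \<Rightarrow> 'x"
    and g c a B and N :: "'g set" and \<gamma> \<kappa> n
begin

text \<open>The infimum \<open>s\<close> of the rates separates the two exponents: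
  \<open>quotient_growth_bound\<close> puts the quotient exponent below every number above
  \<open>s\<close>, and free words put the exponent of \<open>G\<close> above some \<open>t\<close>
  with \<open>s < t\<close>.\<close>

lemma growth_gap: "quotient_growth_exponent G \<phi> b N < growth_exponent G \<phi> b"
proof -
  obtain k where k: "0 \<le> k" and submult: "\<And>r t. 0 \<le> r \<Longrightarrow> 0 \<le> t \<Longrightarrow>
      card (coset_ball (r + t)) \<le> card (coset_ball (r + k)) * card (coset_ball (t + k))"
    by (rule coset_ball_submult) (rule that)
  define rate where "rate n = ln (real (card (coset_ball (real n + 2 * k)))) / real n" for n
  have rate0: "0 \<le> rate n" for n
    using one_le_card_coset_ball[of "real n + 2 * k"] k by (simp add: rate_def)
  define s where "s = (INF n\<in>{1..}. rate n)"
  have bdd: "bdd_below (rate ` {1..})" using rate0 by (intro bdd_belowI2[of _ 0]) auto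
  have s0: "0 \<le> s" unfolding s_def using rate0 by (intro cINF_greatest) auto
  have s_le: "s \<le> rate n" if "1 \<le> n" for n unfolding s_def using that by (intro cINF_lower bdd) auto
  have upper: "quotient_growth_exponent G \<phi> b N \<le> ereal t" if t: "s < t" for t
  proof -
    obtain n where "1 \<le> n" "rate n < t" using t unfolding s_def by (subst (asm) cINF_less_iff) (use bdd in auto)
    thus ?thesis unfolding rate_def by (intro quotient_growth_bound[OF k submult])
  qed
  have "\<exists>t>s. ereal t \<le> growth_exponent G \<phi> b"
  proof (cases "0 < s \<or> infinite (rcosets N)")
    case False
    \<comment> \<open>The quotient is finite and the series converges. Already two free letters
      suffice, as their weights at \<open>s = 0\<close> sum to 2.\<close>
    hence s: "s = 0" using s0 by linarith
    obtain f' x' y where f': "f' \<in> carrier G" "x' \<in> carrier G" "y \<in> carrier G" "x' \<noteq> y" "1 < len x'" "1 < len y"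
      "\<And>k. inj_on (word f') {ws. set ws \<subseteq> {x', y} \<and> length ws = k}"
      by (rule free_semigroup_ex[OF \<gamma>_closed], erule out_proj, rule that)
    show ?thesis
      by (rule growth_greater[of "{x', y}" f' s bp]) (use f' s in \<open>auto simp: len_def\<close>)
  next
    case True
    obtain R where R: "\<forall>F k. F \<subseteq> Collect minimal \<longrightarrow> (\<forall>h\<in>F. R < len h) \<longrightarrow>
      (\<forall>h\<in>F. \<forall>h'\<in>F. h \<noteq> h' \<longrightarrow> R < dist (\<phi> h bp) (\<phi> h' bp)) \<longrightarrow>
      inj_on (word f) {ws. set ws \<subseteq> F \<and> length ws = k}"
      using minimal_word_inj by blast
    define R' where "R' = max R 1"
    define M where "M = real (card {h \<in> carrier G. dist bp (\<phi> h bp) \<le> R} + 1) * exp (s * \<bar>R\<bar>)"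
    have M: "0 < M" by (simp add: M_def)
    \<comment> \<open>The bound to be exceeded pays for everything lost afterwards: the factor
      \<open>M\<close> for passing to separated letters, \<open>exp (s * len f)\<close> for the
      inserted \<open>f\<close>, and one unit for each coset too short to serve as a letter.\<close>
    obtain T where T: "finite T" "T \<subseteq> rcosets N"
      "M * exp (s * len f) + real (card (coset_ball R')) < (\<Sum>A\<in>T. exp (- s * len (rep A)))"
      using coset_series_diverges[OF k s0 s_le[unfolded rate_def] True] by blast
    define T' where "T' = {A \<in> T. R' < len (rep A)}"
    have "(\<Sum>A\<in>T. exp (- s * len (rep A))) = (\<Sum>A\<in>T'. exp (- s * len (rep A))) + (\<Sum>A\<in>T - T'. exp (- s * len (rep A)))"
      using sum.subset_diff[of T' T, OF _ T(1), of "\<lambda>A. exp (- s * len (rep A))"]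
      by (auto simp: T'_def add.commute)
    also have "(\<Sum>A\<in>T - T'. exp (- s * len (rep A))) \<le> (\<Sum>A\<in>T - T'. 1)"
      using s0 by (intro sum_mono) (simp add: len_def)
    also have "(\<Sum>A\<in>T - T'. 1 :: real) \<le> real (card (coset_ball R'))"
    proof -
      have "card (T - T') \<le> card (coset_ball R')"
        using T(2) by (intro card_mono finite_coset_ball) (auto simp: T'_def coset_ball_def)
      thus ?thesis by simp
    qed
    finally have "M * exp (s * len f) < (\<Sum>A\<in>T'. exp (- s * len (rep A)))" using T(3) by linarith
    also have "\<dots> = (\<Sum>h\<in>rep ` T'. exp (- s * dist bp (\<phi> h bp)))"
      using T(2) by (subst sum.reindex) (auto simp: T'_def len_def intro: inj_on_subset[OF rep_inj])
    finally have big: "M * exp (s * len f) < (\<Sum>h\<in>rep ` T'. exp (- s * dist bp (\<phi> h bp)))" .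
    have fin: "finite (rep ` T')" and sub: "rep ` T' \<subseteq> carrier G"
      using T rep_closed by (auto simp: T'_def)
    obtain F where F: "F \<subseteq> rep ` T'" "\<And>x y. x \<in> F \<Longrightarrow> y \<in> F \<Longrightarrow> x \<noteq> y \<Longrightarrow> R < dist (\<phi> x bp) (\<phi> y bp)"
      "(\<Sum>h\<in>rep ` T'. exp (- s * dist bp (\<phi> h bp))) \<le> M * (\<Sum>h\<in>F. exp (- s * dist bp (\<phi> h bp)))"
      by (rule separated_subset[OF fin sub s0, of R bp, folded M_def]) (rule that)
    have minF: "F \<subseteq> Collect minimal" using F(1) T(2) rep(2) by (auto simp: T'_def)
    have lenF: "R < len h" "1 < len h" if "h \<in> F" for h using that F(1) by (auto simp: T'_def R'_def)
    have "exp (s * len f) < (\<Sum>h\<in>F. exp (- s * dist bp (\<phi> h bp)))" using big F(3) M by (smt (verit) mult_le_cancel_left_pos)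
    hence "exp (s * len f) * exp (- s * len f) < (\<Sum>h\<in>F. exp (- s * dist bp (\<phi> h bp))) * exp (- s * len f)"
      by (rule mult_strict_right_mono) simp
    hence "1 < (\<Sum>h\<in>F. exp (- s * (dist bp (\<phi> h bp) + dist bp (\<phi> f bp))))"
      by (simp add: sum_distrib_right exp_add[symmetric] len_def algebra_simps)
    moreover have "inj_on (word f) {ws. set ws \<subseteq> F \<and> length ws = k}" for k
      using R minF lenF(1) F(2) by blast
    moreover have "1 \<le> dist bp (\<phi> h bp)" if "h \<in> F" for h using lenF(2)[OF that] by (simp add: len_def)
    moreover have "F \<subseteq> carrier G" using F(1) sub by blast
    ultimately show ?thesis
      by (intro growth_greater[of F f s bp] finite_subset[OF F(1) fin] f_closed s0)
  qed
  then obtain t where t: "s < t" "ereal t \<le> growth_exponent G \<phi> b" by blast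
  have "quotient_growth_exponent G \<phi> b N \<le> ereal ((s + t) / 2)" using t by (intro upper) simp
  also have "\<dots> < ereal t" using t by simp
  finally show ?thesis using t(2) by (rule less_le_trans)
qed

end

section \<open>Assembly of the growth tightness theorem\<close>

theorem theorem9p2:
  fixes G :: "('g, 'm) monoid_scheme"
    and \<phi> :: "'g \<Rightarrow> 'x::metric_space \<Rightarrow> 'x"
    and b :: 'x
  assumes "G_space G \<phi>"
    and "CAT0_space TYPE('x)"
    and "quasi_convex G \<phi>"
    and "finitely_generated G"
    and "\<not> elementary G"
    and "\<exists>g \<in> carrier G. rank_one_isometry (\<phi> g)"
  shows "growth_tight G \<phi> b"
proof -
  interpret S: G_space G \<phi> by fact
  interpret H: group_hom G "BijGroup UNIV" \<phi> by (rule S.group_hom)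
  interpret isometric_action G \<phi>
  proof unfold_locales
    show "CAT0_space TYPE('x)" by fact
    show "proper_space TYPE('x)" by (rule S.proper)
    show "\<phi> \<one>\<^bsub>G\<^esub> p = p" for p using S.id_eq_one by (metis UNIV_I restrict_apply')
    show "\<phi> (g \<otimes>\<^bsub>G\<^esub> h) p = \<phi> g (\<phi> h p)" if "g \<in> carrier G" "h \<in> carrier G" for g h p
      using S.composition_rule[of p g h] that by simp
    show "dist (\<phi> g p) (\<phi> g q) = dist p q" if "g \<in> carrier G" for g p q by (rule S.isometric[OF that])
    show "finite {g \<in> carrier G. dist p (\<phi> g p) \<le> r}" for p r
    proof (cases "0 \<le> r")
      case True
      have "finite {g \<in> carrier G. \<phi> g ` cball p r \<inter> cball p r \<noteq> {}}"
        using S.proper by (intro S.properly_discontinuous) (simp add: proper_space_def)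
      moreover have "{g \<in> carrier G. dist p (\<phi> g p) \<le> r} \<subseteq> {g \<in> carrier G. \<phi> g ` cball p r \<inter> cball p r \<noteq> {}}"
      proof
        fix g assume "g \<in> {g \<in> carrier G. dist p (\<phi> g p) \<le> r}"
        moreover from this have "\<phi> g p \<in> \<phi> g ` cball p r \<inter> cball p r" using True by auto
        ultimately show "g \<in> {g \<in> carrier G. \<phi> g ` cball p r \<inter> cball p r \<noteq> {}}" by blast
      qed
      ultimately show ?thesis by (rule finite_subset[rotated])
    next
      case False
      hence "{g \<in> carrier G. dist p (\<phi> g p) \<le> r} = {}" using zero_le_dist order_trans by blast
      thus ?thesis by (simp only: finite.emptyI)
    qed
  qed
  obtain g L where g: "g \<in> carrier G" "is_axis (\<phi> g) L" "\<not> bounds_half_flat L"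
    using assms(6) unfolding rank_one_isometry_def by blast
  obtain c :: "real \<Rightarrow> 'x" and a where c: "isometric_embedding_on UNIV c" "0 < a" "\<And>t. \<phi> g (c t) = c (t + a)" "L = range c"
    using g(2) unfolding is_axis_def by blast
  interpret A: translated_line "TYPE('x)" c a
  proof unfold_locales
    fix k
    show "\<exists>F. (\<forall>x y. dist (F x) (F y) = dist x y) \<and> (\<forall>t. F (c t) = c (t + of_int k * a))"
      using act_int_pow[of g c a, OF g(1) c(3)] g(1)
      by (intro exI[of _ "\<phi> (g [^]\<^bsub>G\<^esub> k)"]) (simp add: act_dist)
  qed (use c in auto)
  obtain B where B: "contracting B (range c)"
    using A.contracting_if_not_bounds_half_flat g(3) c(4) by blast
  interpret contracting_axis G \<phi> g c a B
    by unfold_locales (use g c B in auto)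
  show ?thesis
    unfolding growth_tight_def
  proof (intro allI impI, elim conjE)
    fix N assume N: "N \<lhd> G" "infinite N"
    obtain \<gamma> where \<gamma>: "\<gamma> \<in> N" "\<not> commensurating \<gamma>"
      using elementary_if_all_commensurating[OF N] assms(5) by blast
    interpret N: normal N G by (rule N(1))
    have \<gamma>G: "\<gamma> \<in> carrier G" using \<gamma> N.subset by blast
    \<comment> \<open>The projection of \<open>L\<close> to \<open>\<gamma> L\<close> is, after
      moving back by \<open>\<gamma>\<close>, that of the line of \<open>inv \<gamma>\<close> to
      \<open>L\<close>. So mutual boundedness requires \<open>bounded_projection\<close> for both
      elements.\<close>
    have "\<not> commensurating (inv\<^bsub>G\<^esub> \<gamma>)" using commensurating_inv[of "inv\<^bsub>G\<^esub> \<gamma>"] \<gamma>(2) \<gamma>G by auto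
    then obtain K1 K2 where K1: "\<And>p. p \<in> \<phi> \<gamma> ` range c \<Longrightarrow> dist (proj (range c) p) (c 0) \<le> K1"
      and K2: "\<And>p. p \<in> \<phi> (inv\<^bsub>G\<^esub> \<gamma>) ` range c \<Longrightarrow> dist (proj (range c) p) (c 0) \<le> K2"
      using bounded_projection[OF \<gamma>G \<gamma>(2)] bounded_projection[of "inv\<^bsub>G\<^esub> \<gamma>"] \<gamma>G by blast
    define \<kappa> where "\<kappa> = max K1 K2"
    obtain n :: nat where n: "100 * (B + \<kappa>) < real n * a" using reals_Archimedean3[OF c(2)] by blast
    interpret quasi_convex_independent G \<phi> g c a B N \<gamma> \<kappa> n
    proof unfold_locales
      show "quasi_convex G \<phi>" by fact
      show "\<gamma> \<in> N" by fact
      show "dist (proj (range c) (\<phi> \<gamma> q)) (c 0) \<le> \<kappa>" if "q \<in> range c" for q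
        using K1[of "\<phi> \<gamma> q"] that by (auto simp: \<kappa>_def le_max_iff_disj)
      show "dist (proj (range c) (\<phi> (inv\<^bsub>G\<^esub> \<gamma>) q)) (c 0) \<le> \<kappa>" if "q \<in> range c" for q
        using K2[of "\<phi> (inv\<^bsub>G\<^esub> \<gamma>) q"] that by (auto simp: \<kappa>_def le_max_iff_disj)
      show "100 * (B + \<kappa>) < real n * a" by fact
    qed
    show "quotient_growth_exponent G \<phi> b N < growth_exponent G \<phi> b" by (rule growth_gap)
  qed
qed

end
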